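(* Assume that $H\in C(\mathbb R^d)$ is convex and $H(p)>H(0)=0$ for all $p\in\mathbb R^d\setminus\{0\}$. For almost every Brownian path $B$, if $u$ is a solution, periodic in space, of $$du=H(Du)\cdot dB\quad\text{in }\mathbb R^d\times(0,\infty),$$ with $u$ bounded and uniformly continuous on $\mathbb R^d\times[0,\infty)$, then there exists a constant $u_\infty=u_\infty(B,u(\cdot,0))$ such that, as $t\to\infty$ and uniformly in $\mathbb R^d$, $u(\cdot,t)\to u_\infty$. Moreover, the random variable $u_\infty$ is, in general, not constant; that is, there exist such an $H$ and a periodic initial datum $u(\cdot,0)$ for which $u_\infty$ is not almost surely equal to a deterministic constant.
   Context: $B$ is a standard one-dimensional Brownian motion (with $B(0)=0$). For a continuous path $B$, $u$ is a solution of $du=H(Du)\cdot dB$ with initial datum $u_0$ bounded and uniformly continuous if $u$ is the limit, uniform on $\mathbb R^d\times[0,T]$ for every $T>0$, of the viscosity solutions $u^n$ of $u^n_t=H(Du^n)\dot B^n$, $u^n(\cdot,0)=u_0$, for $C^1$ paths $B^n$ with $B^n(0)=0$ and $B^n\to B$ locally uniformly on $[0,\infty)$; since $H$ is convex this limit exists and is independent of the choice of $B^n$. *)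

theory Defs
  imports "HOL-Probability.Probability"
begin

text \<open>Only times \<open>t \<ge> 0\<close> matter. Vanishing at time 0 and continuity of paths are
  required almost surely.\<close>

locale brownian_motion = prob_space M for M :: "'w measure" +
  fixes B :: "real \<Rightarrow> 'w \<Rightarrow> real"
  assumes random_variable_at: "0 \<le> t \<Longrightarrow> B t \<in> borel_measurable M"
    and starts_at_0: "AE \<omega> in M. B 0 \<omega> = 0"
    and normal_increments: "0 \<le> s \<Longrightarrow> s < t \<Longrightarrow>
      distributed M lborel (\<lambda>\<omega>. B t \<omega> - B s \<omega>) (normal_density 0 (sqrt (t - s)))"
    and independent_increments: "0 \<le> \<tau> 0 \<Longrightarrow> strict_mono \<tau> \<Longrightarrow>
      indep_vars (\<lambda>_. borel) (\<lambda>i \<omega>. B (\<tau> (Suc i)) \<omega> - B (\<tau> i) \<omega>) {..<(n::nat)}"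
    and continuous_paths: "AE \<omega> in M. continuous_on {0..} (\<lambda>t. B t \<omega>)"

definition BUC_on :: "'a::metric_space set \<Rightarrow> ('a \<Rightarrow> real) \<Rightarrow> bool" where
  "BUC_on S f \<longleftrightarrow> bounded (f ` S) \<and> uniformly_continuous_on S f"

text \<open>Periodic with respect to the lattice generated by a basis \<open>P\<close>.\<close>

definition periodic_wrt :: "(real^'d) set \<Rightarrow> (real^'d \<Rightarrow> real) \<Rightarrow> bool" where
  "periodic_wrt P f \<longleftrightarrow>
     independent P \<and> span P = UNIV \<and> (\<forall>p\<in>P. \<forall>x. f (x + p) = f x)"

definition space_periodic :: "((real^'d) \<times> real \<Rightarrow> real) \<Rightarrow> bool" where
  "space_periodic u \<longleftrightarrow> (\<exists>P. \<forall>t\<ge>0. periodic_wrt P (\<lambda>x. u (x, t)))"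

definition hamiltonian :: "(real^'d \<Rightarrow> real) \<Rightarrow> bool" where
  "hamiltonian H \<longleftrightarrow>
     continuous_on UNIV H \<and> convex_on UNIV H \<and> H 0 = 0 \<and> (\<forall>p. p \<noteq> 0 \<longrightarrow> H p > 0)"

definition C1_path :: "(real \<Rightarrow> real) \<Rightarrow> (real \<Rightarrow> real) \<Rightarrow> bool" where
  "C1_path \<xi> \<xi>' \<longleftrightarrow>
     (\<forall>t\<ge>0. (\<xi> has_real_derivative \<xi>' t) (at t within {0..})) \<and> continuous_on {0..} \<xi>'"

text \<open>\<open>\<phi>\<close> is continuously differentiable on \<open>\<real>\<^sup>d \<times> (0,\<infinity>)\<close>, with spatial gradient \<open>D\<phi>\<close>
  and time derivative \<open>\<phi>t\<close>.\<close>

definition C1_test ::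
  "((real^'d) \<times> real \<Rightarrow> real) \<Rightarrow> ((real^'d) \<times> real \<Rightarrow> real^'d) \<Rightarrow> ((real^'d) \<times> real \<Rightarrow> real) \<Rightarrow> bool"
where
  "C1_test \<phi> D\<phi> \<phi>t \<longleftrightarrow>
     (\<forall>z \<in> UNIV \<times> {0<..}. (\<phi> has_derivative (\<lambda>(h, s). D\<phi> z \<bullet> h + \<phi>t z * s)) (at z)) \<and>
     continuous_on (UNIV \<times> {0<..}) D\<phi> \<and> continuous_on (UNIV \<times> {0<..}) \<phi>t"

text \<open>Viscosity sub- and supersolutions of \<open>u\<^sub>t = H(Du) \<beta>(t)\<close> in \<open>\<real>\<^sup>d \<times> (0,\<infinity>)\<close>;
  the maxima and minima of \<open>u - \<phi>\<close> are local.\<close>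

definition viscosity_subsolution ::
  "(real^'d \<Rightarrow> real) \<Rightarrow> (real \<Rightarrow> real) \<Rightarrow> ((real^'d) \<times> real \<Rightarrow> real) \<Rightarrow> bool"
where
  "viscosity_subsolution H \<beta> u \<longleftrightarrow>
     (\<forall>\<phi> D\<phi> \<phi>t x t. C1_test \<phi> D\<phi> \<phi>t \<and> 0 < t \<and>
        (\<forall>\<^sub>F z in nhds (x, t). u z - \<phi> z \<le> u (x, t) - \<phi> (x, t)) \<longrightarrow>
        \<phi>t (x, t) \<le> H (D\<phi> (x, t)) * \<beta> t)"

definition viscosity_supersolution ::
  "(real^'d \<Rightarrow> real) \<Rightarrow> (real \<Rightarrow> real) \<Rightarrow> ((real^'d) \<times> real \<Rightarrow> real) \<Rightarrow> bool"
where
  "viscosity_supersolution H \<beta> u \<longleftrightarrow>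
     (\<forall>\<phi> D\<phi> \<phi>t x t. C1_test \<phi> D\<phi> \<phi>t \<and> 0 < t \<and>
        (\<forall>\<^sub>F z in nhds (x, t). u z - \<phi> z \<ge> u (x, t) - \<phi> (x, t)) \<longrightarrow>
        \<phi>t (x, t) \<ge> H (D\<phi> (x, t)) * \<beta> t)"

text \<open>The class in which the initial value problem is well posed: bounded and uniformly
  continuous on \<open>\<real>\<^sup>d \<times> [0,T]\<close> for every \<open>T\<close>.\<close>

definition viscosity_solution ::
  "(real^'d \<Rightarrow> real) \<Rightarrow> (real \<Rightarrow> real) \<Rightarrow> (real^'d \<Rightarrow> real) \<Rightarrow> ((real^'d) \<times> real \<Rightarrow> real) \<Rightarrow> bool"
where
  "viscosity_solution H \<beta> u0 u \<longleftrightarrow>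
     (\<forall>T>0. BUC_on (UNIV \<times> {0..T}) u) \<and> (\<forall>x. u (x, 0) = u0 x) \<and>
     viscosity_subsolution H \<beta> u \<and> viscosity_supersolution H \<beta> u"

text \<open>Solutions of \<open>du = H(Du) \<cdot> dB\<close>, \<open>u(\<cdot>,0) = u0\<close>, for a continuous path \<open>B\<close>: limits of
  the viscosity solutions driven by some smooth approximation of \<open>B\<close>. For convex \<open>H\<close> the
  limit does not depend on the approximation.\<close>

definition pathwise_solution ::
  "(real^'d \<Rightarrow> real) \<Rightarrow> (real \<Rightarrow> real) \<Rightarrow> (real^'d \<Rightarrow> real) \<Rightarrow> ((real^'d) \<times> real \<Rightarrow> real) \<Rightarrow> bool"
where
  "pathwise_solution H B u0 u \<longleftrightarrow> BUC_on UNIV u0 \<and>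
     (\<exists>\<xi> \<xi>' v.
        (\<forall>n. C1_path (\<xi> n) (\<xi>' n) \<and> \<xi> n 0 = 0) \<and>
        (\<forall>T>0. uniform_limit {0..T} \<xi> B sequentially) \<and>
        (\<forall>n. viscosity_solution H (\<xi>' n) u0 (v n)) \<and>
        (\<forall>T>0. uniform_limit (UNIV \<times> {0..T}) v u sequentially))"

end

theory Submission
  imports Defs
begin

text \<open>The engine is one comparison principle for solutions driven by different paths. Let
  \<open>\<phi>(z, g) = max\<^sub>p (p \<bullet> z - g H(p) - e |p|\<^sup>2 / 2)\<close>, a \<open>C\<^sup>1\<close> function with gradient \<open>(p, -H(p))\<close> at
  the maximizer \<open>p\<close>. If \<open>u\<close> is a subsolution driven by \<open>\<xi>\<close>, \<open>w\<close> a supersolution driven by \<open>\<zeta>\<close>, and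
  the gap \<open>g = \<zeta> - \<xi> + K\<close> is positive, then doubling variables with \<open>\<phi>(y - x, g(t))\<close> in place of
  the usual quadratic shows that \<open>u(y, t) - w(x, t) - \<phi>(y - x, g(t))\<close> does not exceed its initial
  supremum. The limit \<open>n \<rightarrow> \<infinity>\<close> carries this over to pathwise solutions. Equal paths and small \<open>K\<close>
  give uniqueness; comparison with time-independent functions, which solve the equation for the zero
  path, shows that \<open>max u\<close> decreases, \<open>min u\<close> increases, and that after a large rise of \<open>B\<close> above its
  running minimum (or fall below its running maximum) the oscillation of a periodic \<open>u\<close> is small,
  because \<open>\<phi>(z, g)\<close> becomes small for large \<open>g\<close>, uniformly for bounded \<open>z\<close>. Brownian paths are almost
  surely unbounded.

  For non-constancy take \<open>H(p) = |p|\<close> and for \<open>u(\<cdot>, 0)\<close> the distance of one coordinate to the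
  integers. The solution is explicit, and its limit satisfies
  \<open>u\<^sub>\<infinity>(B) = max c\<^sub>h (min (1/2 + m\<^sub>h) (B h + u\<^sub>\<infinity>(B')))\<close> with \<open>B'\<close> the path after time \<open>h\<close>, \<open>m\<^sub>h\<close> the
  running minimum and \<open>c\<^sub>h\<close> at most the running maximum at time \<open>h\<close>. For small \<open>h\<close> a constant value
  in \<open>(0, 1/2)\<close> would force the independent variables \<open>B h\<close> and \<open>u\<^sub>\<infinity>(B')\<close> to have constant sum
  with positive probability, although \<open>B h\<close> has a bounded density; the values \<open>0\<close> and \<open>1/2\<close> would
  force \<open>B h\<close> to have a sign for all small \<open>h\<close>.\<close>

section \<open>Penalized conjugate of the Hamiltonian\<close>

lemma hamiltonian_nonneg: "hamiltonian H \<Longrightarrow> 0 \<le> H p"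
  unfolding hamiltonian_def by (cases "p = 0") (auto simp: less_imp_le)

text \<open>The quadratic penalty provides a maximum in \<open>q\<close> and makes it unique even
  when \<open>H\<close> grows only linearly or is affine on segments. Without it the conjugate could
  be infinite or have corners.\<close>

definition penalized_pairing :: "(real^'d \<Rightarrow> real) \<Rightarrow> real \<Rightarrow> real^'d \<Rightarrow> real \<Rightarrow> real^'d \<Rightarrow> real" where
  "penalized_pairing H e z g q = q \<bullet> z - g * H q - e / 2 * (q \<bullet> q)"

text \<open>For \<open>0 \<le> g\<close> and \<open>0 < e\<close> this is the unique maximizer; the
  choice operator makes it a total function.\<close>

definition gap_momentum :: "(real^'d \<Rightarrow> real) \<Rightarrow> real \<Rightarrow> real^'d \<Rightarrow> real \<Rightarrow> real^'d" where
  "gap_momentum H e z g = (SOME p. \<forall>q. penalized_pairing H e z g q \<le> penalized_pairing H e z g p)"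

text \<open>The Legendre-Fenchel conjugate of \<open>g * H q + e / 2 * (q \<bullet> q)\<close> at
  \<open>z\<close>. As a function of \<open>(z, g)\<close> it solves
  \<open>\<phi>_g + H(D\<phi>) = 0\<close>, which is why it can absorb the difference of two driving
  paths.\<close>

definition gap_fun :: "(real^'d \<Rightarrow> real) \<Rightarrow> real \<Rightarrow> real^'d \<Rightarrow> real \<Rightarrow> real" where
  "gap_fun H e z g = penalized_pairing H e z g (gap_momentum H e z g)"

lemma penalized_pairing_le:
  assumes "hamiltonian H" "0 \<le> g"
  shows "penalized_pairing H e z g q \<le> norm q * (norm z - e / 2 * norm q)"
proof -
  have "q \<bullet> z \<le> norm q * norm z" by (rule norm_cauchy_schwarz)
  moreover have "0 \<le> g * H q" by (intro mult_nonneg_nonneg assms(2) hamiltonian_nonneg[OF assms(1)])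
  moreover have "q \<bullet> q = norm q * norm q" by (simp add: dot_square_norm power2_eq_square)
  ultimately show ?thesis unfolding penalized_pairing_def by (simp add: algebra_simps)
qed

lemma penalized_pairing_0: "hamiltonian H \<Longrightarrow> penalized_pairing H e z g 0 = 0"
  by (simp add: penalized_pairing_def hamiltonian_def)

text \<open>The pairing is nonpositive outside the ball of radius \<open>2 * norm z / e\<close> and
  zero at the origin, so a maximum over that compact ball is global.\<close>

lemma penalized_pairing_le_gap_momentum:
  assumes H: "hamiltonian H" and g: "0 \<le> g" and e: "0 < e"
  shows "penalized_pairing H e z g q \<le> penalized_pairing H e z g (gap_momentum H e z g)"
proof -
  let ?J = "penalized_pairing H e z g"
  have cont: "continuous_on UNIV H" using H by (simp add: hamiltonian_def)
  have "continuous_on (cball 0 (2 * norm z / e)) ?J"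
    unfolding penalized_pairing_def
    by (intro continuous_intros continuous_on_subset[OF cont]) auto
  then obtain p where p: "p \<in> cball 0 (2 * norm z / e)" "\<And>q. q \<in> cball 0 (2 * norm z / e) \<Longrightarrow> ?J q \<le> ?J p"
    using continuous_attains_sup[of "cball 0 (2 * norm z / e)" ?J] e
    by (auto simp: not_less divide_le_0_iff)
  have "?J q \<le> ?J p" for q
  proof (cases "q \<in> cball 0 (2 * norm z / e)")
    case False
    then have "2 * norm z / e < norm q" by simp
    then have "norm z - e / 2 * norm q < 0" using e by (simp add: field_simps)
    then have "?J q \<le> 0" using penalized_pairing_le[OF H g, of e z q]
      by (smt (verit) mult_nonneg_nonpos norm_ge_zero)
    also have "0 \<le> ?J p" using p(2)[of 0] e by (simp add: penalized_pairing_0[OF H])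
    finally show ?thesis .
  qed (use p in auto)
  then have "\<exists>p. \<forall>q. ?J q \<le> ?J p" by blast
  from someI_ex[OF this] show ?thesis unfolding gap_momentum_def by blast
qed

lemma gap_fun_ge:
  assumes "hamiltonian H" "0 \<le> g" "0 < e"
  shows "q \<bullet> z - g * H q - e / 2 * (q \<bullet> q) \<le> gap_fun H e z g"
  using penalized_pairing_le_gap_momentum[OF assms, of z q]
  by (simp add: gap_fun_def penalized_pairing_def)

lemma gap_fun_nonneg:
  assumes "hamiltonian H" "0 \<le> g" "0 < e"
  shows "0 \<le> gap_fun H e z g"
  using gap_fun_ge[OF assms, of 0 z] assms(1) by (simp add: hamiltonian_def)

lemma gap_fun_eq:
  "gap_fun H e z g = gap_momentum H e z g \<bullet> z - g * H (gap_momentum H e z g)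
     - e / 2 * (gap_momentum H e z g \<bullet> gap_momentum H e z g)"
  by (simp add: gap_fun_def penalized_pairing_def)

lemma gap_fun_le:
  assumes "hamiltonian H" "0 \<le> g" "0 < e" "\<And>q. q \<bullet> z - g * H q \<le> C"
  shows "gap_fun H e z g \<le> C"
proof -
  let ?p = "gap_momentum H e z g"
  have "0 \<le> e / 2 * (?p \<bullet> ?p)" using assms(3) by simp
  then show ?thesis using assms(4)[of ?p] by (simp add: gap_fun_eq)
qed

text \<open>The diagonal costs nothing, so comparison at \<open>y = x\<close> yields a pure bound on
  \<open>u - w\<close>.\<close>

lemma gap_fun_0:
  assumes "hamiltonian H" "0 \<le> g" "0 < e"
  shows "gap_fun H e 0 g = 0"
proof (rule antisym)
  show "gap_fun H e 0 g \<le> 0"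
    by (rule gap_fun_le[OF assms])
      (use mult_nonneg_nonneg[OF assms(2) hamiltonian_nonneg[OF assms(1)]] in simp)
qed (rule gap_fun_nonneg[OF assms])

lemma norm_gap_momentum_le:
  assumes "hamiltonian H" "0 \<le> g" "0 < e"
  shows "norm (gap_momentum H e z g) \<le> 2 * norm z / e"
proof (rule ccontr)
  let ?p = "gap_momentum H e z g"
  assume "\<not> ?thesis"
  then have *: "2 * norm z / e < norm ?p" by simp
  then have "norm z - e / 2 * norm ?p < 0" using assms by (simp add: field_simps)
  moreover have "0 < norm ?p" using * assms(3)
    by (smt (verit) divide_nonneg_pos norm_ge_zero)
  ultimately have "norm ?p * (norm z - e / 2 * norm ?p) < 0" by (rule mult_pos_neg[rotated])
  then show False
    using penalized_pairing_le[OF assms(1,2), of e z ?p] gap_fun_nonneg[OF assms, of z]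
    by (simp add: gap_fun_def)
qed

text \<open>Maximality is tested at the midpoint of \<open>q\<close> and the maximizer. Convexity of
  \<open>H\<close> controls the \<open>H\<close> term, and the quadratic leaves a surplus with
  factor \<open>e / 8\<close>, doubled after rearranging.\<close>

lemma gap_momentum_strong:
  assumes H: "hamiltonian H" and g: "0 \<le> g" and e: "0 < e"
  shows "penalized_pairing H e z g q + e / 4 * (norm (q - gap_momentum H e z g))\<^sup>2 \<le> gap_fun H e z g"
proof -
  let ?p = "gap_momentum H e z g"
  let ?m = "(1/2) *\<^sub>R q + (1/2) *\<^sub>R ?p"
  have cx: "convex_on UNIV H" using H by (simp add: hamiltonian_def)
  have "H ?m \<le> (1/2) * H q + (1/2) * H ?p"
    using convex_onD[OF cx, of "1/2" q ?p] by simp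
  then have Hm: "g * H ?m \<le> g * ((1/2) * H q + (1/2) * H ?p)" using g by (rule mult_left_mono)
  have "e / 2 * (?m \<bullet> ?m) = e / 4 * (q \<bullet> q) + e / 4 * (?p \<bullet> ?p) - e / 8 * ((q - ?p) \<bullet> (q - ?p))"
    by (simp add: inner_simps inner_commute algebra_simps)
  moreover have "?m \<bullet> z = (1/2) * (q \<bullet> z) + (1/2) * (?p \<bullet> z)"
    by (simp add: inner_simps)
  ultimately have "(1/2) * penalized_pairing H e z g q + (1/2) * gap_fun H e z g
       + e / 8 * ((q - ?p) \<bullet> (q - ?p)) \<le> penalized_pairing H e z g ?m"
    using Hm unfolding penalized_pairing_def gap_fun_def by (simp add: algebra_simps)
  also have "\<dots> \<le> gap_fun H e z g"
    using penalized_pairing_le_gap_momentum[OF assms] by (simp add: gap_fun_def)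
  finally show ?thesis by (simp add: power2_norm_eq_inner)
qed

text \<open>Adds strong maximality at \<open>(z, g)\<close>, tested with \<open>p'\<close>, to
  maximality at \<open>(z', g')\<close>, tested with \<open>p\<close>. Only differences of the data
  survive.\<close>

lemma gap_momentum_close:
  fixes z z' :: "real^'d"
  assumes H: "hamiltonian H" and g: "0 \<le> g" "0 \<le> g'" and e: "0 < e"
  defines "p \<equiv> gap_momentum H e z g" and "p' \<equiv> gap_momentum H e z' g'"
  shows "e / 4 * (norm (p' - p))\<^sup>2 \<le> norm (p' - p) * norm (z' - z) + \<bar>g' - g\<bar> * \<bar>H p' - H p\<bar>"
proof -
  have 1: "penalized_pairing H e z g p' + e / 4 * (norm (p' - p))\<^sup>2 \<le> penalized_pairing H e z g p"
    using gap_momentum_strong[OF H g(1) e, of z p'] by (simp add: p_def gap_fun_def)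
  have 2: "penalized_pairing H e z' g' p \<le> penalized_pairing H e z' g' p'"
    using penalized_pairing_le_gap_momentum[OF H g(2) e] by (simp add: p'_def)
  have "e / 4 * (norm (p' - p))\<^sup>2 \<le> (p' - p) \<bullet> (z' - z) - (g' - g) * (H p' - H p)"
    using 1 2 by (simp add: penalized_pairing_def inner_simps algebra_simps)
  also have "(p' - p) \<bullet> (z' - z) \<le> norm (p' - p) * norm (z' - z)" by (rule norm_cauchy_schwarz)
  finally show ?thesis
    using abs_ge_minus_self[of "(g' - g) * (H p' - H p)"] by (simp add: abs_mult)
qed

text \<open>Near a base point all momenta lie in one ball, on which \<open>H\<close> is bounded. The
  squared distance of two momenta is then bounded by a linear function of the increments of
  \<open>z\<close> and \<open>g\<close>.\<close>

lemma continuous_on_gap_momentum: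
  assumes H: "hamiltonian H" and e: "0 < e"
  shows "continuous_on (UNIV \<times> {0..}) (\<lambda>(z, g). gap_momentum H e z g)"
proof -
  have "((\<lambda>(z, g). gap_momentum H e z g) \<longlongrightarrow> gap_momentum H e z0 g0) (at (z0, g0) within UNIV \<times> {0..})"
    if g0: "0 \<le> g0" for z0 g0
  proof -
    let ?F = "at (z0, g0) within UNIV \<times> {0..}"
    let ?P = "\<lambda>x. gap_momentum H e (fst x) (snd x)"
    let ?p = "gap_momentum H e z0 g0"
    define R where "R = 2 * (norm z0 + 1) / e"
    have cont: "continuous_on (cball 0 R) H" using H
      by (auto simp: hamiltonian_def intro: continuous_on_subset)
    obtain C where C: "\<And>q. q \<in> cball 0 R \<Longrightarrow> \<bar>H q\<bar> \<le> C"
      using compact_imp_bounded[OF compact_continuous_image[OF cont compact_cball]]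
      unfolding bounded_iff by fastforce
    have Rp: "norm (gap_momentum H e z g) \<le> R" if "0 \<le> g" "norm z \<le> norm z0 + 1" for z g
    proof -
      have "norm (gap_momentum H e z g) \<le> 2 * norm z / e" by (rule norm_gap_momentum_le[OF H that(1) e])
      also have "\<dots> \<le> R" unfolding R_def using that e by (intro divide_right_mono) auto
      finally show ?thesis .
    qed
    have ev: "\<forall>\<^sub>F x in ?F. e / 4 * (norm (?P x - ?p))\<^sup>2 \<le> 2 * R * norm (fst x - z0) + \<bar>snd x - g0\<bar> * (2 * C)"
    proof -
      have "\<forall>\<^sub>F x in ?F. x \<in> UNIV \<times> {0..}" by (simp add: eventually_at_filter)
      moreover have "((\<lambda>x. norm (fst x - z0)) \<longlongrightarrow> norm (fst (z0, g0) - z0)) ?F"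
        by (intro tendsto_norm tendsto_diff tendsto_fst tendsto_const tendsto_ident_at)
      then have "\<forall>\<^sub>F x in ?F. norm (fst x - z0) < 1" by (intro order_tendstoD) auto
      ultimately show ?thesis
      proof eventually_elim
        case (elim x)
        have g: "0 \<le> snd x" using elim by (cases x) auto
        have nz: "norm (fst x) \<le> norm z0 + 1" using elim(2)
          by (smt (verit) norm_triangle_ineq2)
        have 1: "norm (?P x) \<le> R" "norm ?p \<le> R" using Rp[OF g nz] Rp[OF g0] by auto
        have "e / 4 * (norm (?P x - ?p))\<^sup>2 \<le> norm (?P x - ?p) * norm (fst x - z0) + \<bar>snd x - g0\<bar> * \<bar>H (?P x) - H ?p\<bar>"
          by (rule gap_momentum_close[OF H g0 g e])
        also have "norm (?P x - ?p) * norm (fst x - z0) \<le> 2 * R * norm (fst x - z0)"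
          using 1 norm_triangle_ineq4[of "?P x" ?p] by (intro mult_right_mono) auto
        also have "\<bar>snd x - g0\<bar> * \<bar>H (?P x) - H ?p\<bar> \<le> \<bar>snd x - g0\<bar> * (2 * C)"
          using C[of "?P x"] C[of ?p] 1 by (intro mult_left_mono) auto
        finally show ?case by simp
      qed
    qed
    have "((\<lambda>x. 2 * R * norm (fst x - z0) + \<bar>snd x - g0\<bar> * (2 * C)) \<longlongrightarrow>
        2 * R * norm (fst (z0, g0) - z0) + \<bar>snd (z0, g0) - g0\<bar> * (2 * C)) ?F"
      by (intro tendsto_intros)
    then have lim: "((\<lambda>x. 2 * R * norm (fst x - z0) + \<bar>snd x - g0\<bar> * (2 * C)) \<longlongrightarrow> 0) ?F" by simp
    have "((\<lambda>x. e / 4 * (norm (?P x - ?p))\<^sup>2) \<longlongrightarrow> 0) ?F"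
      by (rule tendsto_sandwich[OF _ ev tendsto_const lim]) (use e in auto)
    then have "((\<lambda>x. 4 / e * (e / 4 * (norm (?P x - ?p))\<^sup>2)) \<longlongrightarrow> 4 / e * 0) ?F"
      by (rule tendsto_mult_left)
    then have "((\<lambda>x. (norm (?P x - ?p))\<^sup>2) \<longlongrightarrow> 0) ?F" using e by simp
    then have "((\<lambda>x. sqrt ((norm (?P x - ?p))\<^sup>2)) \<longlongrightarrow> sqrt 0) ?F" by (rule tendsto_real_sqrt)
    then have "((\<lambda>x. norm (?P x - ?p)) \<longlongrightarrow> 0) ?F" by simp
    then have "(?P \<longlongrightarrow> ?p) ?F" by (simp add: tendsto_norm_zero_iff LIM_zero_iff)
    then show ?thesis by (simp add: case_prod_beta')
  qed
  then show ?thesis unfolding continuous_on_def by auto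
qed

text \<open>Envelope argument: testing the maximum at each point with the momentum of the other
  traps the linearization error between \<open>0\<close> and the change of momentum and of its
  \<open>H\<close> value times the displacement. Continuity of the momentum makes this of lower
  order.\<close>

lemma gap_fun_has_derivative:
  assumes H: "hamiltonian H" and e: "0 < e" and g: "0 < g"
  shows "((\<lambda>x. gap_fun H e (fst x) (snd x)) has_derivative
     (\<lambda>(h, k). gap_momentum H e z g \<bullet> h - H (gap_momentum H e z g) * k)) (at (z, g))"
proof -
  let ?p = "gap_momentum H e z g"
  let ?P = "\<lambda>x. gap_momentum H e (fst x) (snd x)"
  let ?f = "\<lambda>x. gap_fun H e (fst x) (snd x)"
  let ?L = "\<lambda>(h, k). ?p \<bullet> h - H ?p * k"
  have "continuous_on (UNIV \<times> {0<..}) (\<lambda>(z, g). gap_momentum H e z g)"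
    by (rule continuous_on_subset[OF continuous_on_gap_momentum[OF H e]]) auto
  then have "continuous_on (UNIV \<times> {0<..}) ?P" by (simp add: case_prod_beta')
  moreover have "open (UNIV \<times> {0<..} :: ((real^'d) \<times> real) set)" by (intro open_Times) auto
  ultimately have "\<forall>x\<in>UNIV \<times> {0<..}. isCont ?P x"
    using continuous_on_eq_continuous_at by blast
  then have isP: "isCont ?P (z, g)" using g by auto
  have isH: "isCont H q" for q using H by (simp add: hamiltonian_def continuous_on_eq_continuous_at)
  let ?err = "\<lambda>x. norm (?P x - ?p) + \<bar>H (?P x) - H ?p\<bar>"
  have "isCont (\<lambda>x. H (?P x)) (z, g)"
    using isCont_o2[OF isP, of H] isH by simp
  then have "isCont ?err (z, g)" using isP by (intro continuous_intros) auto
  then have err: "(?err \<longlongrightarrow> 0) (at (z, g))" by (simp add: isCont_def)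
  have pos: "\<forall>\<^sub>F x in at (z, g). 0 < snd x"
  proof -
    have "((\<lambda>x. snd x) \<longlongrightarrow> snd (z, g)) (at (z, g))" by (intro tendsto_intros)
    then show ?thesis using g by (intro order_tendstoD) auto
  qed
  have bl: "bounded_linear ?L"
  proof -
    have "bounded_linear (\<lambda>x. ?p \<bullet> fst x - H ?p * snd x)"
      by (intro bounded_linear_intros)
    then show ?thesis by (simp add: case_prod_beta')
  qed
  have ev: "\<forall>\<^sub>F x in at (z, g). norm ((?f x - ?f (z, g)) - ?L (x - (z, g))) / norm (x - (z, g)) \<le> ?err x"
    using pos
  proof eventually_elim
    case (elim x)
    obtain z' g' where x: "x = (z', g')" by (cases x)
    have g': "0 \<le> g'" using elim x by simp
    let ?q = "gap_momentum H e z' g'"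
    have 1: "?p \<bullet> z' - g' * H ?p - e / 2 * (?p \<bullet> ?p) \<le> gap_fun H e z' g'"
      by (rule gap_fun_ge[OF H g' e])
    have 2: "?q \<bullet> z - g * H ?q - e / 2 * (?q \<bullet> ?q) \<le> gap_fun H e z g"
      using g by (intro gap_fun_ge[OF H _ e]) auto
    let ?D = "gap_fun H e z' g' - gap_fun H e z g - (?p \<bullet> (z' - z) - H ?p * (g' - g))"
    have low: "0 \<le> ?D" using 1 gap_fun_eq[of H e z g] by (simp add: algebra_simps inner_simps)
    have "?D \<le> (?q - ?p) \<bullet> (z' - z) - (H ?q - H ?p) * (g' - g)"
      using 2 gap_fun_eq[of H e z' g'] by (simp add: algebra_simps inner_simps)
    also have "\<dots> \<le> norm (?q - ?p) * norm (z' - z) + \<bar>H ?q - H ?p\<bar> * \<bar>g' - g\<bar>"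
      using norm_cauchy_schwarz[of "?q - ?p" "z' - z"] abs_ge_minus_self[of "(H ?q - H ?p) * (g' - g)"]
      by (simp add: abs_mult)
    also have "\<dots> \<le> norm (?q - ?p) * norm (x - (z, g)) + \<bar>H ?q - H ?p\<bar> * norm (x - (z, g))"
      using norm_fst_le[of "z' - z" "g' - g"] norm_snd_le[of "g' - g" "z' - z"]
      by (intro add_mono mult_left_mono) (auto simp: x)
    finally have up: "?D \<le> ?err x * norm (x - (z, g))" by (simp add: x algebra_simps)
    have "norm ((?f x - ?f (z, g)) - ?L (x - (z, g))) \<le> ?err x * norm (x - (z, g))"
      using low up by (simp add: x)
    then show ?case
      by (cases "x = (z, g)") (auto simp: divide_simps)
  qed
  have "((\<lambda>x. norm ((?f x - ?f (z, g)) - ?L (x - (z, g))) / norm (x - (z, g))) \<longlongrightarrow> 0) (at (z, g))"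
    by (rule tendsto_sandwich[OF _ ev tendsto_const err]) auto
  then show ?thesis unfolding has_derivative_iff_norm using bl by simp
qed

section \<open>Comparison along two driving paths\<close>

text \<open>With \<open>\<sigma> = 1\<close> and \<open>\<sigma> = -1\<close> this serves the two
  halves of the doubling of variables; \<open>\<eta>\<close> is the weight of the localization in
  space and \<open>q\<close> collects the penalties in time.\<close>

lemma gap_fun_C1_test:
  fixes c :: "real^'d"
  assumes H: "hamiltonian H" and e: "0 < e"
    and G: "\<And>t. 0 < t \<Longrightarrow> (G has_real_derivative G' t) (at t)" "continuous_on {0<..} G'" "\<And>t. 0 < t \<Longrightarrow> 0 < G t"
    and q: "\<And>t. 0 < t \<Longrightarrow> (q has_real_derivative q' t) (at t)" "continuous_on {0<..} q'"
  shows "C1_test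
     (\<lambda>z. gap_fun H e (\<sigma> *\<^sub>R fst z + c) (G (snd z)) + \<eta> * (fst z \<bullet> fst z) + q (snd z))
     (\<lambda>z. \<sigma> *\<^sub>R gap_momentum H e (\<sigma> *\<^sub>R fst z + c) (G (snd z)) + (2 * \<eta>) *\<^sub>R fst z)
     (\<lambda>z. - H (gap_momentum H e (\<sigma> *\<^sub>R fst z + c) (G (snd z))) * G' (snd z) + q' (snd z))"
  unfolding C1_test_def
proof (intro conjI ballI)
  let ?P = "\<lambda>z. gap_momentum H e (\<sigma> *\<^sub>R fst z + c) (G (snd z))"
  fix z :: "(real^'d) \<times> real" assume z: "z \<in> UNIV \<times> {0<..}"
  obtain y t where zyt: "z = (y, t)" by (cases z)
  have t: "0 < t" using z zyt by simp
  have 1: "((\<lambda>z. (\<sigma> *\<^sub>R fst z + c, G (snd z))) has_derivative (\<lambda>h. (\<sigma> *\<^sub>R fst h, G' t * snd h))) (at z)"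
  proof (intro has_derivative_Pair)
    show "((\<lambda>z. \<sigma> *\<^sub>R fst z + c) has_derivative (\<lambda>h. \<sigma> *\<^sub>R fst h)) (at z)"
      by (auto intro!: derivative_eq_intros)
    have "(G has_derivative (\<lambda>h. G' t * h)) (at (snd z))"
      using G(1)[OF t] by (simp add: zyt has_field_derivative_def)
    from has_derivative_compose[OF has_derivative_snd[OF has_derivative_ident] this]
    show "((\<lambda>z. G (snd z)) has_derivative (\<lambda>h. G' t * snd h)) (at z)" by simp
  qed
  have 2: "((\<lambda>x. gap_fun H e (fst x) (snd x)) has_derivative
     (\<lambda>(h, k). ?P z \<bullet> h - H (?P z) * k)) (at (\<sigma> *\<^sub>R fst z + c, G (snd z)))"
    using gap_fun_has_derivative[OF H e G(3)[OF t], of "\<sigma> *\<^sub>R y + c"] by (simp add: zyt)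
  have 3: "((\<lambda>z. gap_fun H e (\<sigma> *\<^sub>R fst z + c) (G (snd z))) has_derivative
      (\<lambda>h. ?P z \<bullet> (\<sigma> *\<^sub>R fst h) - H (?P z) * (G' t * snd h))) (at z)"
    using has_derivative_compose[OF 1 2] by simp
  have 4: "((\<lambda>z. q (snd z)) has_derivative (\<lambda>h. q' t * snd h)) (at z)"
    using has_derivative_compose[OF has_derivative_snd[OF has_derivative_ident], where s=UNIV and g=q and g'="\<lambda>h. q' t * h" and x=z]
      q(1)[OF t] by (simp add: zyt has_field_derivative_def)
  have 5: "((\<lambda>z. \<eta> * (fst z \<bullet> fst z)) has_derivative (\<lambda>h. \<eta> * (fst z \<bullet> fst h + fst h \<bullet> fst z))) (at z)"
    by (auto intro!: derivative_eq_intros)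
  show "((\<lambda>z. gap_fun H e (\<sigma> *\<^sub>R fst z + c) (G (snd z)) + \<eta> * (fst z \<bullet> fst z) + q (snd z))
     has_derivative (\<lambda>(h, s). (\<sigma> *\<^sub>R ?P z + (2 * \<eta>) *\<^sub>R fst z) \<bullet> h + (- H (?P z) * G' (snd z) + q' (snd z)) * s)) (at z)"
    using has_derivative_add[OF has_derivative_add[OF 3 5] 4]
    by (rule has_derivative_eq_rhs) (auto simp: fun_eq_iff zyt inner_simps inner_commute algebra_simps)
next
  let ?P = "\<lambda>z. gap_momentum H e (\<sigma> *\<^sub>R fst z + c) (G (snd z))"
  have contG: "continuous_on {0<..} G"
    by (intro continuous_at_imp_continuous_on ballI) (auto intro: DERIV_isCont[OF G(1)])
  have cG: "continuous_on (UNIV \<times> {0<..}) (\<lambda>z :: (real^'d) \<times> real. G (snd z))"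
    by (rule continuous_on_compose2[OF contG]) (auto intro: continuous_intros)
  have cPair: "continuous_on (UNIV \<times> {0<..}) (\<lambda>z. (\<sigma> *\<^sub>R fst z + c, G (snd z)))"
    by (intro continuous_intros cG)
  have cP: "continuous_on (UNIV \<times> {0<..}) ?P"
    using continuous_on_compose2[OF continuous_on_gap_momentum[OF H e] cPair] less_imp_le[OF G(3)]
    by (auto simp: image_subset_iff)
  have cH: "continuous_on UNIV H" using H by (simp add: hamiltonian_def)
  show "continuous_on (UNIV \<times> {0<..}) (\<lambda>z. \<sigma> *\<^sub>R ?P z + (2 * \<eta>) *\<^sub>R fst z)"
    by (intro continuous_intros cP)
  have "continuous_on (UNIV \<times> {0<..}) (\<lambda>z. H (?P z))"
    by (rule continuous_on_compose2[OF cH cP]) auto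
  moreover have "continuous_on (UNIV \<times> {0<..}) (\<lambda>z :: (real^'d) \<times> real. G' (snd z))"
    by (rule continuous_on_compose2[OF G(2)]) (auto intro: continuous_intros)
  moreover have "continuous_on (UNIV \<times> {0<..}) (\<lambda>z :: (real^'d) \<times> real. q' (snd z))"
    by (rule continuous_on_compose2[OF q(2)]) (auto intro: continuous_intros)
  ultimately show "continuous_on (UNIV \<times> {0<..}) (\<lambda>z. - H (?P z) * G' (snd z) + q' (snd z))"
    by (intro continuous_intros)
qed

lemma C1_test_uminus:
  fixes \<phi> :: "(real^'d) \<times> real \<Rightarrow> real"
  assumes "C1_test \<phi> D\<phi> \<phi>t"
  shows "C1_test (\<lambda>z. - \<phi> z) (\<lambda>z. - D\<phi> z) (\<lambda>z. - \<phi>t z)"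
  unfolding C1_test_def
proof (intro conjI ballI)
  fix z :: "(real^'d) \<times> real" assume "z \<in> UNIV \<times> {0<..}"
  then have "(\<phi> has_derivative (\<lambda>(h, s). D\<phi> z \<bullet> h + \<phi>t z * s)) (at z)"
    using assms by (auto simp: C1_test_def)
  from has_derivative_minus[OF this]
  show "((\<lambda>z. - \<phi> z) has_derivative (\<lambda>(h, s). - D\<phi> z \<bullet> h + - \<phi>t z * s)) (at z)"
    by (rule has_derivative_eq_rhs) (auto simp: fun_eq_iff)
qed (use assms in \<open>auto simp: C1_test_def intro: continuous_intros\<close>)

lemma continuous_on_gap_fun:
  assumes "hamiltonian H" "0 < e"
  shows "continuous_on (UNIV \<times> {0<..}) (\<lambda>x. gap_fun H e (fst x) (snd x))"
  by (intro continuous_at_imp_continuous_on ballI)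
     (auto intro!: has_derivative_continuous[OF gap_fun_has_derivative[OF assms]])

text \<open>The momentum at \<open>g\<close> is a competitor at \<open>g'\<close>. This allows the
  gap to be moved from one time to another in the initial inequality.\<close>

lemma gap_fun_decrease:
  assumes H: "hamiltonian H" and g: "0 \<le> g" "0 \<le> g'" and e: "0 < e"
  shows "gap_fun H e z g \<le> gap_fun H e z g' + \<bar>g' - g\<bar> * H (gap_momentum H e z g)"
proof -
  let ?p = "gap_momentum H e z g"
  have "?p \<bullet> z - g' * H ?p - e / 2 * (?p \<bullet> ?p) \<le> gap_fun H e z g'"
    by (rule gap_fun_ge[OF H g(2) e])
  moreover have "(g' - g) * H ?p \<le> \<bar>g' - g\<bar> * H ?p"
    by (intro mult_right_mono hamiltonian_nonneg[OF H]) auto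
  ultimately show ?thesis by (simp add: gap_fun_eq[of H e z g] algebra_simps)
qed

text \<open>The conjugate is tested with the unit vector along \<open>z\<close>. In the doubling
  argument this bounds the distance of the two space points.\<close>

lemma norm_le_gap_fun:
  assumes H: "hamiltonian H" and g: "0 \<le> g" and e: "0 < e"
    and H1: "\<And>q. norm q \<le> 1 \<Longrightarrow> H q \<le> h"
  shows "norm z \<le> gap_fun H e z g + g * h + e / 2"
proof (cases "z = 0")
  case True
  have "0 \<le> h" using H1[of 0] H by (simp add: hamiltonian_def)
  then show ?thesis using True gap_fun_nonneg[OF H g e, of z] g e by simp
next
  case False
  let ?q = "z /\<^sub>R norm z"
  have "?q \<bullet> z - g * H ?q - e / 2 * (?q \<bullet> ?q) \<le> gap_fun H e z g"
    by (rule gap_fun_ge[OF H g e])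
  moreover have "?q \<bullet> z = norm z" using False
    by (simp add: dot_square_norm power2_eq_square)
  moreover have "?q \<bullet> ?q = 1" using False by (simp add: dot_square_norm)
  moreover have "g * H ?q \<le> g * h" using g False by (intro mult_left_mono H1) auto
  ultimately show ?thesis by simp
qed

lemma uniformly_continuous_on_compact_margin:
  fixes f :: "'a::metric_space \<Rightarrow> real"
  assumes "continuous_on S f" "compact S" "0 < c" "0 \<le> M"
  obtains d where "0 < d" "\<And>x y. x \<in> S \<Longrightarrow> y \<in> S \<Longrightarrow> dist x y < d \<Longrightarrow> \<bar>f x - f y\<bar> * M < c"
proof -
  have "uniformly_continuous_on S f" by (rule compact_uniformly_continuous[OF assms(1,2)])
  then obtain d where d: "0 < d" "\<And>x y. x \<in> S \<Longrightarrow> y \<in> S \<Longrightarrow> dist x y < d \<Longrightarrow> dist (f x) (f y) < c / (M + 1)"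
    unfolding uniformly_continuous_on_def
    by (metis assms(3,4) add_nonneg_pos divide_pos_pos zero_less_one)
  have "\<bar>f x - f y\<bar> * M < c" if "x \<in> S" "y \<in> S" "dist x y < d" for x y
  proof -
    have "\<bar>f x - f y\<bar> * (M + 1) < c" using d(2)[OF that] assms(4) by (simp add: dist_real_def field_simps)
    then show ?thesis by (simp add: algebra_simps)
  qed
  with d(1) show ?thesis by (rule that)
qed

lemma compact_continuous_bound:
  fixes f :: "'a::topological_space \<Rightarrow> real"
  assumes "compact S" "continuous_on S f"
  obtains C where "\<And>x. x \<in> S \<Longrightarrow> \<bar>f x\<bar> \<le> C"
  using compact_imp_bounded[OF compact_continuous_image[OF assms(2,1)]]
  unfolding bounded_iff by (auto intro: that)

lemma BUC_on_bound:
  assumes "BUC_on S f"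
  obtains C where "\<And>x. x \<in> S \<Longrightarrow> \<bar>f x\<bar> \<le> C"
  using assms unfolding BUC_on_def bounded_iff by (auto intro: that)

lemma BUC_on_modulus:
  assumes "BUC_on S f" "0 < c"
  obtains d where "0 < d" "\<And>x y. x \<in> S \<Longrightarrow> y \<in> S \<Longrightarrow> dist x y < d \<Longrightarrow> \<bar>f x - f y\<bar> < c"
  using assms unfolding BUC_on_def uniformly_continuous_on_def
  by (metis dist_commute dist_real_def)

text \<open>Variables are doubled in space and time. The penalty \<open>n * (t - s)^2\<close> glues
  the times; \<open>N * exp (k * (t - b))\<close> has a positive slope, which makes the inequality
  strict, and a size that keeps the maximum away from \<open>b\<close>; small quadratics give
  compactness. At an interior maximum the time derivative \<open>- H p * G'\<close> of
  \<open>gap_fun\<close> balances the two right-hand sides up to small errors, which contradicts the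
  strict slope.\<close>

lemma comparison_extended_gap:
  fixes u w :: "(real^'d) \<times> real \<Rightarrow> real"
  assumes H: "hamiltonian H" and e: "0 < e" and ab: "0 \<le> a" "a < b"
    and beta: "continuous_on {0..} \<xi>'" "continuous_on {0..} \<zeta>'"
    and sub: "viscosity_subsolution H \<xi>' u" and super: "viscosity_supersolution H \<zeta>' w"
    and buc: "BUC_on (UNIV \<times> {0..b}) u" "BUC_on (UNIV \<times> {0..b}) w"
    and G: "continuous_on {0..} G" "\<And>t. 0 \<le> t \<Longrightarrow> 0 < G t"
      "\<And>t. 0 < t \<Longrightarrow> (G has_real_derivative G' t) (at t)" "continuous_on {0<..} G'"
      "\<And>t. a < t \<Longrightarrow> t < b \<Longrightarrow> G' t = \<zeta>' t - \<xi>' t"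
    and init: "\<And>y x. u (y, a) - w (x, a) \<le> gap_fun H e (y - x) (G a) + A"
    and tb: "a \<le> tb" "tb < b"
  shows "u (yb, tb) - w (xb, tb) \<le> gap_fun H e (yb - xb) (G tb) + A"
proof (rule ccontr)
  assume contra: "\<not> ?thesis"
  \<comment> \<open>Of the excess \<open>4 * \<mu>\<close>, one \<open>\<mu>\<close> pays for the
    exponential and one for the quadratic penalties at the reference point; the remaining two absorb
    the continuity errors at the initial time.\<close>
  define \<mu> where "\<mu> = (u (yb, tb) - w (xb, tb) - gap_fun H e (yb - xb) (G tb) - A) / 4"
  have \<mu>: "0 < \<mu>" using contra by (simp add: \<mu>_def)
  obtain C1 where C1: "\<And>z. z \<in> UNIV \<times> {0..b} \<Longrightarrow> \<bar>u z\<bar> \<le> C1"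
    using BUC_on_bound[OF buc(1)] by metis
  obtain C2 where C2: "\<And>z. z \<in> UNIV \<times> {0..b} \<Longrightarrow> \<bar>w z\<bar> \<le> C2"
    using BUC_on_bound[OF buc(2)] by metis
  define C where "C = max 1 (max C1 C2)"
  have C: "0 < C" "\<And>x t. 0 \<le> t \<Longrightarrow> t \<le> b \<Longrightarrow> \<bar>u (x, t)\<bar> \<le> C" "\<And>x t. 0 \<le> t \<Longrightarrow> t \<le> b \<Longrightarrow> \<bar>w (x, t)\<bar> \<le> C"
    using C1 C2 by (force simp: C_def le_max_iff_disj)+
  have A: "- 2 * C \<le> A"
    using init[of 0 0] gap_fun_0[OF H _ e, of "G a"] G(2)[of a] C(2)[of a 0] C(3)[of a 0] ab by auto
  \<comment> \<open>The factor \<open>8\<close> turns the later bound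
    \<open>N * exp (k * (t0 - b)) < 4 * C\<close> into \<open>exp (k * (t0 - b)) < 1 / 2\<close>,
    that is \<open>t0 < b - \<theta>\<close> with \<open>\<theta> = ln 2 / k\<close>.\<close>
  define N where "N = 8 * C"
  have N: "0 < N" using C by (simp add: N_def)
  \<comment> \<open>Chosen so that \<open>k * (b - tb) = N / \<mu>\<close>; since
    \<open>x \<le> exp x\<close>, the exponential penalty at \<open>tb\<close> is at most
    \<open>\<mu>\<close>.\<close>
  define k where "k = N / (\<mu> * (b - tb))"
  have k: "0 < k" using N \<mu> tb by (simp add: k_def)
  have Nk: "N * exp (k * (tb - b)) \<le> \<mu>"
  proof -
    have kx: "k * (tb - b) = - (N / \<mu>)" using \<mu> tb by (simp add: k_def field_simps)
    have "N / \<mu> \<le> exp (N / \<mu>)" using exp_ge_add_one_self[of "N / \<mu>"] by linarith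
    then have "N \<le> \<mu> * exp (N / \<mu>)" using \<mu> by (simp add: field_simps)
    then show ?thesis unfolding kx exp_minus by (simp add: field_simps)
  qed
  define \<theta> where "\<theta> = ln 2 / k"
  have \<theta>: "0 < \<theta>" using k by (simp add: \<theta>_def)
  have cH: "continuous_on S H" for S
    using H by (auto simp: hamiltonian_def intro: continuous_on_subset)
  have cG: "continuous_on {a..b} G" using ab by (auto intro: continuous_on_subset[OF G(1)])
  obtain h where h: "\<And>q. norm q \<le> 1 \<Longrightarrow> \<bar>H q\<bar> \<le> h"
    using compact_continuous_bound[OF compact_cball[of 0 1] cH] by (metis mem_cball_0)
  have h0: "0 \<le> h" using h[of 0] by auto
  obtain Gm where Gm: "\<And>t. a \<le> t \<Longrightarrow> t \<le> b \<Longrightarrow> \<bar>G t\<bar> \<le> Gm"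
    using compact_continuous_bound[OF compact_Icc cG] by (metis atLeastAtMost_iff)
  \<comment> \<open>Bounds every momentum that occurs: \<open>4 * C + Gm * h + e / 2\<close> bounds
    the distance of the maximizing points, by \<open>norm_le_gap_fun\<close>.\<close>
  define R where "R = 2 * (4 * C + Gm * h + e / 2) / e"
  obtain HR where HR: "\<And>q. norm q \<le> R + 1 \<Longrightarrow> \<bar>H q\<bar> \<le> HR"
    using compact_continuous_bound[OF compact_cball[of 0 "R + 1"] cH] by (metis mem_cball_0)
  have Gm0: "0 \<le> Gm" using Gm[of a] ab by auto
  have R0: "0 \<le> R" using C Gm0 h0 e unfolding R_def by (intro divide_nonneg_pos mult_nonneg_nonneg add_nonneg_nonneg) auto
  have HR0: "0 \<le> HR" using HR[of 0] R0 by auto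
  have cb: "continuous_on {0..b} \<xi>'" "continuous_on {0..b} \<zeta>'"
    by (auto intro: continuous_on_subset[OF beta(1)] continuous_on_subset[OF beta(2)])
  obtain B1 where B1: "\<And>t. t \<in> {0..b} \<Longrightarrow> \<bar>\<xi>' t\<bar> \<le> B1"
    using compact_continuous_bound[OF compact_Icc cb(1)] by metis
  obtain B2 where B2: "\<And>t. t \<in> {0..b} \<Longrightarrow> \<bar>\<zeta>' t\<bar> \<le> B2"
    using compact_continuous_bound[OF compact_Icc cb(2)] by metis
  define Bd where "Bd = max 0 (max B1 B2)"
  have Bd: "0 \<le> Bd" "\<And>t. t \<in> {0..b} \<Longrightarrow> \<bar>\<xi>' t\<bar> \<le> Bd" "\<And>t. t \<in> {0..b} \<Longrightarrow> \<bar>\<zeta>' t\<bar> \<le> Bd"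
    using B1 B2 by (auto simp: Bd_def le_max_iff_disj)
  \<comment> \<open>The smallest slope of the exponential penalty on \<open>[a, b]\<close>; three
    errors below \<open>\<kappa> / 4\<close> will contradict it.\<close>
  define \<kappa> where "\<kappa> = N * k * exp (k * (a - b))"
  have \<kappa>: "0 < \<kappa>" using N k by (simp add: \<kappa>_def)
  obtain d0 where d0: "0 < d0"
    "\<And>x t s. t \<in> {0..b} \<Longrightarrow> s \<in> {0..b} \<Longrightarrow> \<bar>t - s\<bar> < d0 \<Longrightarrow> \<bar>u (x, t) - u (x, s)\<bar> < \<mu>"
    "\<And>x t s. t \<in> {0..b} \<Longrightarrow> s \<in> {0..b} \<Longrightarrow> \<bar>t - s\<bar> < d0 \<Longrightarrow> \<bar>w (x, t) - w (x, s)\<bar> < \<mu>"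
  proof -
    obtain d1 where d1: "0 < d1" "\<And>y z. y \<in> UNIV \<times> {0..b} \<Longrightarrow> z \<in> UNIV \<times> {0..b} \<Longrightarrow> dist y z < d1 \<Longrightarrow> \<bar>u y - u z\<bar> < \<mu>"
      using BUC_on_modulus[OF buc(1) \<mu>] by blast
    obtain d2 where d2: "0 < d2" "\<And>y z. y \<in> UNIV \<times> {0..b} \<Longrightarrow> z \<in> UNIV \<times> {0..b} \<Longrightarrow> dist y z < d2 \<Longrightarrow> \<bar>w y - w z\<bar> < \<mu>"
      using BUC_on_modulus[OF buc(2) \<mu>] by blast
    show ?thesis
    proof (rule that[of "min d1 d2"])
      show "0 < min d1 d2" using d1 d2 by simp
      fix x :: "real^'d" and t s assume *: "t \<in> {0..b}" "s \<in> {0..b}" "\<bar>t - s\<bar> < min d1 d2"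
      have dd: "dist (x, t) (x, s) = \<bar>t - s\<bar>" by (simp add: dist_Pair_Pair dist_real_def)
      show "\<bar>u (x, t) - u (x, s)\<bar> < \<mu>" using d1(2)[of "(x, t)" "(x, s)"] * dd by auto
      show "\<bar>w (x, t) - w (x, s)\<bar> < \<mu>" using d2(2)[of "(x, t)" "(x, s)"] * dd by auto
    qed
  qed
  obtain d1 where d1: "0 < d1" "\<And>t s. t \<in> {a..b} \<Longrightarrow> s \<in> {a..b} \<Longrightarrow> dist t s < d1 \<Longrightarrow> \<bar>G t - G s\<bar> * HR < \<mu>"
    using uniformly_continuous_on_compact_margin[OF cG compact_Icc \<mu> HR0] by blast
  have \<kappa>4: "0 < \<kappa> / 4" using \<kappa> by simp
  obtain d2 where d2: "0 < d2" "\<And>t s. t \<in> {0..b} \<Longrightarrow> s \<in> {0..b} \<Longrightarrow> dist t s < d2 \<Longrightarrow> \<bar>\<zeta>' t - \<zeta>' s\<bar> * HR < \<kappa> / 4"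
    using uniformly_continuous_on_compact_margin[OF cb(2) compact_Icc \<kappa>4 HR0] by blast
  obtain d3 where d3: "0 < d3" "\<And>p q. p \<in> cball 0 (R + 1) \<Longrightarrow> q \<in> cball 0 (R + 1) \<Longrightarrow> dist p q < d3 \<Longrightarrow> \<bar>H p - H q\<bar> * Bd < \<kappa> / 4"
    using uniformly_continuous_on_compact_margin[OF cH compact_cball \<kappa>4 Bd(1)] by blast
  define d where "d = Min {d0, d1, d2, d3, \<theta>, 1}"
  have "d \<le> d0" "d \<le> d1" "d \<le> d2" "d \<le> d3" "d \<le> \<theta>" "d \<le> 1"
    unfolding d_def by (rule Min_le; simp)+
  moreover have "0 < d"
    unfolding d_def using d0(1) d1(1) d2(1) d3(1) \<theta> by (subst Min_gr_iff) simp_all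
  ultimately have d: "0 < d" "d \<le> d0" "d \<le> d1" "d \<le> d2" "d \<le> d3" "d \<le> \<theta>" "d \<le> 1" by blast+
  \<comment> \<open>The first summand forces \<open>t0\<close> and \<open>s0\<close> closer than
    \<open>d\<close> and the gradients of the localization below \<open>d\<close>; the second makes
    the localization at the reference points at most \<open>\<mu>\<close>.\<close>
  define n where "n = 16 * C / d\<^sup>2 + (yb \<bullet> yb + xb \<bullet> xb) / \<mu> + 1"
  have n1: "16 * C / d\<^sup>2 < n" "(yb \<bullet> yb + xb \<bullet> xb) / \<mu> \<le> n"
    using C \<mu> d by (auto simp: n_def add_pos_pos divide_nonneg_pos add_nonneg_pos)
  have n0: "0 < n" using n1(1) C d by (smt (verit) divide_nonneg_pos zero_less_power)
  have n2: "16 * C < n * d\<^sup>2" "(yb \<bullet> yb + xb \<bullet> xb) / n \<le> \<mu>"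
    using n1 n0 d \<mu> by (auto simp: field_simps)
  \<comment> \<open>Since \<open>r \<ge> 1\<close> and \<open>r > 4 * C * n\<close>, also
    \<open>r^2 > 4 * C * n\<close>, which puts the maximizing points in the open ball. The two norms
    keep the reference points in the closed ball.\<close>
  define r where "r = 4 * C * n + 1 + norm yb + norm xb"
  have "0 \<le> 4 * C * n" using C n0 by simp
  then have r1: "1 \<le> r" "norm yb \<le> r" "norm xb \<le> r" "4 * C * n < r"
    unfolding r_def using norm_ge_zero[of yb] norm_ge_zero[of xb] by linarith+
  have "r * 1 \<le> r * r" using r1 by (intro mult_left_mono) auto
  then have rr: "4 * C * n < r\<^sup>2" using r1(4) unfolding power2_eq_square by linarith
  define \<Phi> where "\<Phi> = (\<lambda>(y, t) (x, s). u (y, t) - w (x, s) - gap_fun H e (y - x) (G t)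
      - n * (t - s)\<^sup>2 - N * exp (k * (t - b)) - (y \<bullet> y) / n - (x \<bullet> x) / n)"
  define K where "K = (cball (0::real^'d) r \<times> {a..b}) \<times> (cball (0::real^'d) r \<times> {a..b})"
  have compK: "compact K" unfolding K_def by (intro compact_Times compact_cball compact_Icc)
  have refK: "((yb, tb), (xb, tb)) \<in> K" using r1 tb by (auto simp: K_def)
  have contPhi: "continuous_on K (\<lambda>z. \<Phi> (fst z) (snd z))"
  proof -
    have cu: "continuous_on (UNIV \<times> {0..b}) u" "continuous_on (UNIV \<times> {0..b}) w"
      using buc by (auto simp: BUC_on_def uniformly_continuous_imp_continuous)
    have 1: "continuous_on K (\<lambda>z. u (fst (fst z), snd (fst z)))"
      by (rule continuous_on_compose2[OF cu(1)]) (use ab in \<open>auto simp: K_def intro!: continuous_intros\<close>)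
    have 2: "continuous_on K (\<lambda>z. w (fst (snd z), snd (snd z)))"
      by (rule continuous_on_compose2[OF cu(2)]) (use ab in \<open>auto simp: K_def intro!: continuous_intros\<close>)
    have 3: "continuous_on K (\<lambda>z. G (snd (fst z)))"
      by (rule continuous_on_compose2[OF cG]) (auto simp: K_def intro!: continuous_intros)
    have 4: "continuous_on K (\<lambda>z. (fst (fst z) - fst (snd z), G (snd (fst z))))"
      by (intro continuous_intros 3)
    have 5: "continuous_on K (\<lambda>z. gap_fun H e (fst (fst z) - fst (snd z)) (G (snd (fst z))))"
      using continuous_on_compose2[OF continuous_on_gap_fun[OF H e] 4] G(2) ab by (force simp: K_def)
    show ?thesis unfolding \<Phi>_def case_prod_beta'
      using n0 by (intro continuous_intros 1 2 5) auto
  qed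
  obtain z0 where z0: "z0 \<in> K" "\<And>z. z \<in> K \<Longrightarrow> \<Phi> (fst z) (snd z) \<le> \<Phi> (fst z0) (snd z0)"
    using continuous_attains_sup[OF compK _ contPhi] refK by blast
  obtain y0 t0 x0 s0 where z0eq: "z0 = ((y0, t0), (x0, s0))" by (metis prod.collapse)
  have in0: "t0 \<in> {a..b}" "s0 \<in> {a..b}" using z0(1) by (auto simp: z0eq K_def)
  have mx: "\<Phi> (y, t) (x, s) \<le> \<Phi> (y0, t0) (x0, s0)"
    if "norm y \<le> r" "norm x \<le> r" "t \<in> {a..b}" "s \<in> {a..b}" for y t x s
    using z0(2)[of "((y, t), (x, s))"] that by (auto simp: z0eq K_def)
  have "v = A + 4 * ((v - A) / 4)" for v :: real by (simp add: field_simps)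
  then have "u (yb, tb) - w (xb, tb) - gap_fun H e (yb - xb) (G tb) = A + 4 * \<mu>"
    unfolding \<mu>_def .
  then have "A + 2 * \<mu> \<le> \<Phi> (yb, tb) (xb, tb)"
    using Nk n2(2) by (simp add: \<Phi>_def add_divide_distrib)
  also have "\<dots> \<le> \<Phi> (y0, t0) (x0, s0)" using r1 tb by (intro mx) auto
  finally have big: "A + 2 * \<mu> \<le> \<Phi> (y0, t0) (x0, s0)" .
  have g0: "0 \<le> gap_fun H e (y0 - x0) (G t0)"
    using gap_fun_nonneg[OF H _ e] G(2)[of t0] in0 ab by auto
  have pos: "0 \<le> n * (t0 - s0)\<^sup>2" "0 \<le> N * exp (k * (t0 - b))" "0 \<le> (y0 \<bullet> y0) / n" "0 \<le> (x0 \<bullet> x0) / n"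
    using n0 N by auto
  have "u (y0, t0) \<le> C" "- C \<le> w (x0, s0)" using C(2)[of t0 y0] C(3)[of s0 x0] in0 ab by auto
  with big A \<mu> have sum: "gap_fun H e (y0 - x0) (G t0) + n * (t0 - s0)\<^sup>2 + N * exp (k * (t0 - b)) + (y0 \<bullet> y0) / n + (x0 \<bullet> x0) / n < 4 * C"
    by (simp add: \<Phi>_def)
  have base: "A + 2 * \<mu> \<le> u (y0, t0) - w (x0, s0) - gap_fun H e (y0 - x0) (G t0)"
    using big pos by (simp add: \<Phi>_def)
  have ts: "\<bar>t0 - s0\<bar> < d"
  proof -
    have "n * (t0 - s0)\<^sup>2 < n * d\<^sup>2" using sum pos g0 n2(1) C(1) by linarith
    then have "(t0 - s0)\<^sup>2 < d\<^sup>2" using n0 by simp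
    then show ?thesis using d(1) by (metis abs_le_square_iff abs_of_pos linorder_not_less)
  qed
  have small: "norm ((2 / n) *\<^sub>R y) < d \<and> norm y < r" if "(y \<bullet> y) / n < 4 * C" for y :: "real^'d"
  proof -
    have yy: "(norm y)\<^sup>2 < 4 * C * n" using that n0 by (simp add: field_simps dot_square_norm)
    have "(norm ((2 / n) *\<^sub>R y))\<^sup>2 = 4 * (norm y)\<^sup>2 / n\<^sup>2" using n0 by (simp add: power_mult_distrib power_divide)
    also have "\<dots> < 4 * (4 * C * n) / n\<^sup>2" using yy n0 by (intro divide_strict_right_mono) auto
    also have "\<dots> = 16 * C / n" using n0 by (simp add: power2_eq_square)
    also have "\<dots> < d\<^sup>2" using n2(1) n0 by (simp add: field_simps)
    finally have "norm ((2 / n) *\<^sub>R y) < d" using d(1) by (simp add: power2_less_imp_less)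
    moreover have "norm y < r" using yy rr r1(1) by (intro power2_less_imp_less[of "norm y" r]) auto
    ultimately show ?thesis by simp
  qed
  have sy: "norm ((2 / n) *\<^sub>R y0) < d" "norm y0 < r" using small[of y0] sum pos g0 by auto
  have sx: "norm ((2 / n) *\<^sub>R x0) < d" "norm x0 < r" using small[of x0] sum pos g0 by auto
  have nz: "norm (y0 - x0) \<le> 4 * C + Gm * h + e / 2"
  proof -
    have "norm (y0 - x0) \<le> gap_fun H e (y0 - x0) (G t0) + G t0 * h + e / 2"
      using G(2)[of t0] in0 ab h by (intro norm_le_gap_fun[OF H _ e]) (auto intro: order_trans[OF abs_ge_self])
    moreover have "G t0 * h \<le> Gm * h" using Gm[of t0] in0 h0 by (intro mult_right_mono) auto
    ultimately show ?thesis using sum pos by linarith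
  qed
  have PR: "norm (gap_momentum H e (y0 - x0) (G t)) \<le> R" if "t \<in> {a..b}" for t
  proof -
    have "norm (gap_momentum H e (y0 - x0) (G t)) \<le> 2 * norm (y0 - x0) / e"
      using G(2)[of t] that ab by (intro norm_gap_momentum_le[OF H _ e]) auto
    also have "\<dots> \<le> R" unfolding R_def using nz e by (intro divide_right_mono mult_left_mono) auto
    finally show ?thesis .
  qed
  have t0b: "t0 < b - \<theta>"
  proof -
    have "N * exp (k * (t0 - b)) < 4 * C" using sum pos g0 by linarith
    then have "exp (k * (t0 - b)) < 1 / 2" using C(1) by (simp add: N_def)
    then have "ln (exp (k * (t0 - b))) < ln (1 / 2)" by (subst ln_less_cancel_iff) auto
    then have "k * (t0 - b) < - ln 2" by (simp add: ln_div)
    then show ?thesis using k by (simp add: \<theta>_def field_simps)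
  qed
  have s0b: "s0 < b" using t0b ts d(6) by linarith
  have t0a: "a < t0"
  proof (rule ccontr)
    assume "\<not> a < t0"
    then have t0: "t0 = a" using in0 by auto
    have "\<bar>w (x0, s0) - w (x0, t0)\<bar> < \<mu>" using ts d(2) in0 ab by (intro d0(3)) auto
    then show False using base init[of y0 x0] \<mu> by (simp add: t0)
  qed
  \<comment> \<open>In \<open>\<Phi>\<close> the gap is evaluated at \<open>t0\<close>, not at
    \<open>s0\<close>, so \<open>gap_fun_decrease\<close> is used to return to
    \<open>G a\<close>.\<close>
  have s0a: "a < s0"
  proof (rule ccontr)
    assume "\<not> a < s0"
    then have s0: "s0 = a" using in0 by auto
    have 1: "\<bar>u (y0, t0) - u (y0, s0)\<bar> < \<mu>" using ts d(2) in0 ab by (intro d0(2)) auto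
    have "gap_fun H e (y0 - x0) (G a) \<le> gap_fun H e (y0 - x0) (G t0)
        + \<bar>G t0 - G a\<bar> * H (gap_momentum H e (y0 - x0) (G a))"
      using G(2)[of a] G(2)[of t0] in0 ab by (intro gap_fun_decrease[OF H _ _ e]) auto
    also have "\<bar>G t0 - G a\<bar> * H (gap_momentum H e (y0 - x0) (G a)) \<le> \<bar>G t0 - G a\<bar> * HR"
      using PR[of a] ab HR[of "gap_momentum H e (y0 - x0) (G a)"] by (intro mult_left_mono) auto
    also have "\<dots> < \<mu>" using d1(2)[of t0 a] ts d(3) in0 ab s0 by (auto simp: dist_real_def)
    finally show False using base init[of y0 x0] 1 by (simp add: s0)
  qed
  let ?p = "gap_momentum H e (y0 - x0) (G t0)"
  let ?q1 = "\<lambda>t. n * (t - s0)\<^sup>2 + N * exp (k * (t - b))"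
  let ?q1' = "\<lambda>t. 2 * n * (t - s0) + N * k * exp (k * (t - b))"
  have T1: "C1_test
     (\<lambda>z. gap_fun H e (1 *\<^sub>R fst z + (- x0)) (G (snd z)) + (1 / n) * (fst z \<bullet> fst z) + ?q1 (snd z))
     (\<lambda>z. 1 *\<^sub>R gap_momentum H e (1 *\<^sub>R fst z + (- x0)) (G (snd z)) + (2 * (1 / n)) *\<^sub>R fst z)
     (\<lambda>z. - H (gap_momentum H e (1 *\<^sub>R fst z + (- x0)) (G (snd z))) * G' (snd z) + ?q1' (snd z))"
  proof (rule gap_fun_C1_test[OF H e G(3,4)])
    show "(?q1 has_real_derivative ?q1' t) (at t)" for t
      by (auto intro!: derivative_eq_intros simp: algebra_simps)
    show "continuous_on {0<..} ?q1'" by (intro continuous_intros)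
  qed (use G(2) in auto)
  have max1: "\<forall>\<^sub>F z in nhds (y0, t0). u z - (gap_fun H e (1 *\<^sub>R fst z + (- x0)) (G (snd z)) + (1 / n) * (fst z \<bullet> fst z) + ?q1 (snd z))
     \<le> u (y0, t0) - (gap_fun H e (1 *\<^sub>R fst (y0, t0) + (- x0)) (G (snd (y0, t0))) + (1 / n) * (fst (y0, t0) \<bullet> fst (y0, t0)) + ?q1 (snd (y0, t0)))"
    unfolding eventually_nhds
  proof (intro exI[of _ "ball 0 r \<times> {a<..<b}"] conjI ballI)
    show "open (ball (0::real^'d) r \<times> {a<..<b})" by (intro open_Times) auto
    show "(y0, t0) \<in> ball 0 r \<times> {a<..<b}" using sy t0a t0b \<theta> by auto
    fix z :: "(real^'d) \<times> real" assume z: "z \<in> ball 0 r \<times> {a<..<b}"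
    obtain y t where zz: "z = (y, t)" by (cases z)
    show "u z - (gap_fun H e (1 *\<^sub>R fst z + (- x0)) (G (snd z)) + (1 / n) * (fst z \<bullet> fst z) + ?q1 (snd z))
     \<le> u (y0, t0) - (gap_fun H e (1 *\<^sub>R fst (y0, t0) + (- x0)) (G (snd (y0, t0))) + (1 / n) * (fst (y0, t0) \<bullet> fst (y0, t0)) + ?q1 (snd (y0, t0)))"
      using mx[of y x0 t s0] z sx in0 by (auto simp: zz \<Phi>_def)
  qed
  have v1: "- H ?p * G' t0 + (2 * n * (t0 - s0) + N * k * exp (k * (t0 - b))) \<le> H (?p + (2 / n) *\<^sub>R y0) * \<xi>' t0"
    using sub[unfolded viscosity_subsolution_def, rule_format, OF conjI[OF T1 conjI[OF _ max1]]] t0a ab by simp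
  let ?q2 = "\<lambda>s. n * (t0 - s)\<^sup>2"
  let ?q2' = "\<lambda>s. - 2 * n * (t0 - s)"
  \<comment> \<open>In the variables \<open>(x, s)\<close> the gap is frozen at \<open>G t0\<close>,
    so it has time derivative \<open>0\<close> and only the gluing penalty contributes.\<close>
  have T2': "C1_test
     (\<lambda>z. gap_fun H e ((-1) *\<^sub>R fst z + y0) (G t0) + (1 / n) * (fst z \<bullet> fst z) + ?q2 (snd z))
     (\<lambda>z. (-1) *\<^sub>R gap_momentum H e ((-1) *\<^sub>R fst z + y0) (G t0) + (2 * (1 / n)) *\<^sub>R fst z)
     (\<lambda>z. - H (gap_momentum H e ((-1) *\<^sub>R fst z + y0) (G t0)) * 0 + ?q2' (snd z))"
  proof (rule gap_fun_C1_test[OF H e, where G = "\<lambda>_. G t0" and G' = "\<lambda>_. 0"])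
    show "(?q2 has_real_derivative ?q2' t) (at t)" for t
      by (auto intro!: derivative_eq_intros simp: algebra_simps)
    show "continuous_on {0<..} ?q2'" by (intro continuous_intros)
  qed (use G(2) in0 ab in auto)
  note T2 = C1_test_uminus[OF T2']
  have max2: "\<forall>\<^sub>F z in nhds (x0, s0). w z - - (gap_fun H e ((-1) *\<^sub>R fst z + y0) (G t0) + (1 / n) * (fst z \<bullet> fst z) + ?q2 (snd z))
     \<ge> w (x0, s0) - - (gap_fun H e ((-1) *\<^sub>R fst (x0, s0) + y0) (G t0) + (1 / n) * (fst (x0, s0) \<bullet> fst (x0, s0)) + ?q2 (snd (x0, s0)))"
    unfolding eventually_nhds
  proof (intro exI[of _ "ball 0 r \<times> {a<..<b}"] conjI ballI)
    show "open (ball (0::real^'d) r \<times> {a<..<b})" by (intro open_Times) auto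
    show "(x0, s0) \<in> ball 0 r \<times> {a<..<b}" using sx s0a s0b by auto
    fix z :: "(real^'d) \<times> real" assume z: "z \<in> ball 0 r \<times> {a<..<b}"
    obtain x s where zz: "z = (x, s)" by (cases z)
    show "w z - - (gap_fun H e ((-1) *\<^sub>R fst z + y0) (G t0) + (1 / n) * (fst z \<bullet> fst z) + ?q2 (snd z))
     \<ge> w (x0, s0) - - (gap_fun H e ((-1) *\<^sub>R fst (x0, s0) + y0) (G t0) + (1 / n) * (fst (x0, s0) \<bullet> fst (x0, s0)) + ?q2 (snd (x0, s0)))"
      using mx[of y0 x t0 s] z sy in0 by (auto simp: zz \<Phi>_def)
  qed
  have v2: "2 * n * (t0 - s0) \<ge> H (?p - (2 / n) *\<^sub>R x0) * \<zeta>' s0"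
    using super[unfolded viscosity_supersolution_def, rule_format, OF conjI[OF T2 conjI[OF _ max2]]] s0a ab by simp
  \<comment> \<open>Subtracting the two viscosity inequalities cancels
    \<open>2 * n * (t0 - s0)\<close>, and \<open>G' = \<zeta>' - \<xi>'\<close> at \<open>t0\<close>
    lets \<open>H ?p\<close> be subtracted from both values of the Hamiltonian.\<close>
  have "\<kappa> \<le> N * k * exp (k * (t0 - b))"
    unfolding \<kappa>_def using N k in0 by (intro mult_left_mono) auto
  also have "\<dots> \<le> H (?p + (2 / n) *\<^sub>R y0) * \<xi>' t0 - H (?p - (2 / n) *\<^sub>R x0) * \<zeta>' s0 + H ?p * (\<zeta>' t0 - \<xi>' t0)"
    using v1 v2 G(5)[of t0] t0a t0b \<theta> by simp
  also have "\<dots> = (H (?p + (2 / n) *\<^sub>R y0) - H ?p) * \<xi>' t0 - (H (?p - (2 / n) *\<^sub>R x0) - H ?p) * \<zeta>' s0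
      + H ?p * (\<zeta>' t0 - \<zeta>' s0)" by (simp add: algebra_simps)
  also have "\<dots> \<le> \<bar>H (?p + (2 / n) *\<^sub>R y0) - H ?p\<bar> * Bd + \<bar>H (?p - (2 / n) *\<^sub>R x0) - H ?p\<bar> * Bd
      + \<bar>\<zeta>' t0 - \<zeta>' s0\<bar> * HR"
  proof -
    have m: "x * y \<le> \<bar>x\<bar> * c \<and> - (x * y) \<le> \<bar>x\<bar> * c" if "\<bar>y\<bar> \<le> c" for x y c :: real
    proof -
      have "\<bar>x * y\<bar> \<le> \<bar>x\<bar> * c" using that by (simp add: abs_mult mult_left_mono)
      then show ?thesis by auto
    qed
    have tin: "t0 \<in> {0..b}" "s0 \<in> {0..b}" using in0 ab by auto
    have "\<bar>H ?p\<bar> \<le> HR" using HR[of ?p] PR[of t0] in0 by auto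
    then show ?thesis
      using m[of "\<xi>' t0" Bd "H (?p + (2 / n) *\<^sub>R y0) - H ?p"] m[of "\<zeta>' s0" Bd "H (?p - (2 / n) *\<^sub>R x0) - H ?p"]
        m[of "H ?p" HR "\<zeta>' t0 - \<zeta>' s0"] Bd tin by (auto simp: mult.commute)
  qed
  also have "\<dots> < \<kappa> / 4 + \<kappa> / 4 + \<kappa> / 4"
  proof -
    have p: "norm ?p \<le> R" using PR in0 by auto
    have "norm (?p + (2 / n) *\<^sub>R y0) \<le> R + 1"
      using norm_triangle_ineq[of ?p "(2 / n) *\<^sub>R y0"] p sy(1) d(7) by linarith
    then have 1: "\<bar>H (?p + (2 / n) *\<^sub>R y0) - H ?p\<bar> * Bd < \<kappa> / 4"
      using p sy(1) d(5) by (intro d3(2)) (auto simp: mem_cball_0 dist_norm simp del: mem_cball)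
    have "norm (?p - (2 / n) *\<^sub>R x0) \<le> R + 1"
      using norm_triangle_ineq4[of ?p "(2 / n) *\<^sub>R x0"] p sx(1) d(7) by linarith
    then have 2: "\<bar>H (?p - (2 / n) *\<^sub>R x0) - H ?p\<bar> * Bd < \<kappa> / 4"
      using p sx(1) d(5) by (intro d3(2)) (auto simp: mem_cball_0 dist_norm simp del: mem_cball)
    have 3: "\<bar>\<zeta>' t0 - \<zeta>' s0\<bar> * HR < \<kappa> / 4"
      using ts d(4) in0 ab by (intro d2(2)) (auto simp: dist_real_def)
    show ?thesis using 1 2 3 by linarith
  qed
  finally show False using \<kappa> by simp
qed


section \<open>Comparison for continuously differentiable paths\<close>

lemma has_real_derivative_pos_part_square:
  "((\<lambda>x. (max 0 (c - x))\<^sup>2) has_real_derivative - 2 * max 0 (c - x)) (at x)"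
proof -
  consider "x < c" | "c < x" | "x = c" by linarith
  then show ?thesis
  proof cases
    case 1
    have "((\<lambda>x. (c - x)\<^sup>2) has_real_derivative - 2 * (c - x)) (at x)"
      by (auto intro!: derivative_eq_intros)
    then have "((\<lambda>x. (max 0 (c - x))\<^sup>2) has_real_derivative - 2 * (c - x)) (at x)"
      by (rule has_field_derivative_transform_within_open[of _ _ _ "{..<c}"]) (use 1 in auto)
    then show ?thesis using 1 by simp
  next
    case 2
    have "((\<lambda>x. 0) has_real_derivative 0) (at x)" by simp
    then have "((\<lambda>x. (max 0 (c - x))\<^sup>2) has_real_derivative 0) (at x)"
      by (rule has_field_derivative_transform_within_open[of _ _ _ "{c<..}"]) (use 2 in auto)
    then show ?thesis using 2 by simp
  next
    case 3
    have "((\<lambda>y. ((max 0 (c - y))\<^sup>2 - 0) / (y - c)) \<longlongrightarrow> 0) (at c)"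
    proof (rule Lim_null_comparison)
      have "\<bar>(max 0 (c - y))\<^sup>2 - 0\<bar> / \<bar>y - c\<bar> \<le> \<bar>y - c\<bar>" for y
        by (cases "y < c") (auto simp: power2_eq_square abs_mult)
      then show "\<forall>\<^sub>F y in at c. norm (((max 0 (c - y))\<^sup>2 - 0) / (y - c)) \<le> \<bar>y - c\<bar>"
        by simp
      have "((\<lambda>y. \<bar>y - c\<bar>) \<longlongrightarrow> \<bar>c - c\<bar>) (at c)" by (intro tendsto_intros)
      then show "((\<lambda>y. \<bar>y - c\<bar>) \<longlongrightarrow> 0) (at c)" by simp
    qed
    then show ?thesis by (simp add: 3 has_field_derivative_iff)
  qed
qed

lemma C1_path_continuous_on: "C1_path \<xi> \<xi>' \<Longrightarrow> continuous_on {0..} \<xi>"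
  unfolding C1_path_def continuous_on_eq_continuous_within
  by (auto intro: DERIV_continuous)

lemma C1_path_has_derivative_at:
  assumes "C1_path \<xi> \<xi>'" "0 < t"
  shows "(\<xi> has_real_derivative \<xi>' t) (at t)"
proof -
  have "at t within {0..} = at t" using assms(2) by (intro at_within_interior) simp
  then show ?thesis using assms by (auto simp: C1_path_def dest!: spec[of _ t])
qed

text \<open>The gap \<open>\<zeta> - \<xi> + K\<close> need only be positive on \<open>[a, b]\<close>, while test functions are required to be
  smooth for all positive times; composing the gap with \<open>r \<mapsto> r + (max 0 (k - r))\<^sup>2 / k\<close>, which is
  \<open>C\<^sup>1\<close>, positive, and the identity above \<open>k\<close>, removes the discrepancy.\<close>

lemma comparison_open:
  fixes u w :: "(real^'d) \<times> real \<Rightarrow> real"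
  assumes H: "hamiltonian H" and e: "0 < e" and ab: "0 \<le> a" "a < b"
    and paths: "C1_path \<xi> \<xi>'" "C1_path \<zeta> \<zeta>'"
    and sub: "viscosity_subsolution H \<xi>' u" and super: "viscosity_supersolution H \<zeta>' w"
    and buc: "BUC_on (UNIV \<times> {0..b}) u" "BUC_on (UNIV \<times> {0..b}) w"
    and k: "0 < k" "\<And>t. a \<le> t \<Longrightarrow> t \<le> b \<Longrightarrow> k \<le> \<zeta> t - \<xi> t + K"
    and init: "\<And>y x. u (y, a) - w (x, a) \<le> gap_fun H e (y - x) (\<zeta> a - \<xi> a + K) + A"
    and t: "a \<le> t" "t < b"
  shows "u (y, t) - w (x, t) \<le> gap_fun H e (y - x) (\<zeta> t - \<xi> t + K) + A"
proof -
  define g where "g = (\<lambda>t. \<zeta> t - \<xi> t + K)"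
  define G where "G = (\<lambda>t. g t + (max 0 (k - g t))\<^sup>2 / k)"
  define G' where "G' = (\<lambda>t. (\<zeta>' t - \<xi>' t) + - 2 * max 0 (k - g t) * (\<zeta>' t - \<xi>' t) / k)"
  have Gg: "G t = g t" if "a \<le> t" "t \<le> b" for t using k(2)[OF that] by (simp add: G_def g_def)
  have cg: "continuous_on {0..} g" unfolding g_def
    by (intro continuous_intros C1_path_continuous_on[OF paths(1)] C1_path_continuous_on[OF paths(2)])
  have c': "continuous_on {0..} \<xi>'" "continuous_on {0..} \<zeta>'" using paths by (auto simp: C1_path_def)
  have dg: "(g has_real_derivative \<zeta>' t - \<xi>' t) (at t)" if "0 < t" for t
    unfolding g_def using C1_path_has_derivative_at[OF paths(1) that] C1_path_has_derivative_at[OF paths(2) that]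
    by (auto intro!: derivative_eq_intros)
  have "u (y, t) - w (x, t) \<le> gap_fun H e (y - x) (G t) + A"
  proof (rule comparison_extended_gap[OF H e ab c' sub super buc, where G = G and G' = G'])
    show "continuous_on {0..} G" unfolding G_def by (intro continuous_intros cg) (use k in auto)
    show "0 < G t" for t
    proof (cases "g t < k")
      case True
      have "k * G t = k * g t + (k - g t)\<^sup>2" using True k by (simp add: G_def field_simps)
      also have "\<dots> = (g t - k / 2)\<^sup>2 + 3 / 4 * k\<^sup>2" by (simp add: power2_eq_square field_simps)
      also have "\<dots> > 0" using k by (intro add_nonneg_pos) auto
      finally show ?thesis using k by (simp add: zero_less_mult_iff)
    qed (use k in \<open>auto simp: G_def\<close>)
    show "(G has_real_derivative G' t) (at t)" if "0 < t" for t
      unfolding G_def G'_def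
      using DERIV_chain2[OF has_real_derivative_pos_part_square dg[OF that], of k]
      by (intro DERIV_add dg[OF that] DERIV_cdivide)
    show "continuous_on {0<..} G'" unfolding G'_def
      by (intro continuous_intros continuous_on_subset[OF cg] continuous_on_subset[OF c'(1)]
          continuous_on_subset[OF c'(2)]) (use k in auto)
    show "G' t = \<zeta>' t - \<xi>' t" if "a < t" "t < b" for t
      using k(2)[of t] that by (simp add: G'_def g_def)
    show "u (y, a) - w (x, a) \<le> gap_fun H e (y - x) (G a) + A" for y x
      using init[of y x] Gg[of a] ab by (simp add: g_def)
  qed (use t in auto)
  then show ?thesis using Gg[of t] t by (simp add: g_def)
qed

text \<open>The endpoint \<open>b\<close> is reached by letting the time in
  \<open>comparison_open\<close> tend to it from the left; all terms are continuous there since the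
  gap at \<open>b\<close> is positive.\<close>

lemma comparison:
  fixes u w :: "(real^'d) \<times> real \<Rightarrow> real"
  assumes H: "hamiltonian H" and e: "0 < e" and ab: "0 \<le> a" "a \<le> b"
    and paths: "C1_path \<xi> \<xi>'" "C1_path \<zeta> \<zeta>'"
    and sol: "viscosity_subsolution H \<xi>' u" "viscosity_supersolution H \<zeta>' w"
    and buc: "BUC_on (UNIV \<times> {0..b}) u" "BUC_on (UNIV \<times> {0..b}) w"
    and k: "0 < k" "\<And>t. a \<le> t \<Longrightarrow> t \<le> b \<Longrightarrow> k \<le> \<zeta> t - \<xi> t + K"
    and init: "\<And>y x. u (y, a) - w (x, a) \<le> gap_fun H e (y - x) (\<zeta> a - \<xi> a + K) + A"
  shows "u (y, b) - w (x, b) \<le> gap_fun H e (y - x) (\<zeta> b - \<xi> b + K) + A"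
proof (cases "a = b")
  case True
  then show ?thesis using init by simp
next
  case False
  then have ab': "a < b" using ab by simp
  let ?F = "at_left b"
  have ev: "\<forall>\<^sub>F t in ?F. t \<in> {a<..<b}" using ab' by (rule eventually_at_left_real)
  have nt: "?F \<noteq> bot" by simp
  have sub: "at b within {0..b} = ?F"
    using ab ab' by (simp add: at_within_Icc_at_left)
  have lim: "((\<lambda>t. f (y, t)) \<longlongrightarrow> f (y, b)) ?F" if "BUC_on (UNIV \<times> {0..b}) f" for f :: "(real^'d) \<times> real \<Rightarrow> real" and y
  proof -
    have "continuous_on (UNIV \<times> {0..b}) f" using that by (simp add: BUC_on_def uniformly_continuous_imp_continuous)
    then have "continuous_on {0..b} (\<lambda>t. f (y, t))"
      by (rule continuous_on_compose2) (auto intro!: continuous_intros)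
    then have "((\<lambda>t. f (y, t)) \<longlongrightarrow> f (y, b)) (at b within {0..b})"
      using ab by (auto simp: continuous_on_def)
    then show ?thesis by (simp add: sub)
  qed
  have gl: "((\<lambda>t. \<zeta> t - \<xi> t + K) \<longlongrightarrow> \<zeta> b - \<xi> b + K) ?F"
  proof -
    have "continuous_on {0..b} (\<lambda>t. \<zeta> t - \<xi> t + K)"
      by (intro continuous_intros continuous_on_subset[OF C1_path_continuous_on[OF paths(1)]]
          continuous_on_subset[OF C1_path_continuous_on[OF paths(2)]]) auto
    then have "((\<lambda>t. \<zeta> t - \<xi> t + K) \<longlongrightarrow> \<zeta> b - \<xi> b + K) (at b within {0..b})"
      using ab by (auto simp: continuous_on_def)
    then show ?thesis by (simp add: sub)
  qed
  have "0 < \<zeta> b - \<xi> b + K" using k(1) k(2)[of b] ab by simp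
  then have "isCont (\<lambda>x. gap_fun H e (fst x) (snd x)) (y - x, \<zeta> b - \<xi> b + K)"
    by (intro has_derivative_continuous[OF gap_fun_has_derivative[OF H e]])
  from isCont_tendsto_compose[OF this tendsto_Pair[OF tendsto_const gl]]
  have "((\<lambda>t. gap_fun H e (y - x) (\<zeta> t - \<xi> t + K) + A) \<longlongrightarrow> gap_fun H e (y - x) (\<zeta> b - \<xi> b + K) + A) ?F"
    by (intro tendsto_intros) simp
  moreover have "((\<lambda>t. u (y, t) - w (x, t)) \<longlongrightarrow> u (y, b) - w (x, b)) ?F"
    by (intro tendsto_diff lim buc)
  moreover have "\<forall>\<^sub>F t in ?F. u (y, t) - w (x, t) \<le> gap_fun H e (y - x) (\<zeta> t - \<xi> t + K) + A"
    using ev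
  proof eventually_elim
    case (elim t)
    show ?case
      by (rule comparison_open[OF H e ab(1) ab' paths sol buc k init]) (use elim in auto)
  qed
  ultimately show ?thesis using tendsto_le[OF nt] by blast
qed

section \<open>Pathwise solutions\<close>

text \<open>Serves restriction to shorter time intervals, passage to time slices and truncation of
  time.\<close>

lemma BUC_on_compose_nonexpansive:
  assumes f: "BUC_on S f" and g: "\<And>x. x \<in> T \<Longrightarrow> g x \<in> S"
    "\<And>x y. x \<in> T \<Longrightarrow> y \<in> T \<Longrightarrow> dist (g x) (g y) \<le> dist x y"
  shows "BUC_on T (\<lambda>x. f (g x))"
  unfolding BUC_on_def
proof
  have "(\<lambda>x. f (g x)) ` T \<subseteq> f ` S" using g(1) by auto
  then show "bounded ((\<lambda>x. f (g x)) ` T)" using f bounded_subset by (auto simp: BUC_on_def)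
  show "uniformly_continuous_on T (\<lambda>x. f (g x))"
    unfolding uniformly_continuous_on_def
  proof (intro allI impI)
    fix e :: real assume "0 < e"
    then obtain d where d: "0 < d" "\<And>x y. x \<in> S \<Longrightarrow> y \<in> S \<Longrightarrow> dist x y < d \<Longrightarrow> \<bar>f x - f y\<bar> < e"
      using BUC_on_modulus[OF f] by metis
    show "\<exists>d>0. \<forall>x\<in>T. \<forall>x'\<in>T. dist x' x < d \<longrightarrow> dist (f (g x')) (f (g x)) < e"
      using d(1) by (intro exI[of _ d]) (auto simp: dist_real_def intro!: d(2) g(1) le_less_trans[OF g(2)])
  qed
qed

lemma pathwise_comparison:
  fixes u w :: "(real^'d) \<times> real \<Rightarrow> real"
  assumes H: "hamiltonian H" and e: "0 < e" and ab: "0 \<le> a" "a \<le> b"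
    and sol: "pathwise_solution H B1 u0 u" "pathwise_solution H B2 w0 w"
    and k: "0 < k" "\<And>t. a \<le> t \<Longrightarrow> t \<le> b \<Longrightarrow> k \<le> B2 t - B1 t + K"
    and init: "\<And>y x. u (y, a) - w (x, a) \<le> gap_fun H e (y - x) (B2 a - B1 a + K) + A"
  shows "u (y, b) - w (x, b) \<le> gap_fun H e (y - x) (B2 b - B1 b + K) + A"
proof -
  have T: "0 < b + 1" using ab by simp
  obtain \<xi> \<xi>' v where u: "\<And>n. C1_path (\<xi> n) (\<xi>' n)" "uniform_limit {0..b + 1} \<xi> B1 sequentially"
      "\<And>n. viscosity_solution H (\<xi>' n) u0 (v n)" "uniform_limit (UNIV \<times> {0..b + 1}) v u sequentially"
    using sol(1) T unfolding pathwise_solution_def by blast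
  obtain \<zeta> \<zeta>' v2 where w: "\<And>n. C1_path (\<zeta> n) (\<zeta>' n)" "uniform_limit {0..b + 1} \<zeta> B2 sequentially"
      "\<And>n. viscosity_solution H (\<zeta>' n) w0 (v2 n)" "uniform_limit (UNIV \<times> {0..b + 1}) v2 w sequentially"
    using sol(2) T unfolding pathwise_solution_def by blast
  \<comment> \<open>The corrected constant makes the approximate gap at time \<open>a\<close> equal
    to the limiting one, so the initial inequality is perturbed only by
    \<open>2 * \<delta>\<close>.\<close>
  define Kn where "Kn = (\<lambda>n. B2 a - B1 a + K - (\<zeta> n a - \<xi> n a))"
  have k8: "0 < k / 8" using k by simp
  have step: "u (y, b) - w (x, b) \<le> gap_fun H e (y - x) (B2 b - B1 b + K) + (A + 2 * \<delta>)" if \<delta>: "0 < \<delta>" for \<delta>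
  proof -
    have ev: "\<forall>\<^sub>F n in sequentially. v n (y, b) - v2 n (x, b) \<le> gap_fun H e (y - x) (\<zeta> n b - \<xi> n b + Kn n) + (A + 2 * \<delta>)"
      using uniform_limitD[OF u(2) k8] uniform_limitD[OF w(2) k8] uniform_limitD[OF u(4) \<delta>] uniform_limitD[OF w(4) \<delta>]
    proof eventually_elim
      case (elim n)
      have p: "\<bar>\<xi> n t - B1 t\<bar> < k / 8" "\<bar>\<zeta> n t - B2 t\<bar> < k / 8" if "a \<le> t" "t \<le> b" for t
        using elim(1,2) that ab by (auto simp: dist_real_def)
      have q: "\<bar>v n (y, a) - u (y, a)\<bar> < \<delta>" "\<bar>v2 n (y, a) - w (y, a)\<bar> < \<delta>" for y
        using elim(3,4) ab by (auto simp: dist_real_def)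
      show ?case
      proof (rule comparison[OF H e ab u(1) w(1)])
        show "viscosity_subsolution H (\<xi>' n) (v n)" "viscosity_supersolution H (\<zeta>' n) (v2 n)"
          using u(3)[of n] w(3)[of n] by (auto simp: viscosity_solution_def)
        have "BUC_on (UNIV \<times> {0..b + 1}) (v n)" "BUC_on (UNIV \<times> {0..b + 1}) (v2 n)"
          using u(3)[of n] w(3)[of n] T by (auto simp: viscosity_solution_def)
        moreover have "BUC_on (UNIV \<times> {0..b}) f" if "BUC_on (UNIV \<times> {0..b + 1}) f" for f :: "(real^'d) \<times> real \<Rightarrow> real"
          by (rule BUC_on_compose_nonexpansive[OF that]) auto
        ultimately show "BUC_on (UNIV \<times> {0..b}) (v n)" "BUC_on (UNIV \<times> {0..b}) (v2 n)" by auto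
        show "0 < k / 2" using k by simp
        \<comment> \<open>Four path errors, two at \<open>t\<close> and two at \<open>a\<close>,
          each below \<open>k / 8\<close>, leave at least half of the gap.\<close>
        show "k / 2 \<le> \<zeta> n t - \<xi> n t + Kn n" if "a \<le> t" "t \<le> b" for t
          using p[OF that] p[of a] k(2)[OF that] ab unfolding Kn_def by linarith
        show "v n (y, a) - v2 n (x, a) \<le> gap_fun H e (y - x) (\<zeta> n a - \<xi> n a + Kn n) + (A + 2 * \<delta>)" for y x
          using q(1)[of y] q(2)[of x] init[of y x] unfolding Kn_def abs_less_iff by (simp add: algebra_simps)
      qed
    qed
    have "(\<lambda>n. \<zeta> n b - \<xi> n b + Kn n) \<longlonglongrightarrow> B2 b - B1 b + (B2 a - B1 a + K - (B2 a - B1 a))"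
      unfolding Kn_def using ab by (intro tendsto_intros tendsto_uniform_limitI[OF u(2)] tendsto_uniform_limitI[OF w(2)]) auto
    then have gl: "(\<lambda>n. \<zeta> n b - \<xi> n b + Kn n) \<longlonglongrightarrow> B2 b - B1 b + K" by simp
    have "0 < B2 b - B1 b + K" using k(1) k(2)[of b] ab by simp
    then have "isCont (\<lambda>x. gap_fun H e (fst x) (snd x)) (y - x, B2 b - B1 b + K)"
      by (intro has_derivative_continuous[OF gap_fun_has_derivative[OF H e]])
    from isCont_tendsto_compose[OF this tendsto_Pair[OF tendsto_const gl]]
    have r: "(\<lambda>n. gap_fun H e (y - x) (\<zeta> n b - \<xi> n b + Kn n) + (A + 2 * \<delta>)) \<longlonglongrightarrow> gap_fun H e (y - x) (B2 b - B1 b + K) + (A + 2 * \<delta>)"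
      by (intro tendsto_intros) simp
    have l: "(\<lambda>n. v n (y, b) - v2 n (x, b)) \<longlonglongrightarrow> u (y, b) - w (x, b)"
      using ab by (intro tendsto_diff tendsto_uniform_limitI[OF u(4)] tendsto_uniform_limitI[OF w(4)]) auto
    show ?thesis by (rule tendsto_le[OF _ r l ev]) simp
  qed
  show ?thesis
  proof (rule field_le_epsilon)
    fix \<epsilon> :: real assume "0 < \<epsilon>"
    then show "u (y, b) - w (x, b) \<le> gap_fun H e (y - x) (B2 b - B1 b + K) + A + \<epsilon>"
      using step[of "\<epsilon> / 2"] by simp
  qed
qed

lemma pathwise_solution_initial:
  assumes "pathwise_solution H B u0 u"
  shows "u (x, 0) = u0 x"
proof -
  obtain v where v: "\<And>n. v n (x, 0) = u0 x" "uniform_limit (UNIV \<times> {0..1}) v u sequentially"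
    using assms zero_less_one[where 'a = real] unfolding pathwise_solution_def viscosity_solution_def by blast
  have "(\<lambda>n. v n (x, 0)) \<longlonglongrightarrow> u (x, 0)"
    by (rule tendsto_uniform_limitI[OF v(2)]) auto
  then show ?thesis by (simp add: v(1) LIMSEQ_const_iff)
qed

section \<open>Stationary solutions and uniqueness\<close>

lemma C1_test_time_derivative:
  assumes "C1_test \<phi> D\<phi> \<phi>t" "0 < t"
  shows "((\<lambda>s. \<phi> (x, s)) has_real_derivative \<phi>t (x, t)) (at t)"
proof -
  have 1: "(\<phi> has_derivative (\<lambda>(h, s). D\<phi> (x, t) \<bullet> h + \<phi>t (x, t) * s)) (at (x, t))"
    using assms by (auto simp: C1_test_def)
  have "((\<lambda>s. (x, s)) has_derivative (\<lambda>s. (0, s))) (at t)" by (auto intro!: derivative_eq_intros)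
  from has_derivative_compose[OF this 1] show ?thesis
    by (simp add: has_field_derivative_def)
qed

lemma pathwise_solution_time_constant:
  fixes f :: "real^'d \<Rightarrow> real"
  assumes f: "BUC_on UNIV f"
  shows "pathwise_solution H (\<lambda>_. 0) f (\<lambda>z. f (fst z))"
proof -
  have stationary: "\<phi>t (x, t) = 0"
    if \<phi>: "C1_test \<phi> D\<phi> \<phi>t" "0 < t" and loc: "\<forall>\<^sub>F z in nhds (x, t). P (f (fst z) - \<phi> z) (f x - \<phi> (x, t))"
      and P: "P = (\<le>) \<or> P = (\<ge>)" for \<phi> D\<phi> \<phi>t x t P
  proof -
    have "filterlim (\<lambda>s. (x, s)) (nhds (x, t)) (nhds t)"
      by (intro tendsto_Pair tendsto_const tendsto_ident_at filterlim_ident)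
    then have "\<forall>\<^sub>F s in nhds t. P (f x - \<phi> (x, s)) (f x - \<phi> (x, t))"
      using eventually_compose_filterlim[OF loc] by fastforce
    then obtain d where d: "0 < d" "\<And>s. dist s t < d \<Longrightarrow> P (f x - \<phi> (x, s)) (f x - \<phi> (x, t))"
      by (auto simp: eventually_nhds_metric)
    note der = C1_test_time_derivative[OF \<phi>, of x]
    from P show ?thesis
    proof
      assume "P = (\<le>)"
      then show ?thesis using d by (intro DERIV_local_min[OF der d(1)]) (auto simp: dist_real_def abs_minus_commute)
    next
      assume "P = (\<ge>)"
      then show ?thesis using d by (intro DERIV_local_max[OF der d(1)]) (auto simp: dist_real_def abs_minus_commute)
    qed
  qed
  have "viscosity_solution H (\<lambda>_. 0) f (\<lambda>z. f (fst z))"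
    unfolding viscosity_solution_def
  proof (intro conjI allI impI)
    fix T :: real
    show "BUC_on (UNIV \<times> {0..T}) (\<lambda>z. f (fst z))"
      by (rule BUC_on_compose_nonexpansive[OF f]) (auto simp: dist_fst_le)
  next
    show "viscosity_subsolution H (\<lambda>_. 0) (\<lambda>z. f (fst z))"
      unfolding viscosity_subsolution_def using stationary[where P = "(\<le>)"] by force
    show "viscosity_supersolution H (\<lambda>_. 0) (\<lambda>z. f (fst z))"
      unfolding viscosity_supersolution_def using stationary[where P = "(\<ge>)"] by force
  qed simp
  then show ?thesis unfolding pathwise_solution_def
    using f by (intro conjI exI[of _ "\<lambda>_ _. 0"] exI[of _ "\<lambda>_ z. f (fst z)"])
      (auto simp: C1_path_def uniform_limit_const)
qed

text \<open>Nearby points are handled by the modulus of continuity and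
  \<open>0 \<le> gap_fun\<close>. For points at distance at least \<open>d\<close>, a momentum of
  length \<open>R = 2 * N / d\<close> along \<open>y - x\<close> makes the conjugate at least
  \<open>2 * N\<close> up to an error, and \<open>\<kappa>\<close> is so small that the error is at
  most \<open>\<delta>\<close>.\<close>

lemma BUC_gap_fun_bound:
  fixes f :: "real^'d \<Rightarrow> real"
  assumes H: "hamiltonian H" and f: "BUC_on UNIV f" and \<delta>: "0 < \<delta>"
  obtains \<kappa> where "0 < \<kappa>" "\<And>y x. f y - f x \<le> gap_fun H \<kappa> (y - x) \<kappa> + \<delta>"
proof -
  obtain d where d: "0 < d" "\<And>x y. dist x y < d \<Longrightarrow> \<bar>f x - f y\<bar> < \<delta>"
    using BUC_on_modulus[OF f \<delta>] by auto
  obtain N where N: "\<And>x. \<bar>f x\<bar> \<le> N" using BUC_on_bound[OF f] by auto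
  define R where "R = 2 * N / d"
  have N0: "0 \<le> N" using N[of 0] by auto
  have R0: "0 \<le> R" using N0 d by (simp add: R_def)
  have "continuous_on (cball 0 R) H"
    using H by (auto simp: hamiltonian_def intro: continuous_on_subset)
  then obtain h where h: "\<And>q. q \<in> cball 0 R \<Longrightarrow> \<bar>H q\<bar> \<le> h" using compact_continuous_bound[OF compact_cball] by metis
  have h0: "0 \<le> h" using h[of 0] R0 by auto
  define \<kappa> where "\<kappa> = \<delta> / (h + R\<^sup>2 + 1)"
  have hp: "0 < h + R\<^sup>2 + 1" using h0 by (simp add: add_nonneg_pos)
  have \<kappa>: "0 < \<kappa>" using \<delta> hp by (simp add: \<kappa>_def)
  have \<kappa>h: "\<kappa> * (h + R\<^sup>2) \<le> \<delta>"
  proof -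
    have "\<kappa> * (h + R\<^sup>2) \<le> \<kappa> * (h + R\<^sup>2 + 1)" using \<kappa> by (intro mult_left_mono) auto
    also have "\<dots> = \<delta>" using hp by (simp add: \<kappa>_def)
    finally show ?thesis .
  qed
  show ?thesis
  proof (rule that[OF \<kappa>])
    fix x y
    show "f y - f x \<le> gap_fun H \<kappa> (y - x) \<kappa> + \<delta>"
    proof (cases "dist y x < d")
      case True
      then show ?thesis using d(2)[OF True] gap_fun_nonneg[OF H, of \<kappa> \<kappa> "y - x"] \<kappa> by simp
    next
      case False
      define z where "z = y - x"
      have z: "d \<le> norm z" "0 < norm z" using False d(1) by (auto simp: z_def dist_norm)
      let ?q = "(R / norm z) *\<^sub>R z"
      have nq: "norm ?q = R" using z R0 by simp
      have i1: "?q \<bullet> z - \<kappa> * H ?q - \<kappa> / 2 * (?q \<bullet> ?q) \<le> gap_fun H \<kappa> z \<kappa>"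
        using \<kappa> by (intro gap_fun_ge[OF H]) auto
      have i2: "?q \<bullet> z = R * norm z" using z by (simp add: dot_square_norm power2_eq_square)
      have i3: "?q \<bullet> ?q = R\<^sup>2" using nq by (metis dot_square_norm)
      have i4: "\<kappa> * H ?q \<le> \<kappa> * h" using h[of ?q] nq \<kappa> by (intro mult_left_mono) auto
      have i5: "\<kappa> / 2 * R\<^sup>2 \<le> \<kappa> * R\<^sup>2" using \<kappa> by (intro mult_right_mono) auto
      have "R * norm z \<le> gap_fun H \<kappa> z \<kappa> + \<delta>"
        using i1 i4 i5 \<kappa>h unfolding i2 i3 distrib_left by linarith
      moreover have "2 * N \<le> R * norm z"
      proof -
        have "2 * N = R * d" using d by (simp add: R_def)
        also have "\<dots> \<le> R * norm z" using z R0 by (intro mult_left_mono) auto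
        finally show ?thesis .
      qed
      ultimately show ?thesis using N[of y] N[of x] by (simp add: z_def)
    qed
  qed
qed

text \<open>Equal paths keep the gap at the constant \<open>\<kappa>\<close>; the common initial
  datum costs only \<open>\<delta>\<close>, and the diagonal costs nothing.\<close>

lemma pathwise_solution_le:
  assumes H: "hamiltonian H" and sol: "pathwise_solution H B u0 u" "pathwise_solution H B u0 w" and t: "0 \<le> t"
  shows "u (x, t) \<le> w (x, t)"
proof (rule field_le_epsilon)
  fix \<delta> :: real assume \<delta>: "0 < \<delta>"
  have "BUC_on UNIV u0" using sol by (simp add: pathwise_solution_def)
  then obtain \<kappa> where \<kappa>: "0 < \<kappa>" "\<And>y x. u0 y - u0 x \<le> gap_fun H \<kappa> (y - x) \<kappa> + \<delta>"
    using BUC_gap_fun_bound[OF H _ \<delta>] by metis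
  have "u (x, t) - w (x, t) \<le> gap_fun H \<kappa> (x - x) (B t - B t + \<kappa>) + \<delta>"
    by (rule pathwise_comparison[OF H \<kappa>(1) order_refl t sol \<kappa>(1)])
      (use \<kappa> in \<open>auto simp: pathwise_solution_initial[OF sol(1)] pathwise_solution_initial[OF sol(2)]\<close>)
  then show "u (x, t) \<le> w (x, t) + \<delta>" using gap_fun_0[OF H _ \<kappa>(1), of \<kappa>] \<kappa>(1) by simp
qed

lemma pathwise_solution_unique:
  assumes "hamiltonian H" "pathwise_solution H B u0 u" "pathwise_solution H B u0 w" "0 \<le> t"
  shows "u (x, t) = w (x, t)"
  using pathwise_solution_le[OF assms] pathwise_solution_le[OF assms(1,3,2,4)] by (rule antisym)

section \<open>Maximum principle and decay of the oscillation\<close>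

lemma BUC_on_const: "BUC_on S (\<lambda>_. c)"
  by (auto simp: BUC_on_def uniformly_continuous_on_const bounded_iff)

text \<open>Comparison with the constant \<open>C\<close>, which is a solution for the zero path.
  The offset \<open>h + 1\<close> keeps the gap at least \<open>1\<close> on \<open>[s, t]\<close>
  whatever the path does, and at equal points \<open>gap_fun\<close> vanishes.\<close>

lemma pathwise_solution_upper:
  assumes H: "hamiltonian H" and sol: "pathwise_solution H B u0 u" and B: "continuous_on {0..} B"
    and st: "0 \<le> s" "s \<le> t" and C: "\<And>y. u (y, s) \<le> C"
  shows "u (x, t) \<le> C"
proof -
  have "continuous_on {s..t} B" using st by (auto intro: continuous_on_subset[OF B])
  then obtain h where h: "\<And>r. r \<in> {s..t} \<Longrightarrow> \<bar>B r\<bar> \<le> h" using compact_continuous_bound[OF compact_Icc] by metis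
  have hs: "\<And>r. s \<le> r \<Longrightarrow> r \<le> t \<Longrightarrow> 1 \<le> 0 - B r + (h + 1)" using h by fastforce
  have "u (x, t) - C \<le> gap_fun H 1 (x - x) (0 - B t + (h + 1)) + 0"
  proof (rule pathwise_comparison[OF H _ st sol pathwise_solution_time_constant[OF BUC_on_const] _ hs])
    fix y x :: "real^'a"
    show "u (y, s) - C \<le> gap_fun H 1 (y - x) (0 - B s + (h + 1)) + 0"
      using gap_fun_nonneg[OF H, of "0 - B s + (h + 1)" 1 "y - x"] C[of y] hs[of s] st by simp
  qed auto
  then show ?thesis using gap_fun_0[OF H, of "0 - B t + (h + 1)" 1] hs[of t] st by simp
qed

lemma pathwise_solution_lower:
  assumes H: "hamiltonian H" and sol: "pathwise_solution H B u0 u" and B: "continuous_on {0..} B"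
    and st: "0 \<le> s" "s \<le> t" and C: "\<And>y. C \<le> u (y, s)"
  shows "C \<le> u (x, t)"
proof -
  have "continuous_on {s..t} B" using st by (auto intro: continuous_on_subset[OF B])
  then obtain h where h: "\<And>r. r \<in> {s..t} \<Longrightarrow> \<bar>B r\<bar> \<le> h" using compact_continuous_bound[OF compact_Icc] by metis
  have hs: "\<And>r. s \<le> r \<Longrightarrow> r \<le> t \<Longrightarrow> 1 \<le> B r - 0 + (h + 1)" using h by fastforce
  have "C - u (x, t) \<le> gap_fun H 1 (x - x) (B t - 0 + (h + 1)) + 0"
  proof (rule pathwise_comparison[OF H _ st pathwise_solution_time_constant[OF BUC_on_const] sol _ hs])
    fix y x :: "real^'a"
    show "C - u (x, s) \<le> gap_fun H 1 (y - x) (B s - 0 + (h + 1)) + 0"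
      using gap_fun_nonneg[OF H, of "B s - 0 + (h + 1)" 1 "y - x"] C[of x] hs[of s] st by simp
  qed auto
  then show ?thesis using gap_fun_0[OF H, of "B t - 0 + (h + 1)" 1] hs[of t] st by simp
qed

lemma inner_minus_hamiltonian_le:
  assumes H: "hamiltonian H" and "norm z \<le> D" "R \<le> g" "\<And>q. norm q * D - R * H q \<le> \<delta>"
  shows "q \<bullet> z - g * H q \<le> \<delta>"
proof -
  have "q \<bullet> z \<le> norm q * norm z" by (rule norm_cauchy_schwarz)
  also have "\<dots> \<le> norm q * D" using assms(2) by (intro mult_left_mono) auto
  moreover have "R * H q \<le> g * H q" using assms(3) by (intro mult_right_mono hamiltonian_nonneg[OF H])
  ultimately show ?thesis using assms(4)[of q] by linarith
qed

text \<open>The profile at time \<open>s\<close>, frozen, is compared with \<open>u\<close>. The gap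
  starts at \<open>\<kappa>\<close>, stays above it because \<open>B s\<close> is a minimum, and
  ends above \<open>R\<close>, where \<open>gap_fun\<close> is at most
  \<open>\<delta>\<close>.\<close>

lemma pathwise_solution_rise:
  assumes H: "hamiltonian H" and sol: "pathwise_solution H B u0 u"
    and f: "BUC_on UNIV (\<lambda>x. u (x, s))" and st: "0 \<le> s" "s \<le> t"
    and min: "\<And>r. s \<le> r \<Longrightarrow> r \<le> t \<Longrightarrow> B s \<le> B r"
    and R: "R \<le> B t - B s" "\<And>q. norm q * D - R * H q \<le> \<delta>" and D: "norm (y - x) \<le> D" and \<delta>: "0 < \<delta>"
  shows "u (y, s) - u (x, t) \<le> 2 * \<delta>"
proof -
  obtain \<kappa> where \<kappa>: "0 < \<kappa>" "\<And>y x. u (y, s) - u (x, s) \<le> gap_fun H \<kappa> (y - x) \<kappa> + \<delta>"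
    using BUC_gap_fun_bound[OF H f \<delta>] by metis
  have "u (fst (y, t), s) - u (x, t) \<le> gap_fun H \<kappa> (y - x) (B t - 0 + (\<kappa> - B s)) + \<delta>"
  proof (rule pathwise_comparison[OF H \<kappa>(1) st pathwise_solution_time_constant[OF f] sol \<kappa>(1)])
    show "\<kappa> \<le> B r - 0 + (\<kappa> - B s)" if "s \<le> r" "r \<le> t" for r using min[OF that] by simp
    show "u (fst (y, s), s) - u (x, s) \<le> gap_fun H \<kappa> (y - x) (B s - 0 + (\<kappa> - B s)) + \<delta>" for y x
      using \<kappa>(2)[of y x] by simp
  qed
  also have "gap_fun H \<kappa> (y - x) (B t - 0 + (\<kappa> - B s)) \<le> \<delta>"
    by (rule gap_fun_le[OF H _ \<kappa>(1) inner_minus_hamiltonian_le[OF H D _ R(2)]])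
      (use R(1) \<kappa>(1) min[of t] st in auto)
  finally show ?thesis by simp
qed

text \<open>The roles of \<open>u\<close> and its frozen profile are exchanged, so that now a fall
  of the path opens the gap.\<close>

lemma pathwise_solution_fall:
  assumes H: "hamiltonian H" and sol: "pathwise_solution H B u0 u"
    and f: "BUC_on UNIV (\<lambda>x. u (x, s))" and st: "0 \<le> s" "s \<le> t"
    and max: "\<And>r. s \<le> r \<Longrightarrow> r \<le> t \<Longrightarrow> B r \<le> B s"
    and R: "R \<le> B s - B t" "\<And>q. norm q * D - R * H q \<le> \<delta>" and D: "norm (y - x) \<le> D" and \<delta>: "0 < \<delta>"
  shows "u (y, t) - u (x, s) \<le> 2 * \<delta>"
proof -
  obtain \<kappa> where \<kappa>: "0 < \<kappa>" "\<And>y x. u (y, s) - u (x, s) \<le> gap_fun H \<kappa> (y - x) \<kappa> + \<delta>"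
    using BUC_gap_fun_bound[OF H f \<delta>] by metis
  have "u (y, t) - u (fst (x, t), s) \<le> gap_fun H \<kappa> (y - x) (0 - B t + (\<kappa> + B s)) + \<delta>"
  proof (rule pathwise_comparison[OF H \<kappa>(1) st sol pathwise_solution_time_constant[OF f] \<kappa>(1)])
    show "\<kappa> \<le> 0 - B r + (\<kappa> + B s)" if "s \<le> r" "r \<le> t" for r using max[OF that] by simp
    show "u (y, s) - u (fst (x, s), s) \<le> gap_fun H \<kappa> (y - x) (0 - B s + (\<kappa> + B s)) + \<delta>" for y x
      using \<kappa>(2)[of y x] by simp
  qed
  also have "gap_fun H \<kappa> (y - x) (0 - B t + (\<kappa> + B s)) \<le> \<delta>"
    by (rule gap_fun_le[OF H _ \<kappa>(1) inner_minus_hamiltonian_le[OF H D _ R(2)]])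
      (use R(1) \<kappa>(1) max[of t] st in auto)
  finally show ?thesis by simp
qed

text \<open>On a sphere of radius \<open>r\<close> with \<open>r * D \<le> \<delta>\<close> the
  Hamiltonian has a positive minimum. Convexity and \<open>H 0 = 0\<close> turn this into linear
  growth outside the ball, while inside \<open>norm q * D\<close> is already at most
  \<open>\<delta>\<close>.\<close>

lemma hamiltonian_dominates:
  fixes H :: "real^'d \<Rightarrow> real"
  assumes H: "hamiltonian H" and D: "0 \<le> D" and \<delta>: "0 < \<delta>"
  obtains R where "\<And>q. norm q * D - R * H q \<le> \<delta>"
proof -
  define r where "r = \<delta> / (D + 1)"
  have r: "0 < r" "r * D \<le> \<delta>" using D \<delta> by (auto simp: r_def field_simps)
  have "continuous_on (sphere 0 r) H"
    using H by (auto simp: hamiltonian_def intro: continuous_on_subset)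
  moreover have "sphere 0 r \<noteq> ({} :: (real^'d) set)" using r by simp
  ultimately obtain p where p: "p \<in> sphere 0 r" "\<And>q. q \<in> sphere 0 r \<Longrightarrow> H p \<le> H q"
    using continuous_attains_inf[OF compact_sphere] by metis
  have "p \<noteq> 0" using p(1) r by auto
  then have m: "0 < H p" using H by (auto simp: hamiltonian_def)
  have cx: "convex_on UNIV H" using H by (simp add: hamiltonian_def)
  show ?thesis
  proof (rule that)
    fix q :: "real^'d"
    show "norm q * D - (D * r / H p) * H q \<le> \<delta>"
    proof (cases "norm q \<le> r")
      case True
      have "norm q * D \<le> r * D" using True D by (intro mult_right_mono)
      moreover have "0 \<le> (D * r / H p) * H q" using D r m hamiltonian_nonneg[OF H, of q] by simp
      ultimately show ?thesis using r by linarith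
    next
      case False
      let ?c = "r / norm q"
      have nq: "0 < norm q" using False r by linarith
      have c: "0 \<le> ?c" "?c \<le> 1" using r nq False by (auto simp: field_simps)
      have "H p \<le> H (?c *\<^sub>R q)" using r nq by (intro p(2)) auto
      also have "\<dots> \<le> ?c * H q"
        using convex_onD[OF cx c, of 0 q] H by (simp add: hamiltonian_def)
      finally have "H p * norm q \<le> r * H q" using nq by (simp add: field_simps)
      then have "D * (H p * norm q) \<le> D * (r * H q)" using D by (rule mult_left_mono)
      then have "norm q * D \<le> (D * r / H p) * H q" using m by (simp add: field_simps)
      then show ?thesis using \<delta> by simp
    qed
  qed
qed

text \<open>Integer parts of the coordinates of \<open>y - x\<close> in the basis \<open>P\<close>
  are dropped. One point \<open>y'\<close> serves all \<open>P\<close>-periodic functions, hence all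
  times of a periodic solution.\<close>

lemma lattice_reduction:
  fixes P :: "(real^'d) set"
  assumes P: "independent P" "span P = UNIV"
  obtains D where "0 \<le> D" "\<And>x y. \<exists>y'. norm (y' - x) \<le> D \<and> (\<forall>f. periodic_wrt P f \<longrightarrow> f y' = (f y :: real))"
proof
  have fin: "finite P" by (rule independent_imp_finite[OF P(1)])
  show "0 \<le> (\<Sum>p\<in>P. norm p)" by (simp add: sum_nonneg)
  fix x y :: "real^'d"
  have "y - x \<in> span P" by (simp add: P(2))
  then obtain c where c: "y - x = (\<Sum>p\<in>P. c p *\<^sub>R p)" by (auto simp: span_finite[OF fin])
  define y' where "y' = y - (\<Sum>p\<in>P. real_of_int \<lfloor>c p\<rfloor> *\<^sub>R p)"
  have "norm (y' - x) = norm (\<Sum>p\<in>P. (c p - real_of_int \<lfloor>c p\<rfloor>) *\<^sub>R p)"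
    using c by (simp add: y'_def scaleR_left_diff_distrib sum_subtractf algebra_simps)
  also have "\<dots> \<le> (\<Sum>p\<in>P. norm ((c p - real_of_int \<lfloor>c p\<rfloor>) *\<^sub>R p))" by (rule norm_sum)
  also have "\<dots> \<le> (\<Sum>p\<in>P. norm p)"
  proof (rule sum_mono)
    fix p :: "real^'d"
    have "\<bar>c p - real_of_int \<lfloor>c p\<rfloor>\<bar> \<le> 1" by linarith
    then show "norm ((c p - real_of_int \<lfloor>c p\<rfloor>) *\<^sub>R p) \<le> norm p"
      using mult_right_mono[of "\<bar>c p - real_of_int \<lfloor>c p\<rfloor>\<bar>" 1 "norm p"] by simp
  qed
  finally have near: "norm (y' - x) \<le> (\<Sum>p\<in>P. norm p)" .
  have "f y' = f y" if f: "periodic_wrt P f" for f :: "real^'d \<Rightarrow> real"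
  proof -
    have nat: "f (x + real n *\<^sub>R p) = f x" if "p \<in> P" for x p n
    proof (induction n)
      case (Suc n)
      have "f (x + real (Suc n) *\<^sub>R p) = f ((x + real n *\<^sub>R p) + p)"
        by (simp add: algebra_simps)
      also have "\<dots> = f x" using f that Suc by (simp add: periodic_wrt_def)
      finally show ?case .
    qed simp
    have int: "f (x + real_of_int k *\<^sub>R p) = f x" if "p \<in> P" for x p k
    proof (cases "0 \<le> k")
      case True
      then show ?thesis using nat[OF that, of x "nat k"] by simp
    next
      case False
      then show ?thesis using nat[OF that, of "x + real_of_int k *\<^sub>R p" "nat (- k)"] by simp
    qed
    have "f (x + (\<Sum>p\<in>Q. real_of_int (k p) *\<^sub>R p)) = f x" if "Q \<subseteq> P" for x k Q
      using finite_subset[OF that fin] that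
    proof (induction Q arbitrary: x)
      case (insert p Q)
      then show ?case using int[of p "x + (\<Sum>p\<in>Q. real_of_int (k p) *\<^sub>R p)" "k p"]
        by (simp add: add.assoc add.commute[of "real_of_int (k p) *\<^sub>R p"])
    qed simp
    from this[of P y "\<lambda>p. - \<lfloor>c p\<rfloor>"] show ?thesis
      by (simp add: y'_def sum_negf)
  qed
  then show "\<exists>y'. norm (y' - x) \<le> (\<Sum>p\<in>P. norm p) \<and> (\<forall>f. periodic_wrt P f \<longrightarrow> f y' = f y)"
    using near by blast
qed

text \<open>At a time \<open>T\<close> with \<open>\<bar>B T\<bar> > R\<close> the path has risen by
  more than \<open>R\<close> from its minimum on \<open>[0, T]\<close> or fallen by more than
  \<open>R\<close> from its maximum. Either way the oscillation at \<open>T\<close> is small, and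
  the maximum principle carries this to all later pairs of times.\<close>

lemma pathwise_solution_oscillation:
  fixes u :: "(real^'d) \<times> real \<Rightarrow> real"
  assumes H: "hamiltonian H" and sol: "pathwise_solution H B u0 u" and B: "continuous_on {0..} B" "B 0 = 0"
    and unb: "\<And>K. \<exists>n::nat. K < \<bar>B (real n)\<bar>"
    and per: "space_periodic u" and buc: "BUC_on (UNIV \<times> {0..}) u" and \<delta>: "0 < \<delta>"
  obtains T where "0 \<le> T" "\<And>x y t t'. T \<le> t \<Longrightarrow> T \<le> t' \<Longrightarrow> u (y, t) - u (x, t') \<le> 2 * \<delta>"
proof -
  obtain P where P: "\<And>t. 0 \<le> t \<Longrightarrow> periodic_wrt P (\<lambda>x. u (x, t))" using per by (auto simp: space_periodic_def)
  have "independent P" "span P = UNIV" using P[of 0] by (auto simp: periodic_wrt_def)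
  then obtain D where D: "0 \<le> D" "\<And>x y. \<exists>y'. norm (y' - x) \<le> D \<and> (\<forall>f. periodic_wrt P f \<longrightarrow> f y' = (f y :: real))"
    using lattice_reduction by metis
  obtain R where R: "\<And>q. norm q * D - R * H q \<le> \<delta>" using hamiltonian_dominates[OF H D(1) \<delta>] by metis
  obtain n :: nat where n: "R < \<bar>B (real n)\<bar>" using unb by blast
  define T where "T = real n"
  have T: "0 \<le> T" by (simp add: T_def)
  have cB: "continuous_on {0..T} B" by (auto intro: continuous_on_subset[OF B(1)])
  have slice: "BUC_on UNIV (\<lambda>x. u (x, s))" if "0 \<le> s" for s
    by (rule BUC_on_compose_nonexpansive[OF buc]) (use that in \<open>auto simp: dist_Pair_Pair\<close>)
  have ne: "{0..T} \<noteq> {}" using T by simp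
  have key: "u (y, T) - u (x, T) \<le> 2 * \<delta>" for x y
  proof (cases "0 < B T")
    case True
    obtain s where s: "s \<in> {0..T}" "\<And>r. r \<in> {0..T} \<Longrightarrow> B s \<le> B r"
      using continuous_attains_inf[OF compact_Icc ne cB] by blast
    have Ps: "periodic_wrt P (\<lambda>x. u (x, s))" using P s(1) by auto
    \<comment> \<open>Since \<open>B 0 = 0\<close>, the minimum is at most \<open>0\<close>, so the
      rise from it is at least \<open>B T\<close>.\<close>
    have Bs: "R \<le> B T - B s" using n True s(2)[of 0] T B(2) by (simp add: T_def)
    have "u (z, s) \<le> u (x, T) + 2 * \<delta>" for z
    proof -
      obtain z' where z': "norm (z' - x) \<le> D" "u (z', s) = u (z, s)"
        using D(2)[of x z] Ps by blast
      have "u (z', s) - u (x, T) \<le> 2 * \<delta>"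
        using s by (intro pathwise_solution_rise[OF H sol slice _ _ _ Bs R z'(1) \<delta>]) auto
      then show ?thesis using z' by simp
    qed
    \<comment> \<open>The bound at the minimizing time \<open>s\<close> holds for all
      \<open>z\<close>, so the maximum principle transports it to time \<open>T\<close>.\<close>
    from pathwise_solution_upper[OF H sol B(1) _ _ this] show ?thesis
      using s(1) by (simp add: diff_le_eq add.commute)
  next
    case False
    obtain s where s: "s \<in> {0..T}" "\<And>r. r \<in> {0..T} \<Longrightarrow> B r \<le> B s"
      using continuous_attains_sup[OF compact_Icc ne cB] by blast
    have Ps: "periodic_wrt P (\<lambda>x. u (x, s))" using P s(1) by auto
    have Bs: "R \<le> B s - B T" using n False s(2)[of 0] T B(2) by (simp add: T_def)
    have "u (y, T) - 2 * \<delta> \<le> u (z, s)" for z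
    proof -
      obtain z' where z': "norm (z' - y) \<le> D" "u (z', s) = u (z, s)"
        using D(2)[of y z] Ps by blast
      have "u (y, T) - u (z', s) \<le> 2 * \<delta>"
        using s z'(1) by (intro pathwise_solution_fall[OF H sol slice _ _ _ Bs R _ \<delta>]) (auto simp: norm_minus_commute)
      then show ?thesis using z' by simp
    qed
    from pathwise_solution_lower[OF H sol B(1) _ _ this] show ?thesis
      using s(1) by (simp add: diff_le_eq add.commute)
  qed
  show ?thesis
  proof (rule that[OF T])
    fix x y t t' assume t: "T \<le> t" "T \<le> t'"
    have 1: "u (y, t) - 2 * \<delta> \<le> u (z, T)" for z
    proof -
      have "u (y, t) \<le> u (z, T) + 2 * \<delta>"
        by (rule pathwise_solution_upper[OF H sol B(1) T t(1)]) (use key[of _ z] in \<open>simp add: diff_le_eq add.commute\<close>)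
      then show ?thesis by simp
    qed
    have "u (y, t) - 2 * \<delta> \<le> u (x, t')"
      by (rule pathwise_solution_lower[OF H sol B(1) T t(2) 1])
    then show "u (y, t) - u (x, t') \<le> 2 * \<delta>" by simp
  qed
qed

lemma pathwise_solution_converges:
  fixes u :: "(real^'d) \<times> real \<Rightarrow> real"
  assumes H: "hamiltonian H" and sol: "pathwise_solution H B u0 u" and B: "continuous_on {0..} B" "B 0 = 0"
    and unb: "\<And>K. \<exists>n::nat. K < \<bar>B (real n)\<bar>"
    and per: "space_periodic u" and buc: "BUC_on (UNIV \<times> {0..}) u"
  obtains l where "uniform_limit UNIV (\<lambda>t x. u (x, t)) (\<lambda>x. l) at_top"
proof -
  have osc: "\<exists>T. \<forall>x y t t'. T \<le> t \<longrightarrow> T \<le> t' \<longrightarrow> u (y, t) - u (x, t') \<le> e / 2" if "0 < e" for e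
  proof -
    have "0 < e / 4" using that by simp
    then show ?thesis
    proof (rule pathwise_solution_oscillation[OF H sol B unb per buc])
      fix T assume "\<And>x y t t'. T \<le> t \<Longrightarrow> T \<le> t' \<Longrightarrow> u (y, t) - u (x, t') \<le> 2 * (e / 4)"
      then show ?thesis by (intro exI[of _ T]) simp
    qed
  qed
  have "Cauchy (\<lambda>n. u (0, real n))"
  proof (rule metric_CauchyI)
    fix e :: real assume "0 < e"
    then obtain T where T: "\<And>x y t t'. T \<le> t \<Longrightarrow> T \<le> t' \<Longrightarrow> u (y, t) - u (x, t') \<le> e / 2"
      using osc by blast
    show "\<exists>M. \<forall>m\<ge>M. \<forall>n\<ge>M. dist (u (0, real m)) (u (0, real n)) < e"
    proof (intro exI[of _ "nat \<lceil>T\<rceil>"] allI impI)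
      fix m n assume "nat \<lceil>T\<rceil> \<le> m" "nat \<lceil>T\<rceil> \<le> n"
      then have "T \<le> real m" "T \<le> real n" by linarith+
      then show "dist (u (0, real m)) (u (0, real n)) < e"
        using T[of "real m" "real n" 0 0] T[of "real n" "real m" 0 0] \<open>0 < e\<close> by (simp add: dist_real_def abs_less_iff)
    qed
  qed
  then obtain l where l: "(\<lambda>n. u (0, real n)) \<longlonglongrightarrow> l" using Cauchy_convergent_iff convergent_def by blast
  show ?thesis
  proof (rule that, rule uniform_limitI)
    fix e :: real assume e: "0 < e"
    then obtain T where T: "\<And>x y t t'. T \<le> t \<Longrightarrow> T \<le> t' \<Longrightarrow> u (y, t) - u (x, t') \<le> e / 2"
      using osc by blast
    have ev: "\<forall>\<^sub>F n in sequentially. T \<le> real n"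
      using eventually_ge_at_top[of "nat \<lceil>T\<rceil>"] by eventually_elim linarith
    have "dist (u (x, t)) l < e" if t: "T \<le> t" for x t
    proof -
      have "u (x, t) - l \<le> e / 2"
        by (rule tendsto_upperbound[OF tendsto_diff[OF tendsto_const l]])
          (use ev in \<open>auto elim!: eventually_mono dest: T[OF t]\<close>)
      moreover have "- (e / 2) \<le> u (x, t) - l"
      proof (rule tendsto_lowerbound[OF tendsto_diff[OF tendsto_const l]])
        show "\<forall>\<^sub>F n in sequentially. - (e / 2) \<le> u (x, t) - u (0, real n)"
          using ev
        proof eventually_elim
          case (elim n)
          then show ?case using T[of "real n" t 0 x] t by simp
        qed
      qed simp
      ultimately show ?thesis using e by (simp add: dist_real_def abs_less_iff)
    qed
    then show "\<forall>\<^sub>F t in at_top. \<forall>x\<in>UNIV. dist (u (x, t)) l < e"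
      by (intro eventually_mono[OF eventually_ge_at_top[of T]]) auto
  qed
qed

section \<open>An explicit solution of the eikonal equation\<close>

text \<open>The norm is even, so changing the signs of the function and of the driving term
  exchanges the two notions.\<close>

lemma subsolution_uminus_imp_supersolution:
  fixes V :: "(real^'d) \<times> real \<Rightarrow> real"
  assumes "viscosity_subsolution norm (\<lambda>t. - \<beta> t) (\<lambda>z. - V z)"
  shows "viscosity_supersolution norm \<beta> V"
  unfolding viscosity_supersolution_def
proof (intro allI impI, elim conjE)
  fix \<phi> D\<phi> \<phi>t and x :: "real^'d" and t
  assume \<phi>: "C1_test \<phi> D\<phi> \<phi>t" "0 < t"
    and loc: "\<forall>\<^sub>F z in nhds (x, t). V (x, t) - \<phi> (x, t) \<le> V z - \<phi> z"
  have "\<forall>\<^sub>F z in nhds (x, t). - V z - - \<phi> z \<le> - V (x, t) - - \<phi> (x, t)"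
    using loc by eventually_elim simp
  then have "- \<phi>t (x, t) \<le> norm (- D\<phi> (x, t)) * - \<beta> t"
    using assms[unfolded viscosity_subsolution_def, rule_format, OF conjI[OF C1_test_uminus[OF \<phi>(1)] conjI[OF \<phi>(2)]]]
    by simp
  then show "norm (D\<phi> (x, t)) * \<beta> t \<le> \<phi>t (x, t)" by simp
qed

text \<open>A one-step dynamic programming inequality, valid for oscillating \<open>\<xi>\<close>: with \<open>M\<close> the maximum of
  \<open>\<xi>\<close> over \<open>[s, t]\<close>, every value at time \<open>t\<close> is bounded by values reached from time \<open>s\<close> by first
  dilating by \<open>M - \<xi> s\<close> and then eroding by \<open>M - \<xi> t\<close>.\<close>

lemma eikonal_subsolutionI:
  fixes V :: "(real^'d) \<times> real \<Rightarrow> real"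
  assumes path: "C1_path \<xi> \<xi>'"
    and dyn: "\<And>s t M x z. 0 \<le> s \<Longrightarrow> s < t \<Longrightarrow> (\<And>r. s \<le> r \<Longrightarrow> r \<le> t \<Longrightarrow> \<xi> r \<le> M) \<Longrightarrow> norm (z - x) \<le> M - \<xi> t \<Longrightarrow>
      \<exists>y. norm (y - z) \<le> M - \<xi> s \<and> V (x, t) \<le> V (y, s)"
  shows "viscosity_subsolution norm \<xi>' V"
  unfolding viscosity_subsolution_def
proof (intro allI impI, elim conjE)
  fix \<phi> D\<phi> \<phi>t and x :: "real^'d" and t
  assume \<phi>: "C1_test \<phi> D\<phi> \<phi>t" and t: "0 < t"
    and loc: "\<forall>\<^sub>F z in nhds (x, t). V z - \<phi> z \<le> V (x, t) - \<phi> (x, t)"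
  define p where "p = D\<phi> (x, t)"
  define q where "q = \<phi>t (x, t)"
  define S where "S = norm p + 3 * \<bar>\<xi>' t\<bar> + 4"
  have S: "0 < S" by (simp add: S_def add_nonneg_pos)
  have main: "q \<le> norm p * \<xi>' t + \<eta> * S" if \<eta>: "0 < \<eta>" "\<eta> \<le> 1" for \<eta>
  proof -
    have "(\<phi> has_derivative (\<lambda>(h, s). p \<bullet> h + q * s)) (at (x, t))"
      using \<phi> t by (auto simp: C1_test_def p_def q_def)
    then obtain d1 where d1: "0 < d1" "\<And>z. norm (z - (x, t)) < d1 \<Longrightarrow>
        norm (\<phi> z - \<phi> (x, t) - (\<lambda>(h, s). p \<bullet> h + q * s) (z - (x, t))) \<le> \<eta> * norm (z - (x, t))"
      using \<eta>(1) unfolding has_derivative_at_alt by blast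
    obtain d2 where d2: "0 < d2" "\<And>z. dist z (x, t) < d2 \<Longrightarrow> V z - \<phi> z \<le> V (x, t) - \<phi> (x, t)"
      using loc by (auto simp: eventually_nhds_metric)
    have "(\<xi> has_derivative (\<lambda>h. \<xi>' t * h)) (at t)"
      using C1_path_has_derivative_at[OF path t] by (simp add: has_field_derivative_def)
    then obtain d3 where d3: "0 < d3" "\<And>s. norm (s - t) < d3 \<Longrightarrow> norm (\<xi> s - \<xi> t - \<xi>' t * (s - t)) \<le> \<eta> * norm (s - t)"
      using \<eta>(1) unfolding has_derivative_at_alt by blast
    define L where "L = \<bar>\<xi>' t\<bar> + \<eta>"
    have L: "0 < L" using \<eta> by (simp add: L_def add_nonneg_pos)
    define \<mu> where "\<mu> = Min {d1, d2, d3, t}"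
    \<comment> \<open>The total displacement in space and time will be at most
      \<open>(3 * L + 1) * \<tau>\<close>, which this choice keeps inside all neighbourhoods and
      after time \<open>0\<close>.\<close>
    define \<tau> where "\<tau> = \<mu> / 2 / (3 * L + 1)"
    have \<mu>: "0 < \<mu>" "\<mu> \<le> d1" "\<mu> \<le> d2" "\<mu> \<le> d3" "\<mu> \<le> t" using d1 d2 d3 t by (auto simp: \<mu>_def)
    have \<tau>: "0 < \<tau>" using \<mu> L by (simp add: \<tau>_def)
    have "c * (\<mu> / 2 / c) = \<mu> / 2" if "0 < c" for c using that by simp
    from this[of "3 * L + 1"] have "(3 * L + 1) * \<tau> = \<mu> / 2" using L by (simp only: \<tau>_def)
    then have \<tau>d: "(3 * L + 1) * \<tau> < d1" "(3 * L + 1) * \<tau> < d2" "(3 * L + 1) * \<tau> < d3" "(3 * L + 1) * \<tau> < t"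
      using \<mu> by linarith+
    have \<tau>L: "\<tau> \<le> (3 * L + 1) * \<tau>" using L \<tau> by simp
    define s where "s = t - \<tau>"
    have s: "0 \<le> s" "s < t" using \<tau> \<tau>L \<tau>d(4) unfolding s_def by linarith+
    have osc: "\<bar>\<xi> r - \<xi> t\<bar> \<le> L * \<tau>" if "s \<le> r" "r \<le> t" for r
    proof -
      have r: "\<bar>r - t\<bar> \<le> \<tau>" using that by (simp add: s_def)
      then have "norm (r - t) < d3" using \<tau>L \<tau>d(3) by simp
      from d3(2)[OF this] have "\<bar>\<xi> r - \<xi> t - \<xi>' t * (r - t)\<bar> \<le> \<eta> * \<bar>r - t\<bar>" by simp
      then have "\<bar>\<xi> r - \<xi> t\<bar> \<le> \<bar>\<xi>' t * (r - t)\<bar> + \<eta> * \<bar>r - t\<bar>" by linarith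
      also have "\<dots> = L * \<bar>r - t\<bar>" by (simp add: L_def abs_mult distrib_right)
      also have "\<dots> \<le> L * \<tau>" using r L by simp
      finally show ?thesis .
    qed
    have "continuous_on {s..t} \<xi>"
      using s by (auto intro: continuous_on_subset[OF C1_path_continuous_on[OF path]])
    moreover have "{s..t} \<noteq> {}" using s by simp
    ultimately obtain r0 where r0: "r0 \<in> {s..t}" "\<And>r. r \<in> {s..t} \<Longrightarrow> \<xi> r \<le> \<xi> r0"
      using continuous_attains_sup[OF compact_Icc] by blast
    define M where "M = \<xi> r0"
    have M: "\<xi> t \<le> M" "\<xi> s \<le> M" "M - \<xi> t \<le> L * \<tau>" "M - \<xi> s \<le> 2 * (L * \<tau>)"
      using r0(2)[of t] r0(2)[of s] osc[of r0] osc[of s] r0(1) s unfolding M_def by auto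
    \<comment> \<open>Moving against the gradient through the whole erosion radius changes
      \<open>p \<bullet> x\<close> by \<open>- norm p * (M - \<xi> t)\<close>, while the dilation
      can regain at most \<open>norm p * (M - \<xi> s)\<close>. In the sum \<open>M\<close> cancels,
      leaving the increment of \<open>\<xi>\<close>.\<close>
    define z where "z = x - (M - \<xi> t) *\<^sub>R sgn p"
    have nz: "norm (z - x) \<le> M - \<xi> t" using M(1) by (auto simp: z_def norm_sgn)
    have "\<And>r. s \<le> r \<Longrightarrow> r \<le> t \<Longrightarrow> \<xi> r \<le> M" using r0(2) by (simp add: M_def)
    from dyn[OF s this nz] obtain y where y: "norm (y - z) \<le> M - \<xi> s" "V (x, t) \<le> V (y, s)" by blast
    have "norm (y - x) \<le> norm (y - z) + norm (z - x)" using norm_triangle_ineq[of "y - z" "z - x"] by simp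
    then have "norm (y - x) \<le> 3 * (L * \<tau>)" using y(1) nz M by linarith
    moreover have "norm ((y, s) - (x, t)) \<le> norm (y - x) + norm (s - t)"
      using norm_Pair_le[of "y - x" "s - t"] by simp
    ultimately have near: "norm ((y, s) - (x, t)) \<le> (3 * L + 1) * \<tau>"
      using \<tau> by (simp add: s_def algebra_simps)
    have "\<phi> (x, t) \<le> \<phi> (y, s)" using d2(2)[of "(y, s)"] near \<tau>d(2) y(2) by (simp add: dist_norm)
    moreover have "norm (\<phi> (y, s) - \<phi> (x, t) - (\<lambda>(h, s). p \<bullet> h + q * s) ((y, s) - (x, t))) \<le> \<eta> * norm ((y, s) - (x, t))"
      by (rule d1(2)) (use near \<tau>d(1) in linarith)
    then have "\<phi> (y, s) - \<phi> (x, t) \<le> p \<bullet> (y - x) + q * (s - t) + \<eta> * norm ((y, s) - (x, t))" by simp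
    moreover have "\<eta> * norm ((y, s) - (x, t)) \<le> \<eta> * ((3 * L + 1) * \<tau>)"
      using near \<eta> by (intro mult_left_mono) auto
    ultimately have 1: "q * \<tau> \<le> p \<bullet> (y - x) + \<eta> * ((3 * L + 1) * \<tau>)" by (simp add: s_def)
    have "p \<bullet> (y - x) = p \<bullet> (y - z) + p \<bullet> (z - x)" by (simp add: inner_simps)
    also have "p \<bullet> (z - x) = - (norm p * (M - \<xi> t))"
      by (cases "p = 0") (auto simp: z_def sgn_div_norm inner_simps dot_square_norm power2_eq_square)
    also have "p \<bullet> (y - z) \<le> norm p * (M - \<xi> s)"
      using norm_cauchy_schwarz[of p "y - z"] mult_left_mono[OF y(1), of "norm p"] by simp
    finally have 2: "p \<bullet> (y - x) \<le> norm p * (\<xi> t - \<xi> s)" by (simp add: algebra_simps)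
    have "\<tau> < d3" using \<tau>L \<tau>d(3) by linarith
    then have "norm (s - t) < d3" using \<tau> by (simp add: s_def)
    from d3(2)[OF this] have "\<xi> t - \<xi> s \<le> \<xi>' t * \<tau> + \<eta> * \<tau>" using \<tau> by (simp add: s_def abs_le_iff)
    then have "norm p * (\<xi> t - \<xi> s) \<le> norm p * (\<xi>' t * \<tau> + \<eta> * \<tau>)" by (intro mult_left_mono) auto
    with 1 2 have "q * \<tau> \<le> norm p * (\<xi>' t * \<tau> + \<eta> * \<tau>) + \<eta> * ((3 * L + 1) * \<tau>)" by linarith
    also have "\<dots> = (norm p * \<xi>' t + \<eta> * (norm p + 3 * L + 1)) * \<tau>" by (simp add: algebra_simps)
    finally have "q \<le> norm p * \<xi>' t + \<eta> * (norm p + 3 * L + 1)" using \<tau> by simp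
    also have "\<eta> * (norm p + 3 * L + 1) \<le> \<eta> * S"
      using \<eta> by (intro mult_left_mono) (auto simp: S_def L_def)
    finally show ?thesis by simp
  qed
  have "q \<le> norm p * \<xi>' t"
  proof (rule field_le_epsilon)
    fix e :: real assume e: "0 < e"
    define \<eta> where "\<eta> = min 1 (e / S)"
    have "\<eta> * S \<le> e" using S by (simp add: \<eta>_def min_mult_distrib_right)
    then show "q \<le> norm p * \<xi>' t + e" using main[of \<eta>] e S by (auto simp: \<eta>_def)
  qed
  then show "\<phi>t (x, t) \<le> norm (D\<phi> (x, t)) * \<xi>' t" by (simp add: p_def q_def)
qed

text \<open>This is the subsolution criterion for \<open>- V\<close> along \<open>- \<xi>\<close>,
  with \<open>M = - m\<close>; dilation and erosion change places.\<close>

lemma eikonal_supersolutionI: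
  fixes V :: "(real^'d) \<times> real \<Rightarrow> real"
  assumes path: "C1_path \<xi> \<xi>'"
    and dyn: "\<And>s t m x z. 0 \<le> s \<Longrightarrow> s < t \<Longrightarrow> (\<And>r. s \<le> r \<Longrightarrow> r \<le> t \<Longrightarrow> m \<le> \<xi> r) \<Longrightarrow> norm (z - x) \<le> \<xi> t - m \<Longrightarrow>
      \<exists>y. norm (y - z) \<le> \<xi> s - m \<and> V (y, s) \<le> V (x, t)"
  shows "viscosity_supersolution norm \<xi>' V"
proof (rule subsolution_uminus_imp_supersolution, rule eikonal_subsolutionI)
  show "C1_path (\<lambda>t. - \<xi> t) (\<lambda>t. - \<xi>' t)"
    using path by (auto simp: C1_path_def intro!: derivative_intros continuous_intros)
  fix s t M :: real and x z :: "real^'d"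
  assume "0 \<le> s" "s < t" "\<And>r. s \<le> r \<Longrightarrow> r \<le> t \<Longrightarrow> - \<xi> r \<le> M" "norm (z - x) \<le> M - - \<xi> t"
  then have "\<exists>y. norm (y - z) \<le> \<xi> s - (- M) \<and> V (y, s) \<le> V (x, t)"
    by (intro dyn) (auto simp: minus_le_iff)
  then show "\<exists>y. norm (y - z) \<le> M - - \<xi> s \<and> - V (x, t) \<le> - V (y, s)" by (simp add: add.commute)
qed

section \<open>The tent profile\<close>

definition tent :: "real \<Rightarrow> real" where
  "tent r = \<bar>r - of_int (round r)\<bar>"

lemma tent_le: "tent r \<le> \<bar>r - of_int k\<bar>"
  unfolding tent_def by (rule round_diff_minimal)

lemma tent_nonneg: "0 \<le> tent r" by (simp add: tent_def)

lemma tent_le_half: "tent r \<le> 1 / 2"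
  unfolding tent_def using of_int_round_abs_le[of r] by linarith

lemma tent_lipschitz: "\<bar>tent r - tent s\<bar> \<le> \<bar>r - s\<bar>"
proof -
  have "tent r \<le> tent s + \<bar>r - s\<bar>" for r s
    using tent_le[of r "round s"] unfolding tent_def[of s] by linarith
  from this[of r s] this[of s r] show ?thesis by linarith
qed

lemma tent_periodic: "tent (r + 1) = tent r"
proof (rule antisym)
  show "tent (r + 1) \<le> tent r"
    using tent_le[of "r + 1" "round r + 1"] by (simp add: tent_def[of r])
  show "tent r \<le> tent (r + 1)"
    using tent_le[of r "round (r + 1) - 1"] by (simp add: tent_def[of "r + 1"] diff_diff_eq2)
qed

text \<open>Every integer other than \<open>k\<close> is at distance at least \<open>1 / 2\<close>
  from \<open>of_int k + d\<close>.\<close>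

lemma tent_of_int_add:
  assumes "\<bar>d\<bar> \<le> 1 / 2"
  shows "tent (of_int k + d) = \<bar>d\<bar>"
proof (rule antisym)
  show "tent (of_int k + d) \<le> \<bar>d\<bar>" using tent_le[of "of_int k + d" k] by simp
  let ?j = "round (of_int k + d)"
  show "\<bar>d\<bar> \<le> tent (of_int k + d)"
  proof (cases "?j = k")
    case False
    then have "1 \<le> \<bar>k - ?j\<bar>" by simp
    then have "1 \<le> \<bar>of_int (k - ?j) :: real\<bar>" by linarith
    then show ?thesis using assms unfolding tent_def by (simp add: abs_if split: if_splits)
  qed (simp add: tent_def)
qed

text \<open>The point moves away from its nearest integer until it reaches height
  \<open>1 / 2\<close>; this is the highest value available within distance
  \<open>\<rho>\<close>.\<close>

lemma tent_rise:
  assumes "0 \<le> \<rho>"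
  obtains s where "\<bar>s - r\<bar> \<le> \<rho>" "min (1 / 2) (tent r + \<rho>) \<le> tent s"
proof -
  define k where "k = round r"
  define d where "d = r - of_int k"
  have d: "tent r = \<bar>d\<bar>" "\<bar>d\<bar> \<le> 1 / 2" using tent_le_half[of r] by (auto simp: d_def k_def tent_def)
  define d' where "d' = (if 0 \<le> d then min (1 / 2) (d + \<rho>) else max (- 1 / 2) (d - \<rho>))"
  show ?thesis
  proof
    have "\<bar>d' - d\<bar> \<le> \<rho>" using d(2) assms by (auto simp: d'_def min_def max_def)
    then show "\<bar>of_int k + d' - r\<bar> \<le> \<rho>" by (simp add: d_def)
    have "\<bar>d'\<bar> \<le> 1 / 2" using d(2) assms by (auto simp: d'_def min_def max_def)
    then have "tent (of_int k + d') = \<bar>d'\<bar>" by (rule tent_of_int_add)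
    moreover have "min (1 / 2) (\<bar>d\<bar> + \<rho>) \<le> \<bar>d'\<bar>" using d(2) assms by (auto simp: d'_def min_def max_def)
    ultimately show "min (1 / 2) (tent r + \<rho>) \<le> tent (of_int k + d')" by (simp only: d(1))
  qed
qed

text \<open>The point moves towards its nearest integer and stops there.\<close>

lemma tent_descend:
  assumes "0 \<le> \<rho>"
  obtains s where "\<bar>s - r\<bar> \<le> \<rho>" "tent s \<le> max 0 (tent r - \<rho>)"
proof -
  define k where "k = round r"
  define d where "d = r - of_int k"
  have d: "tent r = \<bar>d\<bar>" "\<bar>d\<bar> \<le> 1 / 2" using tent_le_half[of r] by (auto simp: d_def k_def tent_def)
  define d' where "d' = (if 0 \<le> d then max 0 (d - \<rho>) else min 0 (d + \<rho>))"
  show ?thesis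
  proof
    have "\<bar>d' - d\<bar> \<le> \<rho>" using d(2) assms by (auto simp: d'_def min_def max_def)
    then show "\<bar>of_int k + d' - r\<bar> \<le> \<rho>" by (simp add: d_def)
    have "\<bar>d'\<bar> \<le> 1 / 2" using d(2) assms by (auto simp: d'_def min_def max_def)
    then have "tent (of_int k + d') = \<bar>d'\<bar>" by (rule tent_of_int_add)
    moreover have "\<bar>d'\<bar> \<le> max 0 (\<bar>d\<bar> - \<rho>)" using d(2) assms by (auto simp: d'_def min_def max_def)
    ultimately show "tent (of_int k + d') \<le> max 0 (tent r - \<rho>)" by (simp only: d(1))
  qed
qed

section \<open>The explicit solution and its dynamic programming inequalities\<close>

definition running_min :: "(real \<Rightarrow> real) \<Rightarrow> real \<Rightarrow> real" where
  "running_min \<xi> t = (INF s\<in>{0..t}. \<xi> s)"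

text \<open>A level \<open>c\<close> counts if at some time \<open>s\<close> both
  \<open>c \<le> \<xi> s\<close>, so that its superlevel set fills the space, and
  \<open>c \<le> 1 / 2 + running_min \<xi> s\<close>, so that the set had not become empty
  before.\<close>

definition locked_level :: "(real \<Rightarrow> real) \<Rightarrow> real \<Rightarrow> real" where
  "locked_level \<xi> t = (SUP s\<in>{0..t}. min (\<xi> s) (1 / 2 + running_min \<xi> s))"

text \<open>Local boundedness makes the infima and suprema above genuine in the conditionally
  complete reals.\<close>

definition bounded_path :: "(real \<Rightarrow> real) \<Rightarrow> bool" where
  "bounded_path \<xi> \<longleftrightarrow> (\<forall>T. bounded (\<xi> ` {0..T}))"

lemma continuous_imp_bounded_path:
  assumes "continuous_on {0..} \<xi>"
  shows "bounded_path \<xi>"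
  unfolding bounded_path_def
  by (intro allI compact_imp_bounded compact_continuous_image continuous_on_subset[OF assms]) auto

lemma running_min_le:
  assumes "bounded_path \<xi>" "0 \<le> s" "s \<le> t"
  shows "running_min \<xi> t \<le> \<xi> s"
  unfolding running_min_def using assms
  by (intro cINF_lower) (auto simp: bounded_path_def intro: bounded_imp_bdd_below)

lemma running_min_greatest:
  assumes "0 \<le> t" "\<And>s. 0 \<le> s \<Longrightarrow> s \<le> t \<Longrightarrow> c \<le> \<xi> s"
  shows "c \<le> running_min \<xi> t"
  unfolding running_min_def using assms by (intro cINF_greatest) auto

lemma running_min_antimono:
  assumes "bounded_path \<xi>" "0 \<le> s" "s \<le> t"
  shows "running_min \<xi> t \<le> running_min \<xi> s"
  using assms by (intro running_min_greatest running_min_le) auto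

lemma locked_level_ge:
  assumes "bounded_path \<xi>" "0 \<le> s" "s \<le> t"
  shows "min (\<xi> s) (1 / 2 + running_min \<xi> s) \<le> locked_level \<xi> t"
  unfolding locked_level_def
proof (intro cSUP_upper)
  have "bdd_above (\<xi> ` {0..t})" using assms(1) by (auto simp: bounded_path_def intro: bounded_imp_bdd_above)
  then obtain h where "\<forall>s\<in>{0..t}. \<xi> s \<le> h" by (auto simp: bdd_above_def)
  then show "bdd_above ((\<lambda>s. min (\<xi> s) (1 / 2 + running_min \<xi> s)) ` {0..t})"
    by (intro bdd_aboveI2[of _ _ h]) (simp add: min_le_iff_disj)
qed (use assms in auto)

lemma locked_level_least:
  assumes "0 \<le> t" "\<And>s. 0 \<le> s \<Longrightarrow> s \<le> t \<Longrightarrow> min (\<xi> s) (1 / 2 + running_min \<xi> s) \<le> c"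
  shows "locked_level \<xi> t \<le> c"
  unfolding locked_level_def using assms by (intro cSUP_least) auto

lemma locked_level_mono:
  assumes "bounded_path \<xi>" "0 \<le> s" "s \<le> t"
  shows "locked_level \<xi> s \<le> locked_level \<xi> t"
  using assms by (intro locked_level_least locked_level_ge) auto

text \<open>For \<open>H = |\<cdot>|\<close> a superlevel set of the tent profile is a union of slabs whose faces move by
  \<open>\<xi>\<close>. Slabs that have merged once, or vanished once, stay so: levels of the first kind make up the
  locked level, and levels of the second kind lie above \<open>1/2 + running_min\<close>.\<close>

definition tent_solution :: "'d \<Rightarrow> (real \<Rightarrow> real) \<Rightarrow> (real^'d) \<times> real \<Rightarrow> real" where
  "tent_solution i \<xi> z =
     max (locked_level \<xi> (snd z)) (min (1 / 2 + running_min \<xi> (snd z)) (tent (fst z $ i) + \<xi> (snd z)))"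

lemma shift_component:
  fixes z :: "real^'d"
  obtains y where "y $ i = r" "norm (y - z) = \<bar>r - z $ i\<bar>"
proof
  show "(z + (r - z $ i) *\<^sub>R axis i 1) $ i = r" by (simp add: axis_def)
  show "norm (z + (r - z $ i) *\<^sub>R axis i 1 - z) = \<bar>r - z $ i\<bar>" by simp
qed

text \<open>The point \<open>y\<close> is taken where the tent is highest within reach of
  \<open>z\<close>. One estimate then dominates both the moving term at time \<open>t\<close> and
  the levels locked between \<open>s\<close> and \<open>t\<close>.\<close>

lemma tent_solution_dilate:
  fixes x z :: "real^'d"
  assumes b: "bounded_path \<xi>" and st: "0 \<le> s" "s < t"
    and M: "\<And>r. s \<le> r \<Longrightarrow> r \<le> t \<Longrightarrow> \<xi> r \<le> M" and z: "norm (z - x) \<le> M - \<xi> t"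
  shows "\<exists>y. norm (y - z) \<le> M - \<xi> s \<and> tent_solution i \<xi> (x, t) \<le> tent_solution i \<xi> (y, s)"
proof -
  have "0 \<le> M - \<xi> s" using M[of s] st by simp
  then obtain r where r: "\<bar>r - z $ i\<bar> \<le> M - \<xi> s" "min (1 / 2) (tent (z $ i) + (M - \<xi> s)) \<le> tent r"
    using tent_rise by metis
  obtain y where y: "y $ i = r" "norm (y - z) = \<bar>r - z $ i\<bar>" using shift_component by metis
  have "\<bar>z $ i - x $ i\<bar> \<le> M - \<xi> t" using z component_le_norm_cart[of "z - x" i] by simp
  then have tz: "tent (x $ i) - (M - \<xi> t) \<le> tent (z $ i)"
    using tent_lipschitz[of "z $ i" "x $ i"] by linarith
  have ms: "running_min \<xi> s \<le> \<xi> s" using running_min_le[OF b, of s s] st by simp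
  have mt: "running_min \<xi> t \<le> running_min \<xi> s" using running_min_antimono[OF b] st by simp
  \<comment> \<open>Up to the cap \<open>1 / 2 + running_min \<xi> s\<close>, dilation makes
    \<open>tent r + \<xi> s\<close> at least \<open>M\<close>, which bounds newly locked levels, and
    at least \<open>tent (x $ i) + \<xi> t\<close>, the moving term.\<close>
  have F: "min (1 / 2 + running_min \<xi> s) (max M (tent (x $ i) + \<xi> t)) \<le> min (1 / 2 + running_min \<xi> s) (tent r + \<xi> s)"
    using r(2) tz ms tent_nonneg[of "z $ i"] by (auto simp: min_def max_def split: if_splits)
  have ct: "locked_level \<xi> t \<le> max (locked_level \<xi> s) (min (1 / 2 + running_min \<xi> s) M)"
  proof (rule locked_level_least)
    fix q assume q: "0 \<le> q" "q \<le> t"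
    show "min (\<xi> q) (1 / 2 + running_min \<xi> q) \<le> max (locked_level \<xi> s) (min (1 / 2 + running_min \<xi> s) M)"
    proof (cases "q \<le> s")
      case True
      then show ?thesis using locked_level_ge[OF b q(1) True] by simp
    next
      case False
      then have "\<xi> q \<le> M" "running_min \<xi> q \<le> running_min \<xi> s"
        using M[of q] q running_min_antimono[OF b, of s q] st by auto
      then show ?thesis by (simp add: min_def max_def)
    qed
  qed (use st in simp)
  let ?R = "min (1 / 2 + running_min \<xi> s) (tent r + \<xi> s)"
  have "min (1 / 2 + running_min \<xi> s) M \<le> ?R" by (rule order_trans[OF min.mono F]) simp_all
  then have 1: "locked_level \<xi> t \<le> max (locked_level \<xi> s) ?R"
    by (rule order_trans[OF ct max.mono[OF order_refl]])
  have "min (1 / 2 + running_min \<xi> t) (tent (x $ i) + \<xi> t) \<le> ?R"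
    by (rule order_trans[OF min.mono F]) (use mt in simp_all)
  then have "min (1 / 2 + running_min \<xi> t) (tent (x $ i) + \<xi> t) \<le> max (locked_level \<xi> s) ?R"
    by (rule max.coboundedI2)
  with 1 have "tent_solution i \<xi> (x, t) \<le> tent_solution i \<xi> (y, s)"
    unfolding tent_solution_def fst_conv snd_conv y(1) by (rule max.boundedI)
  then show ?thesis using r(1) y(2) by (intro exI[of _ y]) simp
qed

text \<open>The point \<open>y\<close> lowers the tent as far as the radius allows. The capped
  moving term at time \<open>s\<close> then splits into a part at most \<open>\<xi> s\<close>,
  already dominated by the locked level, and a part dominated by the capped moving term at time
  \<open>t\<close>.\<close>

lemma tent_solution_erode:
  fixes x z :: "real^'d"
  assumes b: "bounded_path \<xi>" and st: "0 \<le> s" "s < t"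
    and m: "\<And>r. s \<le> r \<Longrightarrow> r \<le> t \<Longrightarrow> m \<le> \<xi> r" and z: "norm (z - x) \<le> \<xi> t - m"
  shows "\<exists>y. norm (y - z) \<le> \<xi> s - m \<and> tent_solution i \<xi> (y, s) \<le> tent_solution i \<xi> (x, t)"
proof -
  have "0 \<le> \<xi> s - m" using m[of s] st by simp
  then obtain r where r: "\<bar>r - z $ i\<bar> \<le> \<xi> s - m" "tent r \<le> max 0 (tent (z $ i) - (\<xi> s - m))"
    using tent_descend by metis
  obtain y where y: "y $ i = r" "norm (y - z) = \<bar>r - z $ i\<bar>" using shift_component by metis
  have "\<bar>z $ i - x $ i\<bar> \<le> \<xi> t - m" using z component_le_norm_cart[of "z - x" i] by simp
  then have tz: "tent (z $ i) \<le> tent (x $ i) + (\<xi> t - m)"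
    using tent_lipschitz[of "z $ i" "x $ i"] by linarith
  \<comment> \<open>The running minimum can drop no lower than \<open>m\<close> between
    \<open>s\<close> and \<open>t\<close>; together with \<open>tent (z $ i) \<le> 1 / 2\<close>
    this keeps \<open>tent (z $ i) + m\<close>, capped at time \<open>s\<close>, below the new
    cap.\<close>
  have mt: "min (running_min \<xi> s) m \<le> running_min \<xi> t"
  proof (rule running_min_greatest)
    fix q assume q: "0 \<le> q" "q \<le> t"
    show "min (running_min \<xi> s) m \<le> \<xi> q"
      using running_min_le[OF b q(1), of s] m[of q] q by (cases "q \<le> s") (auto simp: min_le_iff_disj)
  qed (use st in simp)
  have cs: "min (\<xi> s) (1 / 2 + running_min \<xi> s) \<le> locked_level \<xi> s"
    using locked_level_ge[OF b, of s s] st by simp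
  have ct: "locked_level \<xi> s \<le> locked_level \<xi> t" using locked_level_mono[OF b] st by simp
  have "tent r + \<xi> s \<le> max (\<xi> s) (tent (z $ i) + m)" using r(2) by (auto simp: max_def split: if_splits)
  then have "min (1 / 2 + running_min \<xi> s) (tent r + \<xi> s)
      \<le> min (1 / 2 + running_min \<xi> s) (max (\<xi> s) (tent (z $ i) + m))"
    by (rule min.mono[OF order_refl])
  also have "\<dots> = max (min (\<xi> s) (1 / 2 + running_min \<xi> s)) (min (1 / 2 + running_min \<xi> s) (tent (z $ i) + m))"
    by (simp only: min_max_distrib2 min.commute)
  also have "\<dots> \<le> max (locked_level \<xi> t) (min (1 / 2 + running_min \<xi> t) (tent (x $ i) + \<xi> t))"
  proof (rule max.mono[OF order_trans[OF cs ct]])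
    show "min (1 / 2 + running_min \<xi> s) (tent (z $ i) + m) \<le> min (1 / 2 + running_min \<xi> t) (tent (x $ i) + \<xi> t)"
      using tz mt tent_le_half[of "z $ i"] by (auto simp: min_def split: if_splits)
  qed
  finally have "tent_solution i \<xi> (y, s) \<le> tent_solution i \<xi> (x, t)"
    unfolding tent_solution_def fst_conv snd_conv y(1) by (rule max.boundedI[OF max.coboundedI1[OF ct]])
  then show ?thesis using r(1) y(2) by (intro exI[of _ y]) simp
qed

lemma tent_solution_viscosity:
  fixes i :: "'d::finite"
  assumes "C1_path \<xi> \<xi>'"
  shows "viscosity_subsolution norm \<xi>' (tent_solution i \<xi>)" "viscosity_supersolution norm \<xi>' (tent_solution i \<xi>)"
proof -
  have b: "bounded_path \<xi>" by (rule continuous_imp_bounded_path[OF C1_path_continuous_on[OF assms]])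
  show "viscosity_subsolution norm \<xi>' (tent_solution i \<xi>)"
    by (rule eikonal_subsolutionI[OF assms tent_solution_dilate[OF b]])
  show "viscosity_supersolution norm \<xi>' (tent_solution i \<xi>)"
    by (rule eikonal_supersolutionI[OF assms tent_solution_erode[OF b]])
qed

section \<open>Stability and regularity of the explicit solution\<close>

lemma running_min_perturb:
  assumes "bounded_path \<xi>" "0 \<le> t" "\<And>s. 0 \<le> s \<Longrightarrow> s \<le> t \<Longrightarrow> \<bar>\<xi> s - \<zeta> s\<bar> \<le> d"
  shows "running_min \<xi> t \<le> running_min \<zeta> t + d"
proof -
  have "running_min \<xi> t - d \<le> running_min \<zeta> t"
  proof (rule running_min_greatest[OF assms(2)])
    fix s assume s: "0 \<le> s" "s \<le> t"
    show "running_min \<xi> t - d \<le> \<zeta> s"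
      using running_min_le[OF assms(1) s] assms(3)[OF s] by linarith
  qed
  then show ?thesis by simp
qed

lemma locked_level_perturb:
  assumes b: "bounded_path \<xi>" "bounded_path \<zeta>" and t: "0 \<le> t"
    and d: "\<And>s. 0 \<le> s \<Longrightarrow> s \<le> t \<Longrightarrow> \<bar>\<xi> s - \<zeta> s\<bar> \<le> d"
  shows "locked_level \<xi> t \<le> locked_level \<zeta> t + d"
proof (rule locked_level_least[OF t])
  fix s assume s: "0 \<le> s" "s \<le> t"
  have "running_min \<xi> s \<le> running_min \<zeta> s + d"
    using s d by (intro running_min_perturb[OF b(1)]) auto
  then show "min (\<xi> s) (1 / 2 + running_min \<xi> s) \<le> locked_level \<zeta> t + d"
    using locked_level_ge[OF b(2) s] d[OF s] by (auto simp: min_def split: if_splits)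
qed

lemma max_min_nonexpansive:
  fixes a b c :: real
  assumes "\<bar>a - a'\<bar> \<le> d" "\<bar>b - b'\<bar> \<le> d" "\<bar>c - c'\<bar> \<le> d"
  shows "\<bar>max a (min b c) - max a' (min b' c')\<bar> \<le> d"
  using assms by (auto simp: min_def max_def)

text \<open>Running minimum, locked level and moving term each shift by at most the uniform distance
  of the paths. This carries the formula from smooth approximations to continuous paths.\<close>

lemma tent_solution_perturb:
  assumes b: "bounded_path \<xi>" "bounded_path \<zeta>" and t: "0 \<le> t"
    and d: "\<And>s. 0 \<le> s \<Longrightarrow> s \<le> t \<Longrightarrow> \<bar>\<xi> s - \<zeta> s\<bar> \<le> d"
  shows "\<bar>tent_solution i \<xi> (x, t) - tent_solution i \<zeta> (x, t)\<bar> \<le> d"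
proof -
  have d': "\<And>s. 0 \<le> s \<Longrightarrow> s \<le> t \<Longrightarrow> \<bar>\<zeta> s - \<xi> s\<bar> \<le> d" using d by (simp add: abs_minus_commute)
  show ?thesis
    unfolding tent_solution_def fst_conv snd_conv
    using running_min_perturb[OF b(1) t d] running_min_perturb[OF b(2) t d'] d[OF t order_refl]
      locked_level_perturb[OF b t d] locked_level_perturb[OF b(2,1) t d']
    by (intro max_min_nonexpansive) auto
qed

text \<open>Between \<open>s\<close> and \<open>t\<close> the running minimum falls and the locked
  level rises by at most \<open>d\<close>; the tent contributes its Lipschitz constant
  \<open>1\<close> in space.\<close>

lemma tent_solution_modulus:
  assumes b: "bounded_path \<xi>" and st: "0 \<le> s" "s \<le> t"
    and d: "\<And>r. s \<le> r \<Longrightarrow> r \<le> t \<Longrightarrow> \<bar>\<xi> r - \<xi> s\<bar> \<le> d"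
  shows "\<bar>tent_solution i \<xi> (x, t) - tent_solution i \<xi> (y, s)\<bar> \<le> d + norm (x - y)"
proof -
  have d0: "0 \<le> d" using d[of s] st by simp
  have "running_min \<xi> s - d \<le> running_min \<xi> t"
  proof (rule running_min_greatest)
    fix q assume q: "0 \<le> q" "q \<le> t"
    show "running_min \<xi> s - d \<le> \<xi> q"
    proof (cases "q \<le> s")
      case True
      then show ?thesis using running_min_le[OF b q(1) True] d0 by simp
    next
      case False
      then show ?thesis using running_min_le[OF b st(1) order_refl] d[of q] q by (auto simp: abs_le_iff)
    qed
  qed (use st in simp)
  moreover have ms: "running_min \<xi> q \<le> running_min \<xi> s" if "s \<le> q" for q
    using running_min_antimono[OF b st(1) that] .
  moreover have "locked_level \<xi> t \<le> locked_level \<xi> s + d"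
  proof (rule locked_level_least)
    fix q assume q: "0 \<le> q" "q \<le> t"
    show "min (\<xi> q) (1 / 2 + running_min \<xi> q) \<le> locked_level \<xi> s + d"
    proof (cases "q \<le> s")
      case True
      then show ?thesis using locked_level_ge[OF b q(1) True] d0 by simp
    next
      case False
      have "\<xi> q \<le> \<xi> s + d" using d[of q] q False by auto
      then show ?thesis using locked_level_ge[OF b st(1) order_refl] ms[of q] d0 False
        by (auto simp: min_def split: if_splits)
    qed
  qed (use st in simp)
  moreover have "locked_level \<xi> s \<le> locked_level \<xi> t" by (rule locked_level_mono[OF b st])
  moreover have "\<bar>tent (x $ i) - tent (y $ i)\<bar> \<le> norm (x - y)"
    using tent_lipschitz[of "x $ i" "y $ i"] component_le_norm_cart[of "x - y" i] by simp
  moreover have "\<bar>\<xi> t - \<xi> s\<bar> \<le> d" using d st by simp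
  moreover have "running_min \<xi> t \<le> running_min \<xi> s" using ms st by simp
  ultimately show ?thesis
    unfolding tent_solution_def fst_conv snd_conv using d0 norm_ge_zero[of "x - y"]
    by (intro max_min_nonexpansive; linarith)
qed

lemma tent_solution_bounded:
  assumes b: "bounded_path \<xi>" and h: "\<And>s. 0 \<le> s \<Longrightarrow> s \<le> t \<Longrightarrow> \<bar>\<xi> s\<bar> \<le> h" and t: "0 \<le> t"
  shows "\<bar>tent_solution i \<xi> (x, t)\<bar> \<le> h + 1"
proof -
  have "- h \<le> running_min \<xi> t" using h t by (intro running_min_greatest) (auto simp: abs_le_iff minus_le_iff)
  moreover have rm: "running_min \<xi> t \<le> \<xi> t" "running_min \<xi> 0 \<le> \<xi> 0" using running_min_le[OF b] t by auto
  moreover have "locked_level \<xi> t \<le> h"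
  proof (rule locked_level_least[OF t])
    fix s assume "0 \<le> s" "s \<le> t"
    then show "min (\<xi> s) (1 / 2 + running_min \<xi> s) \<le> h" using h[of s] by auto
  qed
  moreover have "- h \<le> locked_level \<xi> t"
  proof -
    have "- h \<le> \<xi> 0" "- h \<le> running_min \<xi> 0"
      using h[of 0] t by (auto simp: abs_le_iff minus_le_iff intro!: running_min_greatest)
    then show ?thesis using locked_level_ge[OF b order_refl t] by (auto simp: min_def split: if_splits)
  qed
  moreover have "\<bar>\<xi> t\<bar> \<le> h" using h t by simp
  ultimately show ?thesis
    using tent_nonneg[of "x $ i"] tent_le_half[of "x $ i"]
    unfolding tent_solution_def fst_conv snd_conv by (auto simp: min_def max_def abs_le_iff)
qed

lemma tent_solution_BUC:
  fixes i :: "'d::finite"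
  assumes c: "continuous_on {0..} \<xi>"
  shows "BUC_on (UNIV \<times> {0..T}) (tent_solution i \<xi>)"
  unfolding BUC_on_def
proof
  have b: "bounded_path \<xi>" by (rule continuous_imp_bounded_path[OF c])
  have cT: "continuous_on {0..T} \<xi>" by (auto intro: continuous_on_subset[OF c])
  obtain h where "\<And>s. s \<in> {0..T} \<Longrightarrow> \<bar>\<xi> s\<bar> \<le> h" using compact_continuous_bound[OF compact_Icc cT] by metis
  then have "norm (tent_solution i \<xi> z) \<le> h + 1" if "z \<in> UNIV \<times> {0..T}" for z
    using that tent_solution_bounded[OF b, of "snd z" h i "fst z"] by auto
  then show "bounded (tent_solution i \<xi> ` (UNIV \<times> {0..T}))" unfolding bounded_iff by blast
  show "uniformly_continuous_on (UNIV \<times> {0..T}) (tent_solution i \<xi>)"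
    unfolding uniformly_continuous_on_def
  proof (intro allI impI)
    fix e :: real assume e: "0 < e"
    obtain d where d: "0 < d" "\<And>x y. x \<in> {0..T} \<Longrightarrow> y \<in> {0..T} \<Longrightarrow> dist x y < d \<Longrightarrow> \<bar>\<xi> x - \<xi> y\<bar> * 1 < e / 2"
      using uniformly_continuous_on_compact_margin[OF cT compact_Icc, of "e / 2" 1] e by auto
    have *: "\<bar>tent_solution i \<xi> (x, t) - tent_solution i \<xi> (y, s)\<bar> < e"
      if "0 \<le> s" "s \<le> t" "t \<le> T" "dist (x, t) (y, s) < min d (e / 2)" for x y s t
    proof -
      have "t - s < d" using that dist_snd_le[of "(x, t)" "(y, s)"] by (simp add: dist_real_def)
      then have "\<bar>\<xi> r - \<xi> s\<bar> \<le> e / 2" if "s \<le> r" "r \<le> t" for r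
        using d(2)[of r s] that \<open>0 \<le> s\<close> \<open>t \<le> T\<close> by (auto simp: dist_real_def)
      from tent_solution_modulus[OF b that(1,2) this, of i x y]
      have "\<bar>tent_solution i \<xi> (x, t) - tent_solution i \<xi> (y, s)\<bar> \<le> e / 2 + norm (x - y)" by simp
      also have "norm (x - y) < e / 2" using that dist_fst_le[of "(x, t)" "(y, s)"] by (simp add: dist_norm)
      finally show ?thesis by simp
    qed
    show "\<exists>d>0. \<forall>z\<in>UNIV \<times> {0..T}. \<forall>z'\<in>UNIV \<times> {0..T}. dist z' z < d \<longrightarrow> dist (tent_solution i \<xi> z') (tent_solution i \<xi> z) < e"
    proof (intro exI[of _ "min d (e / 2)"] conjI ballI impI)
      show "0 < min d (e / 2)" using d e by simp
      fix z z' :: "(real^'d) \<times> real"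
      assume z: "z \<in> UNIV \<times> {0..T}" "z' \<in> UNIV \<times> {0..T}" "dist z' z < min d (e / 2)"
      obtain x t y s where zz: "z = (x, t)" "z' = (y, s)" by (metis prod.collapse)
      show "dist (tent_solution i \<xi> z') (tent_solution i \<xi> z) < e"
        using *[of s t x y] *[of t s y x] z dist_commute[of z z'] unfolding zz
        by (cases "s \<le> t") (auto simp: dist_real_def abs_minus_commute)
    qed
  qed
qed

lemma tent_solution_initial:
  assumes "bounded_path \<xi>" "\<xi> 0 = 0"
  shows "tent_solution i \<xi> (x, 0) = tent (x $ i)"
proof -
  have "running_min \<xi> 0 = 0" "locked_level \<xi> 0 = 0"
    by (simp_all add: running_min_def locked_level_def assms(2))
  then show ?thesis
    using tent_nonneg[of "x $ i"] tent_le_half[of "x $ i"] assms(2) by (simp add: tent_solution_def)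
qed

lemma tent_solution_viscosity_solution:
  assumes "C1_path \<xi> \<xi>'" "\<xi> 0 = 0"
  shows "viscosity_solution norm \<xi>' (\<lambda>x. tent (x $ i)) (tent_solution i \<xi>)"
  unfolding viscosity_solution_def
  using tent_solution_viscosity[OF assms(1)] tent_solution_BUC[OF C1_path_continuous_on[OF assms(1)]]
    tent_solution_initial[OF continuous_imp_bounded_path[OF C1_path_continuous_on[OF assms(1)]] assms(2)]
  by blast

section \<open>The explicit solution along continuous paths\<close>

text \<open>Weierstrass polynomials on \<open>[0, n]\<close> are shifted to vanish at
  \<open>0\<close>. The shift can double the error, so the polynomial is chosen within half the
  tolerance.\<close>

lemma C1_path_approximation:
  assumes c: "continuous_on {0..} B" and B0: "B 0 = 0"
  obtains \<xi> \<xi>' where "\<And>n::nat. C1_path (\<xi> n) (\<xi>' n)" "\<And>n. \<xi> n 0 = 0"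
    "\<And>n t. 0 \<le> t \<Longrightarrow> t \<le> real n \<Longrightarrow> \<bar>\<xi> n t - B t\<bar> \<le> 1 / real (Suc n)"
proof -
  have "\<exists>\<xi> \<xi>'. C1_path \<xi> \<xi>' \<and> \<xi> 0 = 0 \<and> (\<forall>t. 0 \<le> t \<longrightarrow> t \<le> real n \<longrightarrow> \<bar>\<xi> t - B t\<bar> \<le> 1 / real (Suc n))" for n
  proof -
    have "0 < 1 / (2 * real (Suc n))" by simp
    moreover have "continuous_on {0..real n} B" by (auto intro: continuous_on_subset[OF c])
    ultimately obtain g where g: "real_polynomial_function g" "\<And>x. x \<in> {0..real n} \<Longrightarrow> \<bar>B x - g x\<bar> < 1 / (2 * real (Suc n))"
      using Stone_Weierstrass_real_polynomial_function[OF compact_Icc] by blast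
    obtain g' where g': "real_polynomial_function g'" "\<And>x. (g has_real_derivative g' x) (at x)"
      using has_real_derivative_polynomial_function[OF g(1)] by blast
    have "continuous_on {0..} g'"
      using g'(1) by (intro continuous_on_polymonial_function) (simp add: real_polynomial_function_eq)
    moreover have "((\<lambda>t. g t - g 0) has_real_derivative g' t) (at t within {0..})" for t
      using has_field_derivative_at_within[OF g'(2)] by (auto intro!: derivative_eq_intros)
    ultimately have "C1_path (\<lambda>t. g t - g 0) g'" by (simp add: C1_path_def)
    moreover have "\<bar>g t - g 0 - B t\<bar> \<le> 1 / real (Suc n)" if "0 \<le> t" "t \<le> real n" for t
    proof -
      have "\<bar>B t - g t\<bar> + \<bar>B 0 - g 0\<bar> \<le> 1 / (2 * real (Suc n)) + 1 / (2 * real (Suc n))"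
        using g(2)[of t] g(2)[of 0] that by auto
      also have "\<dots> = 1 / real (Suc n)" by (simp add: field_simps)
      finally show ?thesis using B0 by linarith
    qed
    ultimately show ?thesis by (intro exI[of _ "\<lambda>t. g t - g 0"] exI[of _ g']) auto
  qed
  then obtain \<xi> \<xi>' where "\<And>n. C1_path (\<xi> n) (\<xi>' n) \<and> \<xi> n 0 = 0 \<and> (\<forall>t. 0 \<le> t \<longrightarrow> t \<le> real n \<longrightarrow> \<bar>\<xi> n t - B t\<bar> \<le> 1 / real (Suc n))"
    by metis
  then show ?thesis by (intro that[of \<xi> \<xi>']) auto
qed

text \<open>The tent is the initial slice of the explicit solution driven by the zero path, whose
  uniform continuity is already known.\<close>

lemma tent_BUC: "BUC_on UNIV (\<lambda>x::real^'d. tent (x $ i))"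
proof -
  have "BUC_on (UNIV \<times> {0..0}) (tent_solution i (\<lambda>_. 0))" by (rule tent_solution_BUC) simp
  from BUC_on_compose_nonexpansive[OF this, of UNIV "\<lambda>x. (x, 0)"]
  have "BUC_on UNIV (\<lambda>x::real^'d. tent_solution i (\<lambda>_. 0) (x, 0))" by (simp add: dist_Pair_Pair)
  then show ?thesis
    by (simp add: tent_solution_initial[OF continuous_imp_bounded_path])
qed

text \<open>The explicit solutions along smooth approximations converge uniformly by
  \<open>tent_solution_perturb\<close>.\<close>

lemma tent_solution_pathwise:
  fixes i :: "'d::finite"
  assumes c: "continuous_on {0..} B" and B0: "B 0 = 0"
  shows "pathwise_solution norm B (\<lambda>x. tent (x $ i)) (tent_solution i B)"
proof -
  obtain \<xi> \<xi>' where \<xi>: "\<And>n::nat. C1_path (\<xi> n) (\<xi>' n)" "\<And>n. \<xi> n 0 = 0"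
    "\<And>n t. 0 \<le> t \<Longrightarrow> t \<le> real n \<Longrightarrow> \<bar>\<xi> n t - B t\<bar> \<le> 1 / real (Suc n)"
    using C1_path_approximation[OF c B0] by metis
  have b: "bounded_path B" "bounded_path (\<xi> n)" for n
    using continuous_imp_bounded_path[OF c] continuous_imp_bounded_path[OF C1_path_continuous_on[OF \<xi>(1)]] by auto
  have close: "\<forall>\<^sub>F n in sequentially. \<forall>t\<in>{0..T}. \<bar>\<xi> n t - B t\<bar> < e" if e: "0 < e" for e T
  proof -
    obtain N where N: "1 / real (Suc N) < e" using nat_approx_posE[OF e] by metis
    have "\<bar>\<xi> n t - B t\<bar> < e" if "max N (nat \<lceil>T\<rceil>) \<le> n" "t \<in> {0..T}" for n t
    proof -
      have "nat \<lceil>T\<rceil> \<le> n" "t \<le> T" using that by auto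
      then have "t \<le> real n" by linarith
      then have "\<bar>\<xi> n t - B t\<bar> \<le> 1 / real (Suc n)" using that by (intro \<xi>(3)) auto
      also have "\<dots> \<le> 1 / real (Suc N)" using that by (intro divide_left_mono) auto
      finally show ?thesis using N by simp
    qed
    then show ?thesis unfolding eventually_sequentially by blast
  qed
  show ?thesis
    unfolding pathwise_solution_def
  proof (rule conjI[OF tent_BUC], rule exI[of _ \<xi>], rule exI[of _ \<xi>'],
      rule exI[of _ "\<lambda>n. tent_solution i (\<xi> n)"], intro conjI allI impI)
    show "C1_path (\<xi> n) (\<xi>' n)" "\<xi> n 0 = 0" for n using \<xi> by auto
    show "viscosity_solution norm (\<xi>' n) (\<lambda>x. tent (x $ i)) (tent_solution i (\<xi> n))" for n
      by (rule tent_solution_viscosity_solution[OF \<xi>(1,2)])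
    fix T :: real
    show "uniform_limit {0..T} \<xi> B sequentially"
      using close[of _ T] by (auto intro!: uniform_limitI simp: dist_real_def)
    show "uniform_limit (UNIV \<times> {0..T}) (\<lambda>n. tent_solution i (\<xi> n)) (tent_solution i B) sequentially"
    proof (rule uniform_limitI)
      fix e :: real assume "0 < e"
      then have e2: "0 < e / 2" by simp
      show "\<forall>\<^sub>F n in sequentially. \<forall>z\<in>UNIV \<times> {0..T}. dist (tent_solution i (\<xi> n) z) (tent_solution i B z) < e"
        using close[OF e2, of T]
      proof eventually_elim
        case (elim n)
        show ?case
        proof
          fix z :: "(real^'d) \<times> real" assume "z \<in> UNIV \<times> {0..T}"
          moreover obtain x t where z: "z = (x, t)" by (cases z)
          ultimately have "\<bar>tent_solution i (\<xi> n) (x, t) - tent_solution i B (x, t)\<bar> \<le> e / 2"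
            using elim by (intro tent_solution_perturb[OF b(2,1)]) (auto intro: less_imp_le)
          then show "dist (tent_solution i (\<xi> n) z) (tent_solution i B z) < e"
            using \<open>0 < e\<close> by (simp add: z dist_real_def)
        qed
      qed
    qed
  qed
qed

lemma hamiltonian_norm: "hamiltonian (norm :: real^'d \<Rightarrow> real)"
  using convex_on_dist[of UNIV "0 :: real^'d"] by (auto simp: hamiltonian_def intro!: continuous_intros)

lemma tent_periodic_wrt: "periodic_wrt Basis (\<lambda>x::real^'d. tent (x $ i))"
  unfolding periodic_wrt_def
proof (intro conjI ballI allI)
  fix p x :: "real^'d" assume "p \<in> Basis"
  then have "p $ i = 0 \<or> p $ i = 1" by (auto simp: Basis_vec_def axis_def)
  then show "tent ((x + p) $ i) = tent (x $ i)" by (auto simp: tent_periodic)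
qed (auto simp: independent_Basis)

lemma tent_solution_space_periodic: "space_periodic (tent_solution i \<xi>)"
  unfolding space_periodic_def
proof (intro exI[of _ Basis] allI impI)
  fix t :: real
  show "periodic_wrt Basis (\<lambda>x. tent_solution i \<xi> (x, t))"
    using tent_periodic_wrt[of i] by (simp add: periodic_wrt_def tent_solution_def)
qed

section \<open>Locking and the long-time limit\<close>

text \<open>From such a time on the cap of the moving term does not exceed the locked level, so the
  explicit solution is constant in space and time.\<close>

definition locked_by :: "(real \<Rightarrow> real) \<Rightarrow> real \<Rightarrow> bool" where
  "locked_by \<xi> T \<longleftrightarrow> 0 \<le> T \<and> 1 / 2 + running_min \<xi> T \<le> locked_level \<xi> T"

text \<open>A rise to \<open>1 / 2\<close> lifts the locked level to the cap, since the running
  minimum is at most \<open>0\<close>. A fall to \<open>- 1 / 2\<close> lowers the cap to at most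
  \<open>0\<close>, which the locked level is never below.\<close>

lemma locked_byI:
  assumes b: "bounded_path \<xi>" and \<xi>0: "\<xi> 0 = 0" and T: "0 \<le> T" "1 / 2 \<le> \<bar>\<xi> T\<bar>"
  shows "locked_by \<xi> T"
proof (cases "0 < \<xi> T")
  case True
  then have "1 / 2 + running_min \<xi> T \<le> min (\<xi> T) (1 / 2 + running_min \<xi> T)"
    using running_min_le[OF b order_refl T(1)] \<xi>0 T(2) by simp
  also have "\<dots> \<le> locked_level \<xi> T" by (rule locked_level_ge[OF b T(1) order_refl])
  finally show ?thesis using T by (simp add: locked_by_def)
next
  case False
  have "running_min \<xi> 0 = 0" by (simp add: running_min_def \<xi>0)
  then have "0 \<le> locked_level \<xi> T" using locked_level_ge[OF b order_refl T(1)] \<xi>0 by simp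
  moreover have "running_min \<xi> T \<le> - (1 / 2)" using running_min_le[OF b T(1) order_refl] False T(2) by simp
  ultimately show ?thesis using T by (simp add: locked_by_def)
qed

lemma locked_level_constant:
  assumes b: "bounded_path \<xi>" and T: "locked_by \<xi> T" "T \<le> t"
  shows "locked_level \<xi> t = locked_level \<xi> T"
proof (rule antisym)
  show "locked_level \<xi> t \<le> locked_level \<xi> T"
  proof (rule locked_level_least)
    fix s assume s: "0 \<le> s" "s \<le> t"
    show "min (\<xi> s) (1 / 2 + running_min \<xi> s) \<le> locked_level \<xi> T"
    proof (cases "s \<le> T")
      case True
      then show ?thesis using locked_level_ge[OF b s(1)] by simp
    next
      case False
      then show ?thesis using running_min_antimono[OF b, of T s] T by (auto simp: locked_by_def)
    qed
  qed (use T in \<open>auto simp: locked_by_def\<close>)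
  show "locked_level \<xi> T \<le> locked_level \<xi> t"
    using T by (intro locked_level_mono[OF b]) (auto simp: locked_by_def)
qed

lemma tent_solution_constant:
  assumes b: "bounded_path \<xi>" and T: "locked_by \<xi> T" "T \<le> t"
  shows "tent_solution i \<xi> (x, t) = locked_level \<xi> T"
  using locked_level_constant[OF assms] running_min_antimono[OF b _ T(2)] T(1)
  by (auto simp: tent_solution_def locked_by_def max_def min_def)

text \<open>After locking nothing changes, so the solution equals its composition with truncation of
  time at \<open>T\<close>.\<close>

lemma tent_solution_BUC_global:
  assumes c: "continuous_on {0..} \<xi>" and T: "locked_by \<xi> T"
  shows "BUC_on (UNIV \<times> {0..}) (tent_solution i \<xi>)"
proof -
  have b: "bounded_path \<xi>" by (rule continuous_imp_bounded_path[OF c])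
  have T0: "0 \<le> T" using T by (simp add: locked_by_def)
  have "BUC_on (UNIV \<times> {0..T}) (tent_solution i \<xi>)" by (rule tent_solution_BUC[OF c])
  then have "BUC_on (UNIV \<times> {0..}) (\<lambda>z. tent_solution i \<xi> (fst z, min (snd z) T))"
  proof (rule BUC_on_compose_nonexpansive)
    fix z z' :: "(real^'a) \<times> real"
    have "dist (min (snd z) T) (min (snd z') T) \<le> dist (snd z) (snd z')"
      by (auto simp: dist_real_def min_def)
    then show "dist (fst z, min (snd z) T) (fst z', min (snd z') T) \<le> dist z z'"
      by (cases z, cases z') (auto simp: dist_Pair_Pair intro!: power_mono)
  qed (use T0 in auto)
  moreover have "tent_solution i \<xi> (fst z, min (snd z) T) = tent_solution i \<xi> z" for z
    using tent_solution_constant[OF b T, of "snd z" i "fst z"] tent_solution_constant[OF b T order_refl, of i "fst z"]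
    by (cases "snd z \<le> T") (auto simp: min_def)
  ultimately show ?thesis by simp
qed

lemma tent_solution_limit:
  assumes b: "bounded_path \<xi>" and T: "locked_by \<xi> T"
  shows "uniform_limit UNIV (\<lambda>t x. tent_solution i \<xi> (x, t)) (\<lambda>x. locked_level \<xi> T) at_top"
proof (rule uniform_limitI)
  fix e :: real assume "0 < e"
  then show "\<forall>\<^sub>F t in at_top. \<forall>x\<in>UNIV. dist (tent_solution i \<xi> (x, t)) (locked_level \<xi> T) < e"
    by (intro eventually_mono[OF eventually_ge_at_top[of T]]) (simp add: tent_solution_constant[OF b T])
qed

section \<open>Restarting the path, and discretization of the locked level\<close>

text \<open>The path after \<open>h\<close> contributes its own locked level, raised by
  \<open>\<xi> h\<close> and cut off at the cap inherited from the time before \<open>h\<close>.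
  This is the recursion from which non-constancy follows.\<close>

lemma locked_level_restart:
  assumes b: "bounded_path \<xi>" and h: "0 \<le> h" and t: "0 \<le> t"
  defines "\<zeta> \<equiv> \<lambda>r. \<xi> (h + r) - \<xi> h"
  shows "locked_level \<xi> (h + t) = max (locked_level \<xi> h) (min (1 / 2 + running_min \<xi> h) (\<xi> h + locked_level \<zeta> t))"
proof -
  have b\<zeta>: "bounded_path \<zeta>"
    unfolding bounded_path_def
  proof
    fix T
    have "bounded (\<xi> ` {0..h + T})" using b by (simp add: bounded_path_def)
    then obtain K where K: "\<forall>x\<in>{0..h + T}. \<bar>\<xi> x\<bar> \<le> K" by (auto simp: bounded_iff)
    have "\<bar>\<zeta> r\<bar> \<le> K + \<bar>\<xi> h\<bar>" if "r \<in> {0..T}" for r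
      using K[rule_format, of "h + r"] that h by (auto simp: \<zeta>_def)
    then show "bounded (\<zeta> ` {0..T})" unfolding bounded_iff by (intro exI[of _ "K + \<bar>\<xi> h\<bar>"]) auto
  qed
  have rm: "running_min \<xi> (h + r) = min (running_min \<xi> h) (\<xi> h + running_min \<zeta> r)" if r: "0 \<le> r" for r
  proof (rule antisym)
    have "running_min \<xi> (h + r) - \<xi> h \<le> running_min \<zeta> r"
      using r h by (intro running_min_greatest) (auto simp: \<zeta>_def intro!: running_min_le[OF b])
    then show "running_min \<xi> (h + r) \<le> min (running_min \<xi> h) (\<xi> h + running_min \<zeta> r)"
      using running_min_antimono[OF b h, of "h + r"] r by simp
    show "min (running_min \<xi> h) (\<xi> h + running_min \<zeta> r) \<le> running_min \<xi> (h + r)"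
    proof (rule running_min_greatest)
      fix s assume s: "0 \<le> s" "s \<le> h + r"
      show "min (running_min \<xi> h) (\<xi> h + running_min \<zeta> r) \<le> \<xi> s"
        using running_min_le[OF b s(1), of h] running_min_le[OF b\<zeta>, of "s - h" r] s
        by (cases "s \<le> h") (auto simp: \<zeta>_def min_le_iff_disj)
    qed (use r h in simp)
  qed
  show ?thesis
  proof (rule antisym)
    show "locked_level \<xi> (h + t) \<le> max (locked_level \<xi> h) (min (1 / 2 + running_min \<xi> h) (\<xi> h + locked_level \<zeta> t))"
    proof (rule locked_level_least)
      fix s assume s: "0 \<le> s" "s \<le> h + t"
      show "min (\<xi> s) (1 / 2 + running_min \<xi> s) \<le> max (locked_level \<xi> h) (min (1 / 2 + running_min \<xi> h) (\<xi> h + locked_level \<zeta> t))"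
      proof (cases "s \<le> h")
        case True
        then show ?thesis using locked_level_ge[OF b s(1) True] by simp
      next
        case False
        have 1: "min (\<zeta> (s - h)) (1 / 2 + running_min \<zeta> (s - h)) \<le> locked_level \<zeta> t"
          using False s by (intro locked_level_ge[OF b\<zeta>]) auto
        have 2: "running_min \<xi> s = min (running_min \<xi> h) (\<xi> h + running_min \<zeta> (s - h))" using rm[of "s - h"] False by simp
        have 3: "\<xi> s = \<xi> h + \<zeta> (s - h)" by (simp add: \<zeta>_def)
        have "min (\<xi> s) (1 / 2 + running_min \<xi> s) \<le> min (1 / 2 + running_min \<xi> h) (\<xi> h + locked_level \<zeta> t)"
          using 1 unfolding 2 3 by (auto simp: min_def split: if_splits)
        then show ?thesis by (rule max.coboundedI2)
      qed
    qed (use h t in simp)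
    have "min (1 / 2 + running_min \<xi> h) (\<xi> h + locked_level \<zeta> t) \<le> locked_level \<xi> (h + t)"
    proof (rule ccontr)
      \<comment> \<open>Now the cap \<open>1 / 2 + running_min \<xi> h\<close> exceeds the locked
        level at \<open>h + t\<close>, so it is never the active term of a minimum, and the bounds
        pass to \<open>\<zeta>\<close>.\<close>
      assume *: "\<not> ?thesis"
      have "locked_level \<zeta> t \<le> locked_level \<xi> (h + t) - \<xi> h"
      proof (rule locked_level_least[OF t])
        fix r assume r: "0 \<le> r" "r \<le> t"
        have 1: "min (\<xi> (h + r)) (1 / 2 + running_min \<xi> (h + r)) \<le> locked_level \<xi> (h + t)"
          using r h by (intro locked_level_ge[OF b]) auto
        have 3: "\<xi> (h + r) = \<xi> h + \<zeta> r" by (simp add: \<zeta>_def)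
        show "min (\<zeta> r) (1 / 2 + running_min \<zeta> r) \<le> locked_level \<xi> (h + t) - \<xi> h"
          using 1 * unfolding rm[OF r(1)] 3 by (auto simp: min_def split: if_splits)
      qed
      then show False using * by simp
    qed
    then show "max (locked_level \<xi> h) (min (1 / 2 + running_min \<xi> h) (\<xi> h + locked_level \<zeta> t)) \<le> locked_level \<xi> (h + t)"
      using locked_level_mono[OF b h, of "h + t"] t by simp
  qed
qed

text \<open>Writing the limit in terms of finitely many path values is what makes it measurable and exhibits
  its independence of the past.\<close>

definition grid_level :: "nat \<Rightarrow> (nat \<Rightarrow> real) \<Rightarrow> real" where
  "grid_level N x = Max ((\<lambda>k. min (x k) (1 / 2 + Min (x ` {..k}))) ` {..N})"

text \<open>The mesh \<open>1 / 2 ^ n\<close> shrinks while the horizon \<open>n\<close> passes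
  \<open>T\<close>. Grid points after \<open>T\<close> exceed the locked level by no more than the
  discretization error, because the cap is already below it.\<close>

lemma grid_level_tendsto:
  assumes c: "continuous_on {0..} \<xi>" and T: "locked_by \<xi> T"
  shows "(\<lambda>n. grid_level (n * 2 ^ n) (\<lambda>k. \<xi> (real k / 2 ^ n))) \<longlonglongrightarrow> locked_level \<xi> T"
proof (rule LIMSEQ_I)
  fix e :: real assume e: "0 < e"
  have b: "bounded_path \<xi>" by (rule continuous_imp_bounded_path[OF c])
  have T0: "0 \<le> T" using T by (simp add: locked_by_def)
  have cT: "continuous_on {0..T} \<xi>" by (auto intro: continuous_on_subset[OF c])
  obtain d where d: "0 < d" "\<And>x y. x \<in> {0..T} \<Longrightarrow> y \<in> {0..T} \<Longrightarrow> dist x y < d \<Longrightarrow> \<bar>\<xi> x - \<xi> y\<bar> * 1 < e / 2"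
    using uniformly_continuous_on_compact_margin[OF cT compact_Icc, of "e / 2" 1] e by auto
  obtain n1 :: nat where n1: "(1 / 2) ^ n1 < d" using real_arch_pow_inv[OF d(1), of "1 / 2"] by auto
  show "\<exists>no. \<forall>n\<ge>no. norm (grid_level (n * 2 ^ n) (\<lambda>k. \<xi> (real k / 2 ^ n)) - locked_level \<xi> T) < e"
  proof (intro exI[of _ "max n1 (nat \<lceil>T\<rceil>)"] allI impI)
    fix n assume n: "max n1 (nat \<lceil>T\<rceil>) \<le> n"
    have "nat \<lceil>T\<rceil> \<le> n" using n by simp
    then have Tn: "T \<le> real n" by linarith
    have "(1 / 2 :: real) ^ n \<le> (1 / 2) ^ n1" using n by (intro power_decreasing) auto
    then have n2: "1 / 2 ^ n < d" using n1 by (simp add: power_one_over)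
    define x where "x = (\<lambda>k. \<xi> (real k / 2 ^ n))"
    \<comment> \<open>Index of the last grid point not after \<open>s\<close>; rounding down keeps
      the running minimum from decreasing.\<close>
    define j where "j = (\<lambda>s :: real. nat \<lfloor>s * 2 ^ n\<rfloor>)"
    have j: "real (j s) / 2 ^ n \<le> s" "s - real (j s) / 2 ^ n < d" if "0 \<le> s" for s
    proof -
      have "real (j s) \<le> s * 2 ^ n" "s * 2 ^ n < real (j s) + 1" using that by (auto simp: j_def)
      then have "real (j s) / 2 ^ n \<le> s" "s < (real (j s) + 1) / 2 ^ n"
        by (auto simp: pos_divide_le_eq pos_less_divide_eq)
      then have "real (j s) / 2 ^ n \<le> s" "s - real (j s) / 2 ^ n < 1 / 2 ^ n"
        by (auto simp: add_divide_distrib)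
      then show "real (j s) / 2 ^ n \<le> s" "s - real (j s) / 2 ^ n < d" using n2 by auto
    qed
    have xj: "\<bar>x (j s) - \<xi> s\<bar> < e / 2" if "0 \<le> s" "s \<le> T" for s
      using d(2)[of "real (j s) / 2 ^ n" s] j[OF that(1)] that by (auto simp: x_def dist_real_def)
    have Min_upper: "Min (x ` {..k}) - e / 2 \<le> running_min \<xi> t" if t: "0 \<le> t" "t \<le> T" "t \<le> real k / 2 ^ n" for k t
    proof (rule running_min_greatest[OF t(1)])
      fix s assume s: "0 \<le> s" "s \<le> t"
      have "real (j s) / 2 ^ n \<le> real k / 2 ^ n" using j(1)[OF s(1)] s(2) t(3) by linarith
      then have "j s \<le> k" by (simp add: divide_le_cancel)
      then have "Min (x ` {..k}) \<le> x (j s)" by (intro Min_le) auto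
      then show "Min (x ` {..k}) - e / 2 \<le> \<xi> s" using xj[of s] s t by linarith
    qed
    have Min_lower: "running_min \<xi> (real k / 2 ^ n) \<le> Min (x ` {..k})" for k
    proof (rule Min.boundedI)
      fix y assume "y \<in> x ` {..k}"
      then obtain l where l: "y = x l" "l \<le> k" by auto
      then show "running_min \<xi> (real k / 2 ^ n) \<le> y"
        using running_min_le[OF b, of "real l / 2 ^ n" "real k / 2 ^ n"] by (simp add: x_def divide_right_mono)
    qed auto
    have up: "grid_level (n * 2 ^ n) x \<le> locked_level \<xi> T + e / 2"
      unfolding grid_level_def
    proof (rule Max.boundedI)
      fix y assume "y \<in> (\<lambda>k. min (x k) (1 / 2 + Min (x ` {..k}))) ` {..n * 2 ^ n}"
      then obtain k where k: "y = min (x k) (1 / 2 + Min (x ` {..k}))" by auto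
      show "y \<le> locked_level \<xi> T + e / 2"
      proof (cases "real k / 2 ^ n \<le> T")
        case True
        have "min (\<xi> (real k / 2 ^ n)) (1 / 2 + running_min \<xi> (real k / 2 ^ n)) \<le> locked_level \<xi> T"
          using True by (intro locked_level_ge[OF b]) auto
        then show ?thesis using Min_upper[of "real k / 2 ^ n" k] True e unfolding k
          by (auto simp: x_def min_def split: if_splits)
      next
        case False
        then show ?thesis using Min_upper[of T k] T T0 unfolding k by (auto simp: locked_by_def min_def)
      qed
    qed auto
    have "locked_level \<xi> T \<le> grid_level (n * 2 ^ n) x + e / 2"
    proof (rule locked_level_least[OF T0])
      fix s assume s: "0 \<le> s" "s \<le> T"
      have "real (j s) / 2 ^ n \<le> real n" using j(1)[OF s(1)] s(2) Tn by linarith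
      then have "real (j s) \<le> real (n * 2 ^ n)" by (simp add: pos_divide_le_eq)
      then have "j s \<le> n * 2 ^ n" by (simp only: of_nat_le_iff)
      then have 1: "min (x (j s)) (1 / 2 + Min (x ` {..j s})) \<le> grid_level (n * 2 ^ n) x"
        unfolding grid_level_def by (intro Max_ge) auto
      have "running_min \<xi> s \<le> running_min \<xi> (real (j s) / 2 ^ n)"
        using j(1)[OF s(1)] by (intro running_min_antimono[OF b]) auto
      from order_trans[OF this Min_lower]
      have "min (\<xi> s) (1 / 2 + running_min \<xi> s) \<le> min (x (j s) + e / 2) (1 / 2 + Min (x ` {..j s}) + e / 2)"
        using xj[OF s] e by (intro min.mono) linarith+
      also have "\<dots> = min (x (j s)) (1 / 2 + Min (x ` {..j s})) + e / 2"
        by (simp only: min_add_distrib_left)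
      finally show "min (\<xi> s) (1 / 2 + running_min \<xi> s) \<le> grid_level (n * 2 ^ n) x + e / 2"
        using 1 by linarith
    qed
    then show "norm (grid_level (n * 2 ^ n) (\<lambda>k. \<xi> (real k / 2 ^ n)) - locked_level \<xi> T) < e"
      using up e by (simp add: x_def[symmetric] abs_less_iff)
  qed
qed

section \<open>Brownian paths\<close>

text \<open>The union over \<open>N\<close> is increasing, so its probability is a limit of values
  each at most \<open>prob (A N)\<close>.\<close>

lemma (in prob_space) prob_eventually_le:
  assumes "\<And>n::nat. A n \<in> events" "\<And>n. prob (A n) \<le> p"
  shows "prob (\<Union>N. \<Inter>n\<in>{N..}. A n) \<le> p"
proof -
  let ?I = "\<lambda>N::nat. \<Inter>n\<in>{N..}. A n"
  have ev: "?I N \<in> events" for N using assms(1) by (intro sets.countable_INT') auto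
  have "incseq ?I" by (intro incseq_SucI) force
  then have "(\<lambda>N. prob (?I N)) \<longlonglongrightarrow> prob (\<Union>N. ?I N)"
    using ev by (intro finite_Lim_measure_incseq) auto
  moreover have "prob (?I N) \<le> p" for N
  proof -
    have "prob (?I N) \<le> prob (A N)" using assms(1) by (intro finite_measure_mono) auto
    then show ?thesis using assms(2)[of N] by linarith
  qed
  ultimately show ?thesis by (intro LIMSEQ_le_const2) auto
qed

lemma (in prob_space) AE_not_in_prob_le_0:
  assumes "A \<in> events" "prob A \<le> 0"
  shows "AE \<omega> in M. \<omega> \<notin> A"
  using assms by (intro AE_not_in) (simp add: null_sets_def emeasure_eq_measure measure_le_0_iff)

lemma normal_density_le:
  assumes "0 < \<sigma>"
  shows "normal_density \<mu> \<sigma> x \<le> 1 / \<sigma>"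
proof -
  have "\<sigma> \<le> sqrt (2 * pi * \<sigma>\<^sup>2)"
  proof (rule real_le_rsqrt)
    have "1 * \<sigma>\<^sup>2 \<le> 2 * pi * \<sigma>\<^sup>2" using pi_gt3 by (intro mult_right_mono) auto
    then show "\<sigma>\<^sup>2 \<le> 2 * pi * \<sigma>\<^sup>2" by simp
  qed
  then have "1 / sqrt (2 * pi * \<sigma>\<^sup>2) \<le> 1 / \<sigma>" using assms by (intro divide_left_mono) auto
  moreover have "exp (- (x - \<mu>)\<^sup>2 / (2 * \<sigma>\<^sup>2)) \<le> 1" by simp
  ultimately have "1 / sqrt (2 * pi * \<sigma>\<^sup>2) * exp (- (x - \<mu>)\<^sup>2 / (2 * \<sigma>\<^sup>2)) \<le> 1 / \<sigma> * 1"
    using assms by (intro mult_mono) auto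
  then show ?thesis by (simp add: normal_density_def)
qed

lemma (in prob_space) normal_interval_le:
  assumes Y: "distributed M lborel Y (normal_density \<mu> \<sigma>)" and \<sigma>: "0 < \<sigma>" and e: "0 \<le> e"
  shows "emeasure (distr M borel Y) {y. \<bar>y - c\<bar> \<le> e} \<le> ennreal (2 * e / \<sigma>)"
proof -
  have eq: "{y. \<bar>y - c\<bar> \<le> e} = {c - e..c + e}" by auto
  have mY: "Y \<in> measurable M borel" using distributed_measurable[OF Y] by simp
  have "emeasure (distr M borel Y) {c - e..c + e} = emeasure M (Y -` {c - e..c + e} \<inter> space M)"
    using mY by (intro emeasure_distr) auto
  also have "\<dots> = (\<integral>\<^sup>+ y. ennreal (normal_density \<mu> \<sigma> y) * indicator {c - e..c + e} y \<partial>lborel)"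
    by (rule distributed_emeasure[OF Y]) simp
  also have "\<dots> \<le> (\<integral>\<^sup>+ y. ennreal (1 / \<sigma>) * indicator {c - e..c + e} y \<partial>lborel)"
    using normal_density_le[OF \<sigma>] by (intro nn_integral_mono mult_right_mono ennreal_leI) auto
  also have "\<dots> = ennreal (1 / \<sigma>) * emeasure lborel {c - e..c + e}"
    by (intro nn_integral_cmult_indicator) simp
  also have "\<dots> = ennreal (2 * e / \<sigma>)"
    using e \<sigma> by (simp add: ennreal_mult'[symmetric])
  finally show ?thesis unfolding eq .
qed

lemma (in prob_space) normal_interval_prob_le:
  assumes Y: "distributed M lborel Y (normal_density \<mu> \<sigma>)" and \<sigma>: "0 < \<sigma>" and e: "0 \<le> e"
  shows "prob {\<omega> \<in> space M. \<bar>Y \<omega> - c\<bar> \<le> e} \<le> 2 * e / \<sigma>"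
proof -
  have mY: "Y \<in> measurable M borel" using distributed_measurable[OF Y] by simp
  have "{\<omega> \<in> space M. \<bar>Y \<omega> - c\<bar> \<le> e} = Y -` {y. \<bar>y - c\<bar> \<le> e} \<inter> space M" by auto
  moreover have "{y. \<bar>y - c\<bar> \<le> e} = {c - e..c + e}" by auto
  ultimately have "emeasure M {\<omega> \<in> space M. \<bar>Y \<omega> - c\<bar> \<le> e} = emeasure (distr M borel Y) {y. \<bar>y - c\<bar> \<le> e}"
    using mY by (simp add: emeasure_distr)
  also have "\<dots> \<le> ennreal (2 * e / \<sigma>)" by (rule normal_interval_le[OF assms])
  finally show ?thesis using e \<sigma> by (simp add: emeasure_eq_measure)
qed

text \<open>Independence makes the joint law a product. Fubini reduces the event to slices, each an
  interval of length \<open>2 * e\<close> for \<open>Y\<close>, whatever the value of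
  \<open>X\<close>.\<close>

lemma (in prob_space) normal_sum_interval_le:
  assumes Y: "distributed M lborel Y (normal_density \<mu> \<sigma>)" and \<sigma>: "0 < \<sigma>" and e: "0 \<le> e"
    and ind: "indep_var borel X borel Y"
  shows "prob {\<omega> \<in> space M. \<bar>X \<omega> + Y \<omega> - c\<bar> \<le> e} \<le> 2 * e / \<sigma>"
proof -
  have mX: "X \<in> measurable M borel" and mY: "Y \<in> measurable M borel"
    and eq: "distr M borel X \<Otimes>\<^sub>M distr M borel Y = distr M (borel \<Otimes>\<^sub>M borel) (\<lambda>\<omega>. (X \<omega>, Y \<omega>))"
    using ind by (auto simp: indep_var_distribution_eq)
  interpret X: prob_space "distr M borel X" by (rule prob_space_distr[OF mX])
  interpret Y: prob_space "distr M borel Y" by (rule prob_space_distr[OF mY])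
  let ?S = "{z :: real \<times> real. \<bar>fst z + snd z - c\<bar> \<le> e}"
  have S: "?S \<in> sets (borel \<Otimes>\<^sub>M borel)"
    unfolding borel_prod by (intro borel_closed closed_Collect_le continuous_intros)
  have pre: "{\<omega> \<in> space M. \<bar>X \<omega> + Y \<omega> - c\<bar> \<le> e} = (\<lambda>\<omega>. (X \<omega>, Y \<omega>)) -` ?S \<inter> space M" by auto
  have "emeasure M {\<omega> \<in> space M. \<bar>X \<omega> + Y \<omega> - c\<bar> \<le> e} = emeasure (distr M (borel \<Otimes>\<^sub>M borel) (\<lambda>\<omega>. (X \<omega>, Y \<omega>))) ?S"
    unfolding pre using mX mY S by (intro emeasure_distr[symmetric]) auto
  also have "\<dots> = emeasure (distr M borel X \<Otimes>\<^sub>M distr M borel Y) ?S" by (simp add: eq)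
  also have "\<dots> = (\<integral>\<^sup>+ x. emeasure (distr M borel Y) (Pair x -` ?S) \<partial>distr M borel X)"
    using S by (intro Y.emeasure_pair_measure_alt) simp
  also have "\<dots> \<le> (\<integral>\<^sup>+ x. ennreal (2 * e / \<sigma>) \<partial>distr M borel X)"
  proof (rule nn_integral_mono)
    fix x
    have "Pair x -` ?S = {y. \<bar>y - (c - x)\<bar> \<le> e}" by (auto simp: algebra_simps)
    then show "emeasure (distr M borel Y) (Pair x -` ?S) \<le> ennreal (2 * e / \<sigma>)"
      using normal_interval_le[OF Y \<sigma> e] by simp
  qed
  also have "\<dots> = ennreal (2 * e / \<sigma>)" using X.emeasure_space_1 by simp
  finally show ?thesis using e \<sigma> by (simp add: emeasure_eq_measure)
qed

text \<open>A centred normal variable has the same law as its negative and no atom at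
  \<open>0\<close>.\<close>

lemma (in prob_space) normal_nonpos_prob:
  assumes Y: "distributed M lborel Y (normal_density 0 \<sigma>)" and \<sigma>: "0 < \<sigma>"
  shows "prob {\<omega> \<in> space M. Y \<omega> \<le> 0} \<le> 1 / 2" "prob {\<omega> \<in> space M. 0 \<le> Y \<omega>} \<le> 1 / 2"
proof -
  have mY[measurable]: "Y \<in> measurable M borel" using distributed_measurable[OF Y] by simp
  have Y': "distributed M lborel (\<lambda>\<omega>. 0 + (-1) * Y \<omega>) (normal_density (0 + (-1) * 0) (\<bar>-1\<bar> * \<sigma>))"
    by (rule normal_density_affine[OF Y \<sigma>]) simp
  have "emeasure M (Y -` {..0} \<inter> space M) = emeasure M ((\<lambda>\<omega>. 0 + (-1) * Y \<omega>) -` {..0} \<inter> space M)"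
    using distributed_emeasure[OF Y, of "{..0}"] distributed_emeasure[OF Y', of "{..0}"] by simp
  moreover have "Y -` {..0} \<inter> space M = {\<omega> \<in> space M. Y \<omega> \<le> 0}"
    "(\<lambda>\<omega>. 0 + (-1) * Y \<omega>) -` {..0} \<inter> space M = {\<omega> \<in> space M. 0 \<le> Y \<omega>}" by auto
  ultimately have sym: "prob {\<omega> \<in> space M. Y \<omega> \<le> 0} = prob {\<omega> \<in> space M. 0 \<le> Y \<omega>}"
    by (simp add: measure_def)
  have zero: "prob {\<omega> \<in> space M. Y \<omega> = 0} = 0"
  proof -
    have "emeasure (distr M borel Y) {y. \<bar>y - 0\<bar> \<le> 0} \<le> ennreal (2 * 0 / \<sigma>)"
      by (rule normal_interval_le[OF Y \<sigma>]) simp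
    then have "emeasure (distr M borel Y) {0} = 0" by simp
    moreover have "Y -` {0} \<inter> space M = {\<omega> \<in> space M. Y \<omega> = 0}" by auto
    ultimately show ?thesis by (simp add: emeasure_distr measure_def)
  qed
  have "{\<omega> \<in> space M. 0 \<le> Y \<omega>} = {\<omega> \<in> space M. Y \<omega> = 0} \<union> {\<omega> \<in> space M. 0 < Y \<omega>}" by auto
  then have "prob {\<omega> \<in> space M. 0 \<le> Y \<omega>} \<le> prob {\<omega> \<in> space M. Y \<omega> = 0} + prob {\<omega> \<in> space M. 0 < Y \<omega>}"
    by (simp add: measure_Un_le)
  moreover have "prob {\<omega> \<in> space M. 0 < Y \<omega>} = 1 - prob {\<omega> \<in> space M. Y \<omega> \<le> 0}"
    using prob_neg[of "\<lambda>\<omega>. Y \<omega> \<le> 0"] by (simp add: not_le)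
  ultimately show "prob {\<omega> \<in> space M. Y \<omega> \<le> 0} \<le> 1 / 2" "prob {\<omega> \<in> space M. 0 \<le> Y \<omega>} \<le> 1 / 2"
    using sym zero by auto
qed

lemma borel_measurable_grid_level:
  assumes "\<And>k. f k \<in> borel_measurable M"
  shows "(\<lambda>\<omega>. grid_level N (\<lambda>k. f k \<omega>)) \<in> borel_measurable M"
  unfolding grid_level_def
  by (intro borel_measurable_Max borel_measurable_min borel_measurable_add borel_measurable_const borel_measurable_Min assms) auto

lemma grid_level_cong:
  assumes "\<And>k. k \<le> N \<Longrightarrow> x k = y k"
  shows "grid_level N x = grid_level N y"
proof -
  have "x ` {..k} = y ` {..k}" if "k \<le> N" for k using assms that by (intro image_cong) auto
  then show ?thesis unfolding grid_level_def using assms by (intro arg_cong[where f = Max] image_cong) auto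
qed

section \<open>The limit as a random variable\<close>

text \<open>Being defined for every path, convergent or not, it is a measurable function of the
  sample without reference to a random locking time; along a continuous path that locks it is the
  locked level.\<close>

definition final_level :: "(real \<Rightarrow> real) \<Rightarrow> real" where
  "final_level \<xi> = lim (\<lambda>n. grid_level (n * 2 ^ n) (\<lambda>k. \<xi> (real k / 2 ^ n)))"

context brownian_motion
begin

lemma increment_measurable:
  assumes "0 \<le> s" "0 \<le> t"
  shows "(\<lambda>\<omega>. B t \<omega> - B s \<omega>) \<in> borel_measurable M"
  using assms random_variable_at by (intro borel_measurable_diff) auto

text \<open>Remaining within \<open>k\<close> at all integer times has probability at most
  \<open>2 * k / sqrt n\<close> for every positive \<open>n\<close>, because the density of
  \<open>B n - B 0\<close> is at most \<open>1 / sqrt n\<close>.\<close>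

lemma AE_unbounded: "AE \<omega> in M. \<forall>K. \<exists>n::nat. K < \<bar>B (real n) \<omega>\<bar>"
proof -
  have "AE \<omega> in M. \<exists>n::nat. real k < \<bar>B (real n) \<omega> - B 0 \<omega>\<bar>" for k :: nat
  proof -
    let ?A = "\<lambda>n. {\<omega> \<in> space M. \<bar>B (real n) \<omega> - B 0 \<omega>\<bar> \<le> real k}"
    have A: "?A n \<in> events" for n using increment_measurable[of 0 "real n"] by measurable
    have le: "prob (\<Inter>n. ?A n) \<le> 2 * real k / sqrt (real (Suc n))" for n
    proof -
      have "distributed M lborel (\<lambda>\<omega>. B (real (Suc n)) \<omega> - B 0 \<omega>) (normal_density 0 (sqrt (real (Suc n) - 0)))"
        by (intro normal_increments) auto
      from normal_interval_prob_le[OF this, of "real k" 0]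
      have "prob (?A (Suc n)) \<le> 2 * real k / sqrt (real (Suc n))" by simp
      moreover have "(\<Inter>n. ?A n) \<subseteq> ?A (Suc n)" by blast
      then have "prob (\<Inter>n. ?A n) \<le> prob (?A (Suc n))" by (rule finite_measure_mono) (rule A)
      ultimately show ?thesis by simp
    qed
    have "(\<lambda>n. 2 * real k / sqrt (real (Suc n))) \<longlonglongrightarrow> 0"
      by real_asymp
    then have "prob (\<Inter>n. ?A n) \<le> 0"
      using le by (intro LIMSEQ_le_const) auto
    moreover have "(\<Inter>n. ?A n) \<in> events" using A by (intro sets.countable_INT') auto
    ultimately have "AE \<omega> in M. \<omega> \<notin> (\<Inter>n. ?A n)" by (intro AE_not_in_prob_le_0)
    then show ?thesis by (rule AE_mp) (auto intro!: AE_I2 simp: not_le)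
  qed
  then have "AE \<omega> in M. \<forall>k. \<exists>n::nat. real k < \<bar>B (real n) \<omega> - B 0 \<omega>\<bar>" by (simp add: AE_all_countable)
  with starts_at_0 show ?thesis
  proof eventually_elim
    case (elim \<omega>)
    show ?case
    proof
      fix K :: real
      obtain k :: nat where "K \<le> real k" using real_arch_simple by blast
      then show "\<exists>n::nat. K < \<bar>B (real n) \<omega>\<bar>" using elim(2)[rule_format, of k] by (auto simp: elim(1) intro: le_less_trans)
    qed
  qed
qed

lemma borel_measurable_final_level: "(\<lambda>\<omega>. final_level (\<lambda>t. B t \<omega>)) \<in> borel_measurable M"
  unfolding final_level_def
  by (intro borel_measurable_lim_metric borel_measurable_grid_level random_variable_at) auto

text \<open>Along the times \<open>0, h, h + 1 / 2 ^ n, ...\<close> the first increment is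
  \<open>B h - B 0\<close>, and the others determine all grid values of the restarted path.\<close>

lemma indep_grid_level:
  assumes h: "0 < h"
  shows "indep_var borel (\<lambda>\<omega>. grid_level (n * 2 ^ n) (\<lambda>k. B (h + real k / 2 ^ n) \<omega> - B h \<omega>))
    borel (\<lambda>\<omega>. B h \<omega> - B 0 \<omega>)"
proof -
  define N where "N = n * 2 ^ n"
  \<comment> \<open>The time \<open>0\<close> is put in front of the grid, so increment
    \<open>0\<close> spans \<open>[0, h]\<close> and the grid increments are numbered from
    \<open>1\<close>.\<close>
  define \<tau> where "\<tau> = (\<lambda>k::nat. case k of 0 \<Rightarrow> 0 | Suc j \<Rightarrow> h + real j / 2 ^ n)"
  have sm: "strict_mono \<tau>"
  proof (rule strict_monoI_Suc)
    fix k show "\<tau> k < \<tau> (Suc k)" using h by (cases k) (auto simp: \<tau>_def divide_strict_right_mono)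
  qed
  define D where "D = (\<lambda>i \<omega>. B (\<tau> (Suc i)) \<omega> - B (\<tau> i) \<omega>)"
  have "indep_vars (\<lambda>_. borel) D {..<Suc N}"
    unfolding D_def by (rule independent_increments[OF _ sm]) (simp add: \<tau>_def)
  then have ind: "indep_var (PiM {1..N} (\<lambda>_. borel)) (\<lambda>\<omega>. restrict (\<lambda>i. D i \<omega>) {1..N})
      (PiM {0} (\<lambda>_. borel)) (\<lambda>\<omega>. restrict (\<lambda>i. D i \<omega>) {0})"
    by (rule indep_var_restrict) auto
  \<comment> \<open>Truncation at \<open>N\<close> keeps the sums within the coordinates
    \<open>{1..N}\<close>; \<open>grid_level N\<close> evaluates only indices up to
    \<open>N\<close>, where it changes nothing.\<close>
  define F where "F = (\<lambda>f :: nat \<Rightarrow> real. grid_level N (\<lambda>k. \<Sum>i\<in>{1..min k N}. f i))"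
  have F: "F \<in> borel_measurable (PiM {1..N} (\<lambda>_. borel))"
    unfolding F_def by (intro borel_measurable_grid_level borel_measurable_sum measurable_component_singleton) auto
  have P: "(\<lambda>f. f 0) \<in> measurable (PiM {0::nat} (\<lambda>_. borel :: real measure)) borel"
    by (intro measurable_component_singleton) simp
  have tele: "(\<Sum>i\<in>{1..k}. D i \<omega>) = B (h + real k / 2 ^ n) \<omega> - B h \<omega>" for k \<omega>
  proof (induction k)
    case (Suc k)
    have "(\<Sum>i\<in>{1..Suc k}. D i \<omega>) = (\<Sum>i\<in>{1..k}. D i \<omega>) + D (Suc k) \<omega>" by simp
    then show ?case using Suc by (simp add: D_def \<tau>_def)
  qed simp
  have 1: "(F \<circ> (\<lambda>\<omega>. restrict (\<lambda>i. D i \<omega>) {1..N})) = (\<lambda>\<omega>. grid_level N (\<lambda>k. B (h + real k / 2 ^ n) \<omega> - B h \<omega>))"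
  proof
    fix \<omega>
    show "(F \<circ> (\<lambda>\<omega>. restrict (\<lambda>i. D i \<omega>) {1..N})) \<omega> = grid_level N (\<lambda>k. B (h + real k / 2 ^ n) \<omega> - B h \<omega>)"
      unfolding o_def F_def
    proof (rule grid_level_cong)
      fix k assume "k \<le> N"
      then have "(\<Sum>i\<in>{1..min k N}. restrict (\<lambda>i. D i \<omega>) {1..N} i) = (\<Sum>i\<in>{1..k}. D i \<omega>)"
        by (intro sum.cong) auto
      then show "(\<Sum>i\<in>{1..min k N}. restrict (\<lambda>i. D i \<omega>) {1..N} i) = B (h + real k / 2 ^ n) \<omega> - B h \<omega>"
        by (simp only: tele)
    qed
  qed
  have 2: "((\<lambda>f. f 0) \<circ> (\<lambda>\<omega>. restrict (\<lambda>i. D i \<omega>) {0})) = (\<lambda>\<omega>. B h \<omega> - B 0 \<omega>)"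
    by (auto simp: D_def \<tau>_def)
  show ?thesis
    using indep_var_compose[OF ind F P] unfolding 1 2 by (simp only: N_def)
qed

text \<open>Such convergence would eventually put the grid level plus the increment within every
  \<open>e\<close> of \<open>c\<close>. By independence and the bounded density of the increment
  this has probability at most \<open>2 * e / sqrt h\<close>.\<close>

lemma AE_grid_level_not_tendsto:
  assumes h: "0 < h"
  shows "AE \<omega> in M. \<not> (\<lambda>n. grid_level (n * 2 ^ n) (\<lambda>k. B (h + real k / 2 ^ n) \<omega> - B h \<omega>)) \<longlonglongrightarrow> c - (B h \<omega> - B 0 \<omega>)"
proof -
  let ?X = "\<lambda>n \<omega>. grid_level (n * 2 ^ n) (\<lambda>k. B (h + real k / 2 ^ n) \<omega> - B h \<omega>)"
  let ?Y = "\<lambda>\<omega>. B h \<omega> - B 0 \<omega>"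
  let ?A = "\<lambda>e n. {\<omega> \<in> space M. \<bar>?X n \<omega> + ?Y \<omega> - c\<bar> \<le> e}"
  let ?S = "\<lambda>e. \<Union>N. \<Inter>n\<in>{N..}. ?A e n"
  have mX: "?X n \<in> borel_measurable M" for n
    using h by (intro borel_measurable_grid_level increment_measurable) auto
  have mY: "?Y \<in> borel_measurable M" using h by (intro increment_measurable) auto
  have A: "?A e n \<in> events" for e n using mX[of n] mY by measurable
  have S: "?S e \<in> events" for e using A by (intro sets.countable_UN sets.countable_INT') auto
  have bound: "prob (?S e) \<le> 2 * e / sqrt h" if "0 \<le> e" for e
  proof (rule prob_eventually_le[OF A])
    have "distributed M lborel ?Y (normal_density 0 (sqrt (h - 0)))" using h by (intro normal_increments) auto
    then show "prob (?A e n) \<le> 2 * e / sqrt h" for n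
      using h that indep_grid_level[OF h, of n] by (intro normal_sum_interval_le[where \<mu> = 0]) auto
  qed
  let ?Z = "\<Inter>j. ?S (1 / real (Suc j))"
  have "prob ?Z \<le> 2 * (1 / real (Suc j)) / sqrt h" for j
  proof -
    have "prob ?Z \<le> prob (?S (1 / real (Suc j)))" using S by (intro finite_measure_mono) auto
    also have "\<dots> \<le> 2 * (1 / real (Suc j)) / sqrt h" by (rule bound) simp
    finally show ?thesis .
  qed
  moreover have "(\<lambda>j. 2 * (1 / real (Suc j)) / sqrt h) \<longlonglongrightarrow> 0"
    using tendsto_mult_left[OF LIMSEQ_inverse_real_of_nat, of "2 / sqrt h"] by (simp add: inverse_eq_divide mult.commute)
  ultimately have "prob ?Z \<le> 0" by (intro LIMSEQ_le_const) auto
  moreover have "?Z \<in> events" using S by (intro sets.countable_INT') auto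
  ultimately have "AE \<omega> in M. \<omega> \<notin> ?Z" by (intro AE_not_in_prob_le_0)
  then show ?thesis
  proof (rule AE_mp, intro AE_I2 impI notI)
    fix \<omega> assume \<omega>: "\<omega> \<in> space M" "\<omega> \<notin> ?Z" and lim: "(\<lambda>n. ?X n \<omega>) \<longlonglongrightarrow> c - ?Y \<omega>"
    have "\<omega> \<in> ?S (1 / real (Suc j))" for j
    proof -
      have "0 < 1 / real (Suc j)" by simp
      from LIMSEQ_D[OF lim this] obtain N where "\<And>n. N \<le> n \<Longrightarrow> norm (?X n \<omega> - (c - ?Y \<omega>)) < 1 / real (Suc j)" by blast
      then have "\<And>n. N \<le> n \<Longrightarrow> \<bar>?X n \<omega> + ?Y \<omega> - c\<bar> \<le> 1 / real (Suc j)"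
        by (smt (verit) real_norm_def)
      then show ?thesis using \<omega>(1) by blast
    qed
    then show False using \<omega>(2) by blast
  qed
qed

text \<open>For each index the sign condition has probability at most \<open>1 / 2\<close>, hence so
  does its validity from some index on.\<close>

lemma not_AE_eventually_one_sided:
  assumes pos: "\<And>m. 0 < h m"
  shows "\<not> (AE \<omega> in M. \<exists>k::nat. \<forall>m\<ge>k. B (h m) \<omega> - B 0 \<omega> \<le> 0)"
    "\<not> (AE \<omega> in M. \<exists>k::nat. \<forall>m\<ge>k. 0 \<le> B (h m) \<omega> - B 0 \<omega>)"
proof -
  have meas: "(\<lambda>\<omega>. B (h m) \<omega> - B 0 \<omega>) \<in> borel_measurable M" for m
    using pos[of m] by (intro increment_measurable) auto
  have dist: "distributed M lborel (\<lambda>\<omega>. B (h m) \<omega> - B 0 \<omega>) (normal_density 0 (sqrt (h m - 0)))" for m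
    using pos[of m] by (intro normal_increments) auto
  have *: "\<not> (AE \<omega> in M. \<exists>k. \<forall>m\<ge>k. Q m \<omega>)"
    if Q: "\<And>m. {\<omega> \<in> space M. Q m \<omega>} \<in> events" "\<And>m. prob {\<omega> \<in> space M. Q m \<omega>} \<le> 1 / 2" for Q :: "nat \<Rightarrow> 'w \<Rightarrow> bool"
  proof
    assume ae: "AE \<omega> in M. \<exists>k. \<forall>m\<ge>k. Q m \<omega>"
    let ?S = "\<Union>N. \<Inter>n\<in>{N..}. {\<omega> \<in> space M. Q n \<omega>}"
    have S: "?S \<in> events" using Q(1) by (intro sets.countable_UN sets.countable_INT') auto
    have "AE \<omega> in M. \<omega> \<in> ?S" using ae by (rule AE_mp) (auto intro!: AE_I2)
    then have "prob ?S = 1" using S by (simp add: prob_eq_1)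
    moreover have "prob ?S \<le> 1 / 2" by (rule prob_eventually_le[OF Q])
    ultimately show False by simp
  qed
  show "\<not> (AE \<omega> in M. \<exists>k::nat. \<forall>m\<ge>k. B (h m) \<omega> - B 0 \<omega> \<le> 0)"
  proof (rule *)
    show "{\<omega> \<in> space M. B (h m) \<omega> - B 0 \<omega> \<le> 0} \<in> events" for m using meas[of m] by measurable
    show "prob {\<omega> \<in> space M. B (h m) \<omega> - B 0 \<omega> \<le> 0} \<le> 1 / 2" for m
      using normal_nonpos_prob(1)[OF dist] pos[of m] by simp
  qed
  show "\<not> (AE \<omega> in M. \<exists>k::nat. \<forall>m\<ge>k. 0 \<le> B (h m) \<omega> - B 0 \<omega>)"
  proof (rule *)
    show "{\<omega> \<in> space M. 0 \<le> B (h m) \<omega> - B 0 \<omega>} \<in> events" for m using meas[of m] by measurable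
    show "prob {\<omega> \<in> space M. 0 \<le> B (h m) \<omega> - B 0 \<omega>} \<le> 1 / 2" for m
      using normal_nonpos_prob(2)[OF dist] pos[of m] by simp
  qed
qed

end


section \<open>Convergence and non-constancy\<close>

text \<open>Uniqueness lets one limit serve all solutions with the given initial datum; if there is
  none, the claim is vacuous.\<close>

lemma pathwise_common_limit:
  fixes H :: "real^'d \<Rightarrow> real"
  assumes H: "hamiltonian H" and B: "continuous_on {0..} B" "B 0 = 0" and unb: "\<And>K. \<exists>n::nat. K < \<bar>B (real n)\<bar>"
  shows "\<exists>l. \<forall>u. pathwise_solution H B u0 u \<and> space_periodic u \<and> BUC_on (UNIV \<times> {0..}) u \<longrightarrow>
    uniform_limit UNIV (\<lambda>t x. u (x, t)) (\<lambda>x. l) at_top"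
proof (cases "\<exists>u. pathwise_solution H B u0 u \<and> space_periodic u \<and> BUC_on (UNIV \<times> {0..}) u")
  case True
  then obtain u where u: "pathwise_solution H B u0 u" "space_periodic u" "BUC_on (UNIV \<times> {0..}) u" by blast
  obtain l where l: "uniform_limit UNIV (\<lambda>t x. u (x, t)) (\<lambda>x. l) at_top"
    using pathwise_solution_converges[OF H u(1) B unb u(2,3)] by blast
  show ?thesis
  proof (intro exI[of _ l] allI impI, elim conjE)
    fix w assume w: "pathwise_solution H B u0 w"
    have "\<forall>\<^sub>F t in at_top. \<forall>x\<in>UNIV. u (x, t) = w (x, t)"
      using eventually_ge_at_top[of 0] by eventually_elim (simp add: pathwise_solution_unique[OF H u(1) w])
    then show "uniform_limit UNIV (\<lambda>t x. w (x, t)) (\<lambda>x. l) at_top"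
      using l by (subst (asm) uniform_limit_cong) auto
  qed
qed blast

lemma final_level_eq:
  assumes "continuous_on {0..} \<xi>" "locked_by \<xi> T"
  shows "final_level \<xi> = locked_level \<xi> T"
  unfolding final_level_def by (rule limI[OF grid_level_tendsto[OF assms]])

text \<open>\<open>X\<close> is the locked level of the path restarted at \<open>h\<close>.
  Presenting it as a limit of grid values makes its independence of the increment up to
  \<open>h\<close> usable.\<close>

lemma final_level_restart:
  assumes c: "continuous_on {0..} \<xi>" and \<xi>0: "\<xi> 0 = 0" and unb: "\<And>K. \<exists>n::nat. K < \<bar>\<xi> (real n)\<bar>"
    and h: "0 \<le> h"
  shows "\<exists>X. (\<lambda>n. grid_level (n * 2 ^ n) (\<lambda>k. \<xi> (h + real k / 2 ^ n) - \<xi> h)) \<longlonglongrightarrow> X \<and>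
    final_level \<xi> = max (locked_level \<xi> h) (min (1 / 2 + running_min \<xi> h) (\<xi> h + X))"
proof -
  define \<zeta> where "\<zeta> = (\<lambda>r. \<xi> (h + r) - \<xi> h)"
  have b: "bounded_path \<xi>" by (rule continuous_imp_bounded_path[OF c])
  have c\<zeta>: "continuous_on {0..} \<zeta>"
    unfolding \<zeta>_def using h by (intro continuous_intros continuous_on_compose2[OF c]) auto
  have b\<zeta>: "bounded_path \<zeta>" by (rule continuous_imp_bounded_path[OF c\<zeta>])
  have "continuous_on {0..h} \<xi>" by (auto intro: continuous_on_subset[OF c])
  then obtain K where K: "\<And>r. r \<in> {0..h} \<Longrightarrow> \<bar>\<xi> r\<bar> \<le> K" using compact_continuous_bound[OF compact_Icc] by metis
  \<comment> \<open>A value this large cannot occur up to time \<open>h\<close>, and it differs from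
    \<open>\<xi> h\<close> by more than \<open>1 / 2\<close>, so the restarted path is locked at
    \<open>real n - h\<close>.\<close>
  obtain n :: nat where n: "K + \<bar>\<xi> h\<bar> + 1 / 2 < \<bar>\<xi> (real n)\<bar>" using unb by blast
  have "h \<le> real n"
  proof (rule ccontr)
    assume "\<not> h \<le> real n"
    then have "\<bar>\<xi> (real n)\<bar> \<le> K" by (intro K) auto
    then show False using n by linarith
  qed
  moreover have "0 \<le> K" using K[of h] h by auto
  moreover from this have "1 / 2 \<le> \<bar>\<xi> (real n) - \<xi> h\<bar>" using n by linarith
  ultimately have T': "locked_by \<zeta> (real n - h)"
    by (intro locked_byI[OF b\<zeta>]) (auto simp: \<zeta>_def)
  obtain n2 :: nat where n2: "1 / 2 < \<bar>\<xi> (real n2)\<bar>" using unb by blast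
  have T: "locked_by \<xi> (real n2)" using n2 by (intro locked_byI[OF b \<xi>0]) auto
  define t where "t = max (real n - h) (real n2)"
  have t: "real n - h \<le> t" "real n2 \<le> h + t" "0 \<le> t" using h by (auto simp: t_def)
  have "final_level \<xi> = locked_level \<xi> (h + t)"
    using final_level_eq[OF c T] locked_level_constant[OF b T t(2)] by simp
  also have "\<dots> = max (locked_level \<xi> h) (min (1 / 2 + running_min \<xi> h) (\<xi> h + locked_level \<zeta> t))"
    unfolding \<zeta>_def by (rule locked_level_restart[OF b h t(3)])
  also have "locked_level \<zeta> t = locked_level \<zeta> (real n - h)" by (rule locked_level_constant[OF b\<zeta> T' t(1)])
  finally show ?thesis
    using grid_level_tendsto[OF c\<zeta> T'] by (intro exI[of _ "locked_level \<zeta> (real n - h)"]) (simp add: \<zeta>_def)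
qed

text \<open>Up to \<open>h\<close> the locked level is at most \<open>\<delta>\<close> and the cap
  at least \<open>1 / 2 - \<delta>\<close>, so a value strictly between comes from the middle term
  of the restart formula. A value at most \<open>0\<close> bounds the locked level at
  \<open>h\<close>, and with it \<open>\<xi> h\<close>, by \<open>0\<close>; a value at least
  \<open>1 / 2\<close> forces the running minimum up to be nonnegative.\<close>

lemma final_level_small_start:
  assumes c: "continuous_on {0..} \<xi>" and \<xi>0: "\<xi> 0 = 0" and unb: "\<And>K. \<exists>n::nat. K < \<bar>\<xi> (real n)\<bar>"
    and h: "0 \<le> h" and small: "\<And>r. 0 \<le> r \<Longrightarrow> r \<le> h \<Longrightarrow> \<bar>\<xi> r\<bar> \<le> \<delta>" and \<delta>: "\<delta> < 1 / 2"
  shows "\<delta> < final_level \<xi> \<Longrightarrow> final_level \<xi> < 1 / 2 - \<delta> \<Longrightarrow>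
      (\<lambda>n. grid_level (n * 2 ^ n) (\<lambda>k. \<xi> (h + real k / 2 ^ n) - \<xi> h)) \<longlonglongrightarrow> final_level \<xi> - \<xi> h"
    and "final_level \<xi> \<le> 0 \<Longrightarrow> \<xi> h \<le> 0"
    and "1 / 2 \<le> final_level \<xi> \<Longrightarrow> 0 \<le> \<xi> h"
proof -
  have b: "bounded_path \<xi>" by (rule continuous_imp_bounded_path[OF c])
  obtain X where X: "(\<lambda>n. grid_level (n * 2 ^ n) (\<lambda>k. \<xi> (h + real k / 2 ^ n) - \<xi> h)) \<longlonglongrightarrow> X"
    and eq: "final_level \<xi> = max (locked_level \<xi> h) (min (1 / 2 + running_min \<xi> h) (\<xi> h + X))"
    using final_level_restart[OF c \<xi>0 unb h] by blast
  have up: "locked_level \<xi> h \<le> \<delta>"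
  proof (rule locked_level_least[OF h])
    fix s assume "0 \<le> s" "s \<le> h"
    then show "min (\<xi> s) (1 / 2 + running_min \<xi> s) \<le> \<delta>" using small[of s] by auto
  qed
  have low: "- \<delta> \<le> running_min \<xi> h"
    using small by (intro running_min_greatest[OF h]) (auto simp: abs_le_iff minus_le_iff)
  have low': "min (\<xi> h) (1 / 2 + running_min \<xi> h) \<le> locked_level \<xi> h" by (rule locked_level_ge[OF b h order_refl])
  show "(\<lambda>n. grid_level (n * 2 ^ n) (\<lambda>k. \<xi> (h + real k / 2 ^ n) - \<xi> h)) \<longlonglongrightarrow> final_level \<xi> - \<xi> h"
    if "\<delta> < final_level \<xi>" "final_level \<xi> < 1 / 2 - \<delta>"
  proof -
    have "X = final_level \<xi> - \<xi> h" using eq that up low by (auto simp: max_def min_def split: if_splits)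
    then show ?thesis using X by simp
  qed
  show "\<xi> h \<le> 0" if "final_level \<xi> \<le> 0"
  proof -
    have "locked_level \<xi> h \<le> 0" using eq that by simp
    then show ?thesis using low' low \<delta> by (auto simp: min_def split: if_splits)
  qed
  show "0 \<le> \<xi> h" if "1 / 2 \<le> final_level \<xi>"
  proof -
    have "0 \<le> running_min \<xi> h" using eq that up \<delta> by (auto simp: max_def min_def split: if_splits)
    then show ?thesis using running_min_le[OF b h order_refl] by linarith
  qed
qed

lemma (in brownian_motion) final_level_not_constant:
  "\<not> (AE \<omega> in M. final_level (\<lambda>t. B t \<omega>) = c)"
proof
  assume const: "AE \<omega> in M. final_level (\<lambda>t. B t \<omega>) = c"
  \<comment> \<open>How long the path stays small depends on \<open>\<omega>\<close>, so no single
    time suffices. A sequence tending to \<open>0\<close> allows a choice for each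
    \<open>\<omega>\<close>, with only countably many null sets.\<close>
  define h where "h = (\<lambda>m. 1 / real (Suc m))"
  have h: "0 < h m" for m by (simp add: h_def)
  have small: "\<exists>k. \<forall>m\<ge>k. \<forall>r. 0 \<le> r \<longrightarrow> r \<le> h m \<longrightarrow> \<bar>B r \<omega>\<bar> \<le> \<delta>"
    if "continuous_on {0..} (\<lambda>t. B t \<omega>)" "B 0 \<omega> = 0" and \<delta>: "0 < \<delta>" for \<omega> \<delta>
  proof -
    have "(0::real) \<in> {0..}" by simp
    from that(1)[unfolded continuous_on_iff, THEN bspec, OF this, rule_format, OF \<delta>]
    obtain d where d: "0 < d" "\<forall>r\<in>{0..}. dist r 0 < d \<longrightarrow> dist (B r \<omega>) (B 0 \<omega>) < \<delta>" by (elim exE conjE)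
    obtain k where k: "1 / real (Suc k) < d" by (rule nat_approx_posE[OF d(1)])
    show ?thesis
    proof (intro exI[of _ k] allI impI)
      fix m r assume r: "k \<le> m" "0 \<le> r" "r \<le> h m"
      have "h m \<le> 1 / real (Suc k)" unfolding h_def using r(1) by (intro divide_left_mono) auto
      then have "dist r 0 < d" using k r by simp
      then show "\<bar>B r \<omega>\<bar> \<le> \<delta>" using d(2)[rule_format, of r] r that(2) by simp
    qed
  qed
  consider "c \<le> 0" | "1 / 2 \<le> c" | "0 < c" "c < 1 / 2" by linarith
  then show False
  proof cases
    case 1
    have "AE \<omega> in M. \<exists>k::nat. \<forall>m\<ge>k. B (h m) \<omega> - B 0 \<omega> \<le> 0"
      using const starts_at_0 continuous_paths AE_unbounded
    proof eventually_elim
      case (elim \<omega>)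
      obtain k where k: "\<forall>m\<ge>k. \<forall>r. 0 \<le> r \<longrightarrow> r \<le> h m \<longrightarrow> \<bar>B r \<omega>\<bar> \<le> 1 / 4"
        using small[OF elim(3,2), of "1 / 4"] by auto
      have "B (h m) \<omega> \<le> 0" if "k \<le> m" for m
        using elim(1,4) 1 k that h[of m] by (intro final_level_small_start(2)[OF elim(3,2), of "h m" "1 / 4"]) auto
      then show ?case using elim(2) by auto
    qed
    then show False using not_AE_eventually_one_sided(1)[of h] h by blast
  next
    case 2
    have "AE \<omega> in M. \<exists>k::nat. \<forall>m\<ge>k. 0 \<le> B (h m) \<omega> - B 0 \<omega>"
      using const starts_at_0 continuous_paths AE_unbounded
    proof eventually_elim
      case (elim \<omega>)
      obtain k where k: "\<forall>m\<ge>k. \<forall>r. 0 \<le> r \<longrightarrow> r \<le> h m \<longrightarrow> \<bar>B r \<omega>\<bar> \<le> 1 / 4"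
        using small[OF elim(3,2), of "1 / 4"] by auto
      have "0 \<le> B (h m) \<omega>" if "k \<le> m" for m
        using elim(1,4) 2 k that h[of m] by (intro final_level_small_start(3)[OF elim(3,2), of "h m" "1 / 4"]) auto
      then show ?case using elim(2) by auto
    qed
    then show False using not_AE_eventually_one_sided(2)[of h] h by blast
  next
    case 3
    have "0 < min c (1 / 2 - c)" using 3 by simp
    \<comment> \<open>This puts \<open>c\<close> strictly between \<open>\<delta>\<close> and
      \<open>1 / 2 - \<delta>\<close>, where the restart formula reduces to its middle term.\<close>
    then obtain \<delta> where "0 < \<delta>" "\<delta> < min c (1 / 2 - c)" using dense by blast
    then have \<delta>: "0 < \<delta>" "\<delta> < c" "c < 1 / 2 - \<delta>" by (simp_all add: less_diff_eq add.commute)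
    have "AE \<omega> in M. \<forall>m. \<not> (\<lambda>n. grid_level (n * 2 ^ n) (\<lambda>k. B (h m + real k / 2 ^ n) \<omega> - B (h m) \<omega>)) \<longlonglongrightarrow> c - (B (h m) \<omega> - B 0 \<omega>)"
      using AE_grid_level_not_tendsto[OF h] by (simp add: AE_all_countable)
    with const starts_at_0 continuous_paths AE_unbounded have "AE \<omega> in M. False"
    proof eventually_elim
      case (elim \<omega>)
      obtain k where k: "\<forall>m\<ge>k. \<forall>r. 0 \<le> r \<longrightarrow> r \<le> h m \<longrightarrow> \<bar>B r \<omega>\<bar> \<le> \<delta>"
        using small[OF elim(3,2) \<delta>(1)] by auto
      have "(\<lambda>n. grid_level (n * 2 ^ n) (\<lambda>j. B (h k + real j / 2 ^ n) \<omega> - B (h k) \<omega>)) \<longlonglongrightarrow> final_level (\<lambda>t. B t \<omega>) - B (h k) \<omega>"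
        using elim(1,4) \<delta> k h[of k] by (intro final_level_small_start(1)[OF elim(3,2), of "h k" \<delta>]) auto
      then show False using elim(5)[rule_format, of k] by (simp add: elim(1,2))
    qed
    then show False by simp
  qed
qed

theorem theorem7p12:
  fixes M :: "'w measure" and B :: "real \<Rightarrow> 'w \<Rightarrow> real"
  assumes "brownian_motion M B"
  shows
    "(\<forall>H :: real^'d \<Rightarrow> real. hamiltonian H \<longrightarrow>
        (AE \<omega> in M. \<forall>u0. \<exists>uinf. \<forall>u.
           pathwise_solution H (\<lambda>t. B t \<omega>) u0 u \<and> space_periodic u \<and> BUC_on (UNIV \<times> {0..}) u \<longrightarrow>
           uniform_limit UNIV (\<lambda>t x. u (x, t)) (\<lambda>x. uinf) at_top)) \<and>
     (\<exists>(H :: real^'d \<Rightarrow> real) u0 uinf.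
        hamiltonian H \<and> BUC_on UNIV u0 \<and> (\<exists>P. periodic_wrt P u0) \<and>
        uinf \<in> borel_measurable M \<and>
        (AE \<omega> in M.
           (\<exists>u. pathwise_solution H (\<lambda>t. B t \<omega>) u0 u \<and> space_periodic u \<and>
                BUC_on (UNIV \<times> {0..}) u) \<and>
           (\<forall>u. pathwise_solution H (\<lambda>t. B t \<omega>) u0 u \<and> space_periodic u \<and>
                BUC_on (UNIV \<times> {0..}) u \<longrightarrow>
                uniform_limit UNIV (\<lambda>t x. u (x, t)) (\<lambda>x. uinf \<omega>) at_top)) \<and>
        \<not> (\<exists>c. AE \<omega> in M. uinf \<omega> = c))"
proof -
  interpret brownian_motion M B by fact
  have limits: "AE \<omega> in M. \<forall>u0. \<exists>uinf. \<forall>u.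
           pathwise_solution H (\<lambda>t. B t \<omega>) u0 u \<and> space_periodic u \<and> BUC_on (UNIV \<times> {0..}) u \<longrightarrow>
           uniform_limit UNIV (\<lambda>t x. u (x, t)) (\<lambda>x. uinf) at_top" if "hamiltonian H" for H :: "real^'d \<Rightarrow> real"
    using starts_at_0 continuous_paths AE_unbounded
  proof eventually_elim
    case (elim \<omega>)
    show ?case using pathwise_common_limit[OF that elim(2,1)] elim(3) by blast
  qed
  \<comment> \<open>Any coordinate will do; the index type is nonempty.\<close>
  obtain i :: 'd where True by blast
  let ?u0 = "\<lambda>x::real^'d. tent (x $ i)"
  let ?uinf = "\<lambda>\<omega>. final_level (\<lambda>t. B t \<omega>)"
  have example: "AE \<omega> in M.
           (\<exists>u. pathwise_solution norm (\<lambda>t. B t \<omega>) ?u0 u \<and> space_periodic u \<and> BUC_on (UNIV \<times> {0..}) u) \<and>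
           (\<forall>u. pathwise_solution norm (\<lambda>t. B t \<omega>) ?u0 u \<and> space_periodic u \<and> BUC_on (UNIV \<times> {0..}) u \<longrightarrow>
                uniform_limit UNIV (\<lambda>t x. u (x, t)) (\<lambda>x. ?uinf \<omega>) at_top)"
    using starts_at_0 continuous_paths AE_unbounded limits[OF hamiltonian_norm]
  proof eventually_elim
    case (elim \<omega>)
    let ?\<xi> = "\<lambda>t. B t \<omega>"
    have b: "bounded_path ?\<xi>" by (rule continuous_imp_bounded_path[OF elim(2)])
    obtain n :: nat where "1 / 2 < \<bar>?\<xi> (real n)\<bar>" using elim(3) by blast
    then have T: "locked_by ?\<xi> (real n)" by (intro locked_byI[OF b elim(1)]) auto
    have u: "pathwise_solution norm ?\<xi> ?u0 (tent_solution i ?\<xi>)" "space_periodic (tent_solution i ?\<xi>)"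
      "BUC_on (UNIV \<times> {0..}) (tent_solution i ?\<xi>)"
      using tent_solution_pathwise[OF elim(2,1)] tent_solution_space_periodic tent_solution_BUC_global[OF elim(2) T] by auto
    have lim: "uniform_limit UNIV (\<lambda>t x. tent_solution i ?\<xi> (x, t)) (\<lambda>x. ?uinf \<omega>) at_top"
      using tent_solution_limit[OF b T, of i] final_level_eq[OF elim(2) T] by simp
    obtain l where l: "\<And>u. pathwise_solution norm ?\<xi> ?u0 u \<Longrightarrow> space_periodic u \<Longrightarrow> BUC_on (UNIV \<times> {0..}) u \<Longrightarrow>
        uniform_limit UNIV (\<lambda>t x. u (x, t)) (\<lambda>x. l) at_top"
      using elim(4) by metis
    \<comment> \<open>The explicit solution is among those converging to \<open>l\<close>, so
      uniqueness of limits identifies \<open>l\<close>, and with it the limit of every other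
      solution.\<close>
    have "l = ?uinf \<omega>"
      using tendsto_uniform_limitI[OF l[OF u], of 0] tendsto_uniform_limitI[OF lim, of 0]
      by (intro tendsto_unique[OF trivial_limit_at_top_linorder]) auto
    then show ?case using u l by blast
  qed
  show ?thesis
  proof (intro conjI allI impI, rule limits, assumption, intro exI conjI)
    show "hamiltonian (norm :: real^'d \<Rightarrow> real)" by (rule hamiltonian_norm)
    show "BUC_on UNIV ?u0" by (rule tent_BUC)
    show "periodic_wrt Basis ?u0" by (rule tent_periodic_wrt)
    show "?uinf \<in> borel_measurable M" by (rule borel_measurable_final_level)
    show "\<not> (\<exists>c. AE \<omega> in M. ?uinf \<omega> = c)" using final_level_not_constant by blast
  qed (rule example)
qed

end
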